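(* Let $\sigma$ be a genuine smooth irreducible representation of $\widetilde H$ and let $\psi$ be a non-trivial character of $F$. An Slcm (Shahidi local coefficients matrix) associated with $\sigma$ and $\psi$ is unique up to conjugation by complex matrices: any two Slcms associated with $\psi$ and the isomorphism class of $\sigma$ (formed using possibly different realizations $(\sigma,V)$ of this class and possibly different ordered bases $R$ of $V^*$) are conjugate by an invertible matrix with complex entries, independent of $s$. Consequently, the conjugacy class of an Slcm associated with $\sigma$ and $\psi$ is a well defined invariant of $\psi$ and of the isomorphism class of $\sigma$.
   Context: $F$ is a finite extension of $\mathbb Q_p$ with ring of integers $\mathbb O_F$, maximal ideal $\mathbb P_F=\varpi\mathbb O_F$, residue cardinality $q$, and absolute value normalized by $|\varpi|=q^{-1}$. Fix $n\ge1$ such that $F^*$ contains the full group $\mu_n$ of $n$-th roots of $1$ (identified with the $n$-th roots of $1$ in $\mathbb C^*$); $(\cdot,\cdot)_n$ is the $n$-th power Hilbert symbol; $d=n$ if $n$ is odd, $d=n/2$ if $n$ is even. Let $G=\mathrm{SL}_2(F)$, $n(x)=\begin{pmatrix}1&x\\0&1\end{pmatrix}$, $h(a)=\begin{pmatrix}a&0\\0&a^{-1}\end{pmatrix}$, $w_0=\begin{pmatrix}0&1\\-1&0\end{pmatrix}$, $N=\{n(x)\}$, $H=\{h(a)\}$, $B=HN$. Kubota's $n$-fold cover $\widetilde G$ is the set $G\times\mu_n$ with product $(g,\epsilon)(g',\epsilon')=(gg',c(g,g')\epsilon\epsilon')$, $c(g,g')=\bigl(x(gg')x(g)^{-1},x(gg')x(g')^{-1}\bigr)_n$,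 where $x\begin{pmatrix}a&b\\c&d\end{pmatrix}$ equals $c$ if $c\ne0$ and $d$ (the lower right entry) if $c=0$; it is a topological group in which, for $l\gg0$, the sets $\{(g,1): g\in \mathrm{SL}_2(\mathbb O_F),\ g\equiv I_2 \bmod \mathbb P_F^l\}$ are a basis of neighborhoods of the identity. For $A\subset G$, $\widetilde A$ is its inverse image; $N$ is embedded by $u\mapsto(u,1)$; $w=(w_0,1)$. A representation of a subgroup of $\widetilde G$ containing $\mu_n$ is genuine if $\mu_n$ acts by the fixed injection $\mu_n\hookrightarrow\mathbb C^*$. Let $(\sigma,V)$ be a genuine smooth irreducible representation of $\widetilde H$ (of dimension $\sqrt{[F^*:{F^*}^d]}$), $V^*$ the space of linear functionals on $V$. For $t=(h(a),\epsilon)$ put $|t|=|a|$; for $s\in\mathbb C$, $\sigma_s(t)=|t|^s\sigma(t)$ and $\sigma^w(t)=\sigma(wtw^{-1})$, both acting on $V$. $I(\sigma)$ is the space of smooth $f:\widetilde G\to V$ with $f(tug)=|t|\sigma(t)f(g)$ for $t\in\widetilde H$, $u\in N$, with $\widetilde G$ acting by right translation. For $f\in I(\sigma)$, $f_s\in I(\sigma_s)$ is defined by $f_s(tuk)=|t|^sf(tuk)$ for $t\in \widetilde H$, $u\in N$, $k\in\widetilde{\mathrm{SL}_2(\mathbb O_F)}$. The intertwining operator $A_w(\sigma_s):I(\sigma_s)\to I((\sigma_s)^w)$ is the meromorphic continuation of $(A_w(\sigma_s)f_s)(g)=\int_Ff_s(wn(x)g)\,d_\psi x$, with $d_\psi x$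 the $\psi$-self-dual Haar measure. $\mathrm{Wh}_\psi(\pi)=\mathrm{Hom}_N(\pi,\mathbb C_\psi)$, where $\psi(n(x))=\psi(x)$. For $\xi\in V^*$, $J_{\sigma_s,\psi}(\xi)\in\mathrm{Wh}_\psi(I(\sigma_s))$ is the analytic continuation of $f_s\mapsto\int_F\xi\bigl(f_s(wn(x))\bigr)\psi^{-1}(x)\,d_\psi x$; $J_{\sigma_s,\psi}$ is an isomorphism $V^*\to\mathrm{Wh}_\psi(I(\sigma_s))$, and likewise $J_{(\sigma_s)^w,\psi}:V^*\to\mathrm{Wh}_\psi(I((\sigma_s)^w))$. Let $A_w^\psi(\sigma_s):\mathrm{Wh}_\psi(I((\sigma_s)^w))\to\mathrm{Wh}_\psi(I(\sigma_s))$, $\lambda\mapsto\lambda\circ A_w(\sigma_s)$. An Slcm associated with $\sigma$ and $\psi$ is the $\sqrt{[F^*:{F^*}^d]}\times\sqrt{[F^*:{F^*}^d]}$ matrix (with entries functions of $s$) representing $A_w^\psi(\sigma_s)$ with respect to the ordered bases $J_{(\sigma_s)^w,\psi}(R)$ and $J_{\sigma_s,\psi}(R)$, where $R$ is an ordered basis of $V^*$ (the same $R$ for both). *)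

theory Defs
  imports
    "HOL-Complex_Analysis.Complex_Analysis"
    "HOL-Algebra.Algebraic_Closure_Type"
begin

section \<open>p-adic fields\<close>

definition int_ring :: "('f::field_char_0 \<Rightarrow> real) \<Rightarrow> 'f set" where
  "int_ring absv = {x. absv x \<le> 1}"

definition max_ideal :: "('f::field_char_0 \<Rightarrow> real) \<Rightarrow> 'f set" where
  "max_ideal absv = {x. absv x < 1}"

definition residue_card :: "('f::field_char_0 \<Rightarrow> real) \<Rightarrow> nat" where
  "residue_card absv = card ((\<lambda>x. {y. y - x \<in> max_ideal absv}) ` int_ring absv)"

definition uniformizer :: "('f::field_char_0 \<Rightarrow> real) \<Rightarrow> 'f \<Rightarrow> bool" where
  "uniformizer absv \<pi> \<longleftrightarrow> \<pi> \<noteq> 0 \<and> max_ideal absv = (\<lambda>y. \<pi> * y) ` int_ring absv"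

text \<open>The closure of the rationals. In \<open>padic_field\<close> below, rational Cauchy sequences converge
  and the absolute value of \<open>p\<close> is less than 1, so this is a copy of the field of \<open>p\<close>-adic numbers.\<close>

definition rat_closure :: "('f::field_char_0 \<Rightarrow> real) \<Rightarrow> 'f set" where
  "rat_closure absv = {x. \<forall>e>0. \<exists>r::rat. absv (x - of_rat r) < e}"

locale padic_field =
  fixes absv :: "'f::field_char_0 \<Rightarrow> real"
  assumes absv_nonneg: "absv x \<ge> 0"
    and absv_eq_0: "absv x = 0 \<longleftrightarrow> x = 0"
    and absv_mult: "absv (x * y) = absv x * absv y"
    and absv_ultrametric: "absv (x + y) \<le> max (absv x) (absv y)"
    and residue_char: "\<exists>p::nat. Factorial_Ring.prime p \<and> absv (of_nat p) < 1"
    and rat_cauchy_convergent: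
      "(\<forall>e>0. \<exists>k. \<forall>i\<ge>k. \<forall>j\<ge>k. absv (of_rat (r i) - of_rat (r j)) < e) \<Longrightarrow>
       \<exists>x. (\<lambda>i::nat. absv (of_rat (r i) - x)) \<longlonglongrightarrow> 0"
    and finite_over_rat_closure:
      "\<exists>B. finite B \<and> (\<forall>x. \<exists>c. (\<forall>b\<in>B. c b \<in> rat_closure absv) \<and> x = (\<Sum>b\<in>B. c b * b))"
    and normalized: "\<exists>\<pi>. uniformizer absv \<pi> \<and> absv \<pi> = 1 / real (residue_card absv)"

definition roots_of_unity :: "nat \<Rightarrow> 'f::field_char_0 set" where
  "roots_of_unity n = {\<zeta>. \<zeta> ^ n = 1}"

definition unity_embedding :: "nat \<Rightarrow> ('f::field_char_0 \<Rightarrow> complex) \<Rightarrow> bool" where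
  "unity_embedding n \<iota> \<longleftrightarrow> inj_on \<iota> (roots_of_unity n) \<and>
     (\<forall>x\<in>roots_of_unity n. \<forall>y\<in>roots_of_unity n. \<iota> (x * y) = \<iota> x * \<iota> y)"

text \<open>The exponent \<open>d\<close> and the index of the \<open>d\<close>-th powers in the multiplicative group.\<close>

definition half_exponent :: "nat \<Rightarrow> nat" where
  "half_exponent n = (if odd n then n else n div 2)"

definition power_index :: "'f::field_char_0 itself \<Rightarrow> nat \<Rightarrow> nat" where
  "power_index _ d = card ((\<lambda>a::'f. {a * b ^ d |b. b \<noteq> 0}) ` {a. a \<noteq> 0})"

definition nontrivial_character :: "('f::field_char_0 \<Rightarrow> real) \<Rightarrow> ('f \<Rightarrow> complex) \<Rightarrow> bool" where
  "nontrivial_character absv \<psi> \<longleftrightarrow>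
     (\<forall>x y. \<psi> (x + y) = \<psi> x * \<psi> y) \<and> (\<forall>x. norm (\<psi> x) = 1) \<and>
     (\<forall>x. \<forall>e>0. \<exists>d>0. \<forall>y. absv (y - x) < d \<longrightarrow> norm (\<psi> y - \<psi> x) < e) \<and>
     (\<exists>x. \<psi> x \<noteq> 1)"

definition schwartz_function :: "('f::field_char_0 \<Rightarrow> real) \<Rightarrow> ('f \<Rightarrow> complex) \<Rightarrow> bool" where
  "schwartz_function absv \<phi> \<longleftrightarrow>
     (\<forall>x. \<exists>e>0. \<forall>y. absv (y - x) < e \<longrightarrow> \<phi> y = \<phi> x) \<and>
     (\<exists>C. \<forall>x. \<phi> x \<noteq> 0 \<longrightarrow> absv x \<le> C)"

definition fourier :: "('f::field_char_0 \<Rightarrow> complex) \<Rightarrow> 'f measure \<Rightarrow> ('f \<Rightarrow> complex) \<Rightarrow> 'f \<Rightarrow> complex" where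
  "fourier \<psi> \<mu> \<phi> y = (\<integral>x. \<phi> x * \<psi> (x * y) \<partial>\<mu>)"

definition self_dual_haar ::
  "('f::field_char_0 \<Rightarrow> real) \<Rightarrow> ('f \<Rightarrow> complex) \<Rightarrow> 'f measure \<Rightarrow> bool" where
  "self_dual_haar absv \<psi> \<mu> \<longleftrightarrow>
     space \<mu> = UNIV \<and>
     sets \<mu> = sigma_sets UNIV {U. \<forall>x\<in>U. \<exists>e>0. \<forall>y. absv (y - x) < e \<longrightarrow> y \<in> U} \<and>
     (\<forall>A\<in>sets \<mu>. \<forall>x. emeasure \<mu> ((\<lambda>y. x + y) ` A) = emeasure \<mu> A) \<and>
     0 < emeasure \<mu> (int_ring absv) \<and> emeasure \<mu> (int_ring absv) < \<infinity> \<and>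
     (\<forall>\<phi>. schwartz_function absv \<phi> \<longrightarrow> (\<forall>x. fourier \<psi> \<mu> (fourier \<psi> \<mu> \<phi>) x = \<phi> (- x)))"


section \<open>The local Artin map and the Hilbert symbol\<close>

text \<open>Extensions of the base field are taken inside \<^typ>\<open>'f alg_closure\<close>.\<close>

definition finite_extension :: "'f::field_char_0 alg_closure set \<Rightarrow> bool" where
  "finite_extension E \<longleftrightarrow> range to_ac \<subseteq> E \<and>
     (\<forall>x\<in>E. \<forall>y\<in>E. x - y \<in> E \<and> x * y \<in> E) \<and> (\<forall>x\<in>E. inverse x \<in> E) \<and>
     (\<exists>B. finite B \<and> (\<forall>x\<in>E. \<exists>c. x = (\<Sum>b\<in>B. to_ac (c b) * b)))"

definition galois_group ::
  "'f::field_char_0 alg_closure set \<Rightarrow> ('f alg_closure \<Rightarrow> 'f alg_closure) set" where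
  "galois_group E = {\<tau> \<in> extensional E. bij_betw \<tau> E E \<and>
     (\<forall>x\<in>E. \<forall>y\<in>E. \<tau> (x + y) = \<tau> x + \<tau> y \<and> \<tau> (x * y) = \<tau> x * \<tau> y) \<and>
     (\<forall>a. \<tau> (to_ac a) = to_ac a)}"

definition abelian_extension :: "'f::field_char_0 alg_closure set \<Rightarrow> bool" where
  "abelian_extension E \<longleftrightarrow> finite_extension E \<and>
     {x \<in> E. \<forall>\<tau>\<in>galois_group E. \<tau> x = x} = range to_ac \<and>
     (\<forall>\<tau>\<in>galois_group E. \<forall>\<tau>'\<in>galois_group E. \<forall>x\<in>E. \<tau> (\<tau>' x) = \<tau>' (\<tau> x))"

text \<open>The norm of a finite Galois extension.\<close>

definition field_norm :: "'f::field_char_0 alg_closure set \<Rightarrow> 'f alg_closure \<Rightarrow> 'f" where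
  "field_norm E y = (THE a. to_ac a = (\<Prod>\<tau>\<in>galois_group E. \<tau> y))"

text \<open>The absolute value of \<open>E\<close> is \<open>\<bar>N y\<bar>\<close> to the power \<open>1 / [E : F]\<close>, which gives the ring of
  integers and the maximal ideal of \<open>E\<close>.\<close>

definition int_ring_ext ::
  "('f::field_char_0 \<Rightarrow> real) \<Rightarrow> 'f alg_closure set \<Rightarrow> 'f alg_closure set" where
  "int_ring_ext absv E = {y \<in> E. absv (field_norm E y) \<le> 1}"

definition max_ideal_ext ::
  "('f::field_char_0 \<Rightarrow> real) \<Rightarrow> 'f alg_closure set \<Rightarrow> 'f alg_closure set" where
  "max_ideal_ext absv E = {y \<in> E. absv (field_norm E y) < 1}"

definition unramified :: "('f::field_char_0 \<Rightarrow> real) \<Rightarrow> 'f alg_closure set \<Rightarrow> bool" where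
  "unramified absv E \<longleftrightarrow>
     (\<exists>\<pi>. uniformizer absv \<pi> \<and> max_ideal_ext absv E = (\<lambda>y. to_ac \<pi> * y) ` int_ring_ext absv E)"

text \<open>The local Artin map into the Galois group of the maximal abelian extension (the union of the
  finite abelian ones): the unique homomorphism that kills the norms from each finite abelian
  extension on that extension, and that sends every uniformizer to the arithmetic Frobenius of every
  finite unramified extension (finite unramified extensions are abelian). Values of \<open>\<theta> a\<close> outside
  the maximal abelian extension are irrelevant.\<close>

definition artin_map ::
  "('f::field_char_0 \<Rightarrow> real) \<Rightarrow> ('f \<Rightarrow> 'f alg_closure \<Rightarrow> 'f alg_closure) \<Rightarrow> bool" where
  "artin_map absv \<theta> \<longleftrightarrow> (\<forall>E. abelian_extension E \<longrightarrow>
     (\<forall>a. a \<noteq> 0 \<longrightarrow> restrict (\<theta> a) E \<in> galois_group E) \<and>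
     (\<forall>a b. a \<noteq> 0 \<longrightarrow> b \<noteq> 0 \<longrightarrow> (\<forall>x\<in>E. \<theta> (a * b) x = \<theta> a (\<theta> b x))) \<and>
     (\<forall>y\<in>E. y \<noteq> 0 \<longrightarrow> (\<forall>x\<in>E. \<theta> (field_norm E y) x = x)) \<and>
     (unramified absv E \<longrightarrow> (\<forall>\<pi>. uniformizer absv \<pi> \<longrightarrow>
        (\<forall>x\<in>int_ring_ext absv E. \<theta> \<pi> x - x ^ residue_card absv \<in> max_ideal_ext absv E))))"

text \<open>\<open>(a, b)\<close> is the factor by which the Artin symbol of \<open>a\<close> scales an \<open>n\<close>-th root of \<open>b\<close>. The
  opposite convention gives the inverse symbol, which amounts to replacing the embedding of the
  roots of unity into the complex numbers by its inverse.\<close>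

definition hilbert_symbol :: "('f::field_char_0 \<Rightarrow> real) \<Rightarrow> nat \<Rightarrow> 'f \<Rightarrow> 'f \<Rightarrow> 'f" where
  "hilbert_symbol absv n a b =
     (THE z. \<exists>\<theta> \<beta>. artin_map absv \<theta> \<and> \<beta> ^ n = to_ac b \<and> \<theta> a \<beta> = to_ac z * \<beta>)"


section \<open>Kubota's cover\<close>

type_synonym 'f cover_elt = "('f ^ 2 ^ 2) \<times> 'f"

definition mat2 :: "'f \<Rightarrow> 'f \<Rightarrow> 'f \<Rightarrow> 'f \<Rightarrow> 'f ^ 2 ^ 2" where
  "mat2 a b c d = (\<chi> i j. if i = 1 then (if j = 1 then a else b) else (if j = 1 then c else d))"

definition SL2 :: "('f::field_char_0 ^ 2 ^ 2) set" where
  "SL2 = {g. det g = 1}"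

definition kubota_x :: "'f::field_char_0 ^ 2 ^ 2 \<Rightarrow> 'f" where
  "kubota_x g = (if g $ 2 $ 1 \<noteq> 0 then g $ 2 $ 1 else g $ 2 $ 2)"

text \<open>Throughout, \<open>absv\<close> is the absolute value of the field \<open>F\<close>, \<open>n\<close> the degree of the cover,
  \<open>\<iota>\<close> the injection of the \<open>n\<close>-th roots of 1 into the complex numbers, \<open>\<psi>\<close> the additive character
  and \<open>\<mu>\<close> its self-dual Haar measure. A complex vector space \<open>V\<close> is a type with scalar
  multiplication \<open>sc\<close>.\<close>

context
  fixes absv :: "'f::field_char_0 \<Rightarrow> real"
    and n :: nat
    and \<iota> :: "'f \<Rightarrow> complex"
    and \<psi> :: "'f \<Rightarrow> complex"
    and \<mu> :: "'f measure"
begin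

definition kubota_cocycle :: "'f ^ 2 ^ 2 \<Rightarrow> 'f ^ 2 ^ 2 \<Rightarrow> 'f" where
  "kubota_cocycle g g' =
     hilbert_symbol absv n (kubota_x (g ** g') * inverse (kubota_x g))
                           (kubota_x (g ** g') * inverse (kubota_x g'))"

definition cover :: "'f cover_elt monoid" where
  "cover = \<lparr> carrier = SL2 \<times> roots_of_unity n,
     monoid.mult = (\<lambda>(g, \<epsilon>) (g', \<epsilon>'). (g ** g', kubota_cocycle g g' * \<epsilon> * \<epsilon>')),
     one = (mat 1, 1) \<rparr>"

abbreviation cover_mult :: "'f cover_elt \<Rightarrow> 'f cover_elt \<Rightarrow> 'f cover_elt"  (infixl "\<odot>" 70) where
  "x \<odot> y \<equiv> x \<otimes>\<^bsub>cover\<^esub> y"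

definition unip :: "'f \<Rightarrow> 'f cover_elt" where
  "unip x = (mat2 1 x 0 1, 1)"

definition weyl :: "'f cover_elt" where
  "weyl = (mat2 0 1 (- 1) 0, 1)"

definition torus :: "'f cover_elt set" where
  "torus = {(mat2 a 0 0 (inverse a), \<epsilon>) |a \<epsilon>. a \<noteq> 0 \<and> \<epsilon> \<in> roots_of_unity n}"

definition torus_abs :: "'f cover_elt \<Rightarrow> real" where
  "torus_abs t = absv (fst t $ 1 $ 1)"

definition max_compact :: "'f cover_elt set" where
  "max_compact = {g \<in> SL2. \<forall>i j. g $ i $ j \<in> int_ring absv} \<times> roots_of_unity n"

text \<open>The congruence neighborhoods of the identity, embedded by the trivial section. They decrease
  with \<open>l\<close>, so being invariant under some open subgroup is the same as being invariant under one of
  these sets.\<close>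

definition congruence_nhd :: "nat \<Rightarrow> 'f cover_elt set" where
  "congruence_nhd l = {(g, 1) |g. g \<in> SL2 \<and> (\<forall>i j. g $ i $ j \<in> int_ring absv) \<and>
     (\<forall>i j. absv (g $ i $ j - mat 1 $ i $ j) \<le> (1 / real (residue_card absv)) ^ l)}"


section \<open>Representations\<close>

definition genuine_smooth_irreducible ::
  "(complex \<Rightarrow> 'v::ab_group_add \<Rightarrow> 'v) \<Rightarrow> ('f cover_elt \<Rightarrow> 'v \<Rightarrow> 'v) \<Rightarrow> bool" where
  "genuine_smooth_irreducible sc \<sigma> \<longleftrightarrow> vector_space sc \<and>
     (\<forall>t\<in>torus. Vector_Spaces.linear sc sc (\<sigma> t)) \<and>
     (\<forall>t\<in>torus. \<forall>t'\<in>torus. \<forall>v. \<sigma> (t \<odot> t') v = \<sigma> t (\<sigma> t' v)) \<and>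
     (\<forall>\<epsilon>\<in>roots_of_unity n. \<forall>v. \<sigma> (mat 1, \<epsilon>) v = sc (\<iota> \<epsilon>) v) \<and>
     (\<forall>v. \<exists>l. \<forall>t\<in>torus \<inter> congruence_nhd l. \<sigma> t v = v) \<and>
     (\<exists>v::'v. v \<noteq> 0) \<and>
     (\<forall>W. module.subspace sc W \<and> (\<forall>t\<in>torus. \<sigma> t ` W \<subseteq> W) \<longrightarrow> W = {0} \<or> W = UNIV)"

definition isomorphic_reps ::
  "(complex \<Rightarrow> 'v::ab_group_add \<Rightarrow> 'v) \<Rightarrow> ('f cover_elt \<Rightarrow> 'v \<Rightarrow> 'v) \<Rightarrow>
   (complex \<Rightarrow> 'u::ab_group_add \<Rightarrow> 'u) \<Rightarrow> ('f cover_elt \<Rightarrow> 'u \<Rightarrow> 'u) \<Rightarrow> bool" where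
  "isomorphic_reps sc \<sigma> sc' \<sigma>' \<longleftrightarrow>
     (\<exists>T. Vector_Spaces.linear sc sc' T \<and> bij T \<and> (\<forall>t\<in>torus. \<forall>v. T (\<sigma> t v) = \<sigma>' t (T v)))"

definition twist ::
  "(complex \<Rightarrow> 'v::ab_group_add \<Rightarrow> 'v) \<Rightarrow> ('f cover_elt \<Rightarrow> 'v \<Rightarrow> 'v) \<Rightarrow> complex \<Rightarrow>
   'f cover_elt \<Rightarrow> 'v \<Rightarrow> 'v" where
  "twist sc \<sigma> s t v = sc (complex_of_real (torus_abs t) powr s) (\<sigma> t v)"

definition weyl_conj :: "('f cover_elt \<Rightarrow> 'v \<Rightarrow> 'v) \<Rightarrow> 'f cover_elt \<Rightarrow> 'v \<Rightarrow> 'v" where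
  "weyl_conj \<sigma> t = \<sigma> (weyl \<odot> t \<odot> inv\<^bsub>cover\<^esub> weyl)"

text \<open>Functions on the cover are set to 0 outside the carrier.\<close>

definition induced ::
  "(complex \<Rightarrow> 'v::ab_group_add \<Rightarrow> 'v) \<Rightarrow> ('f cover_elt \<Rightarrow> 'v \<Rightarrow> 'v) \<Rightarrow>
   ('f cover_elt \<Rightarrow> 'v) set" where
  "induced sc \<sigma> = {f. (\<forall>g. g \<notin> carrier cover \<longrightarrow> f g = 0) \<and>
     (\<forall>t\<in>torus. \<forall>x. \<forall>g\<in>carrier cover.
        f (t \<odot> unip x \<odot> g) = sc (complex_of_real (torus_abs t)) (\<sigma> t (f g))) \<and>
     (\<exists>l. \<forall>k\<in>congruence_nhd l. \<forall>g\<in>carrier cover. f (g \<odot> k) = f g)}"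

text \<open>The value \<open>\<bar>t\<bar>\<close> in an Iwasawa decomposition \<open>g = t u k\<close>, and the section \<open>f\<^sub>s\<close>. For \<open>f\<close> in
  \<open>I(\<tau>)\<close> the section lies in \<open>I(\<tau>\<^sub>s)\<close>, and \<open>f\<^sub>0 = f\<close>.\<close>

definition iwasawa_abs :: "'f cover_elt \<Rightarrow> real" where
  "iwasawa_abs g =
     (THE r. \<exists>t\<in>torus. \<exists>x. \<exists>k\<in>max_compact. g = t \<odot> unip x \<odot> k \<and> r = torus_abs t)"

definition flat_section ::
  "(complex \<Rightarrow> 'v::ab_group_add \<Rightarrow> 'v) \<Rightarrow> complex \<Rightarrow> ('f cover_elt \<Rightarrow> 'v) \<Rightarrow>
   'f cover_elt \<Rightarrow> 'v" where
  "flat_section sc s f g = sc (complex_of_real (iwasawa_abs g) powr s) (f g)"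

definition dual :: "(complex \<Rightarrow> 'v::ab_group_add \<Rightarrow> 'v) \<Rightarrow> ('v \<Rightarrow> complex) set" where
  "dual sc = {\<xi>. Vector_Spaces.linear sc (*) \<xi>}"


section \<open>Intertwining operators and Whittaker functionals\<close>

text \<open>\<open>y\<close> is the value at \<open>z\<^sub>0\<close> of the meromorphic continuation of the integral of \<open>\<Phi> z\<close>, which
  converges absolutely on some right half plane, and \<open>z\<^sub>0\<close> is not a pole.\<close>

definition continued_integral :: "(complex \<Rightarrow> 'f \<Rightarrow> complex) \<Rightarrow> complex \<Rightarrow> complex \<Rightarrow> bool" where
  "continued_integral \<Phi> z\<^sub>0 y \<longleftrightarrow>
     (\<exists>h c. h meromorphic_on UNIV \<and> h analytic_on {z\<^sub>0} \<and>
        (\<forall>z. Re z > c \<longrightarrow> integrable \<mu> (\<Phi> z) \<and> h z = (\<integral>x. \<Phi> z x \<partial>\<mu>)) \<and> y = h z\<^sub>0)"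

text \<open>The operator \<open>A\<^sub>w(\<tau>)\<close> on \<open>I(\<tau>)\<close>, obtained by continuing along the flat section through \<open>f\<close> to
  the parameter 0. For \<open>\<tau> = \<sigma>\<^sub>s\<close> and \<open>\<phi> = f\<^sub>s\<close> one has \<open>\<phi>\<^sub>z = f\<^sub>s\<^sub>+\<^sub>z\<close>, so this is the
  meromorphic continuation in \<open>s\<close>. Vector-valued integrals (\<open>V\<close> is finite-dimensional) are
  computed through linear functionals.\<close>

definition intertwining_value ::
  "(complex \<Rightarrow> 'v::ab_group_add \<Rightarrow> 'v) \<Rightarrow> ('f cover_elt \<Rightarrow> 'v) \<Rightarrow> 'f cover_elt \<Rightarrow> 'v \<Rightarrow> bool" where
  "intertwining_value sc f g v \<longleftrightarrow>
     (\<forall>\<xi>\<in>dual sc. continued_integral (\<lambda>z x. \<xi> (flat_section sc z f (weyl \<odot> unip x \<odot> g))) 0 (\<xi> v))"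

definition intertwining ::
  "(complex \<Rightarrow> 'v::ab_group_add \<Rightarrow> 'v) \<Rightarrow> ('f cover_elt \<Rightarrow> 'v) \<Rightarrow> 'f cover_elt \<Rightarrow> 'v" where
  "intertwining sc f g = (if g \<in> carrier cover then THE v. intertwining_value sc f g v else 0)"

definition intertwining_regular ::
  "(complex \<Rightarrow> 'v::ab_group_add \<Rightarrow> 'v) \<Rightarrow> ('f cover_elt \<Rightarrow> 'v \<Rightarrow> 'v) \<Rightarrow> bool" where
  "intertwining_regular sc \<tau> \<longleftrightarrow>
     (\<forall>f\<in>induced sc \<tau>. \<forall>g\<in>carrier cover. \<exists>v. intertwining_value sc f g v)"

text \<open>Functionals on \<open>I(\<tau>)\<close> are set to 0 outside \<open>I(\<tau>)\<close>.\<close>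

definition whittaker ::
  "(complex \<Rightarrow> 'v::ab_group_add \<Rightarrow> 'v) \<Rightarrow> ('f cover_elt \<Rightarrow> 'v \<Rightarrow> 'v) \<Rightarrow>
   (('f cover_elt \<Rightarrow> 'v) \<Rightarrow> complex) set" where
  "whittaker sc \<tau> = {L. (\<forall>f. f \<notin> induced sc \<tau> \<longrightarrow> L f = 0) \<and>
     (\<forall>f\<in>induced sc \<tau>. \<forall>f'\<in>induced sc \<tau>. L (\<lambda>g. f g + f' g) = L f + L f') \<and>
     (\<forall>c. \<forall>f\<in>induced sc \<tau>. L (\<lambda>g. sc c (f g)) = c * L f) \<and>
     (\<forall>x. \<forall>f\<in>induced sc \<tau>.
        L (\<lambda>g. if g \<in> carrier cover then f (g \<odot> unip x) else 0) = \<psi> x * L f)}"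

definition jacquet_value ::
  "(complex \<Rightarrow> 'v::ab_group_add \<Rightarrow> 'v) \<Rightarrow> ('v \<Rightarrow> complex) \<Rightarrow> ('f cover_elt \<Rightarrow> 'v) \<Rightarrow> complex \<Rightarrow> bool" where
  "jacquet_value sc \<xi> f y \<longleftrightarrow>
     continued_integral (\<lambda>z x. \<xi> (flat_section sc z f (weyl \<odot> unip x)) * inverse (\<psi> x)) 0 y"

definition jacquet ::
  "(complex \<Rightarrow> 'v::ab_group_add \<Rightarrow> 'v) \<Rightarrow> ('f cover_elt \<Rightarrow> 'v \<Rightarrow> 'v) \<Rightarrow> ('v \<Rightarrow> complex) \<Rightarrow>
   ('f cover_elt \<Rightarrow> 'v) \<Rightarrow> complex" where
  "jacquet sc \<tau> \<xi> f = (if f \<in> induced sc \<tau> then THE y. jacquet_value sc \<xi> f y else 0)"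

definition jacquet_regular ::
  "(complex \<Rightarrow> 'v::ab_group_add \<Rightarrow> 'v) \<Rightarrow> ('f cover_elt \<Rightarrow> 'v \<Rightarrow> 'v) \<Rightarrow> bool" where
  "jacquet_regular sc \<tau> \<longleftrightarrow> (\<forall>\<xi>\<in>dual sc. \<forall>f\<in>induced sc \<tau>. \<exists>y. jacquet_value sc \<xi> f y)"

text \<open>The pullback \<open>A\<^sub>w\<^sup>\<psi>(\<tau>)\<close> on Whittaker functionals.\<close>

definition intertwining_pullback ::
  "(complex \<Rightarrow> 'v::ab_group_add \<Rightarrow> 'v) \<Rightarrow> ('f cover_elt \<Rightarrow> 'v \<Rightarrow> 'v) \<Rightarrow>
   (('f cover_elt \<Rightarrow> 'v) \<Rightarrow> complex) \<Rightarrow> ('f cover_elt \<Rightarrow> 'v) \<Rightarrow> complex" where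
  "intertwining_pullback sc \<tau> L f = (if f \<in> induced sc \<tau> then L (intertwining sc f) else 0)"


section \<open>Shahidi local coefficients matrices\<close>

text \<open>A basis of a space \<open>S\<close> of complex-valued functions, indexed by a finite type.\<close>

definition indexed_basis :: "('a \<Rightarrow> complex) set \<Rightarrow> ('i::finite \<Rightarrow> 'a \<Rightarrow> complex) \<Rightarrow> bool" where
  "indexed_basis S b \<longleftrightarrow> (\<forall>i. b i \<in> S) \<and> (\<forall>x\<in>S. \<exists>!c. x = (\<lambda>a. \<Sum>i\<in>UNIV. c i * b i a))"

text \<open>The matrix of \<open>T : S \<rightarrow> S'\<close> with respect to the bases \<open>b\<close> of \<open>S\<close> and \<open>b'\<close> of \<open>S'\<close>: column \<open>i\<close> holds
  the coordinates of \<open>T (b i)\<close>.\<close>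

definition represents ::
  "complex ^ 'i ^ 'i \<Rightarrow> (('a \<Rightarrow> complex) \<Rightarrow> 'a \<Rightarrow> complex) \<Rightarrow>
   ('a \<Rightarrow> complex) set \<Rightarrow> ('i::finite \<Rightarrow> 'a \<Rightarrow> complex) \<Rightarrow>
   ('a \<Rightarrow> complex) set \<Rightarrow> ('i \<Rightarrow> 'a \<Rightarrow> complex) \<Rightarrow> bool" where
  "represents M T S b S' b' \<longleftrightarrow> indexed_basis S b \<and> indexed_basis S' b' \<and>
     (\<forall>i. T (b i) = (\<lambda>a. \<Sum>j\<in>UNIV. M $ j $ i * b' j a))"

text \<open>The points \<open>s\<close> at which all the operators in the definition of the matrix are defined. The
  Jacquet integrals continue to entire functions, so only the poles of the intertwining operator
  are excluded.\<close>

definition slcm_domain ::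
  "(complex \<Rightarrow> 'v::ab_group_add \<Rightarrow> 'v) \<Rightarrow> ('f cover_elt \<Rightarrow> 'v \<Rightarrow> 'v) \<Rightarrow> complex set" where
  "slcm_domain sc \<sigma> = {s. intertwining_regular sc (twist sc \<sigma> s) \<and>
     jacquet_regular sc (twist sc \<sigma> s) \<and> jacquet_regular sc (weyl_conj (twist sc \<sigma> s))}"

text \<open>A matrix-valued function on \<open>slcm_domain\<close> is extended by 0 to a total function. The index
  type of the basis \<open>R\<close> stands for \<open>{1..dim V}\<close>.\<close>

definition slcm_wrt ::
  "(complex \<Rightarrow> 'v::ab_group_add \<Rightarrow> 'v) \<Rightarrow> ('f cover_elt \<Rightarrow> 'v \<Rightarrow> 'v) \<Rightarrow>
   ('i::finite \<Rightarrow> 'v \<Rightarrow> complex) \<Rightarrow> (complex \<Rightarrow> complex ^ 'i ^ 'i) \<Rightarrow> bool" where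
  "slcm_wrt sc \<sigma> R M \<longleftrightarrow>
     real CARD('i) = sqrt (real (power_index TYPE('f) (half_exponent n))) \<and>
     (\<forall>s\<in>slcm_domain sc \<sigma>.
        represents (M s) (intertwining_pullback sc (twist sc \<sigma> s))
          (whittaker sc (weyl_conj (twist sc \<sigma> s)))
          (\<lambda>i. jacquet sc (weyl_conj (twist sc \<sigma> s)) (R i))
          (whittaker sc (twist sc \<sigma> s))
          (\<lambda>i. jacquet sc (twist sc \<sigma> s) (R i))) \<and>
     (\<forall>s. s \<notin> slcm_domain sc \<sigma> \<longrightarrow> M s = 0)"

definition is_slcm ::
  "(complex \<Rightarrow> 'v::ab_group_add \<Rightarrow> 'v) \<Rightarrow> ('f cover_elt \<Rightarrow> 'v \<Rightarrow> 'v) \<Rightarrow>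
   (complex \<Rightarrow> complex ^ 'i::finite ^ 'i) \<Rightarrow> bool" where
  "is_slcm sc \<sigma> M \<longleftrightarrow> (\<exists>R. indexed_basis (dual sc) R \<and> slcm_wrt sc \<sigma> R M)"

end

definition conjugate_matrix_functions ::
  "(complex \<Rightarrow> complex ^ 'i::finite ^ 'i) \<Rightarrow> (complex \<Rightarrow> complex ^ 'i ^ 'i) \<Rightarrow> bool" where
  "conjugate_matrix_functions M M' \<longleftrightarrow>
     (\<exists>P. invertible P \<and> (\<forall>s. M' s = matrix_inv P ** M s ** P))"

definition conjugacy_class ::
  "(complex \<Rightarrow> complex ^ 'i::finite ^ 'i) \<Rightarrow> (complex \<Rightarrow> complex ^ 'i ^ 'i) set" where
  "conjugacy_class M = {M'. conjugate_matrix_functions M M'}"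

end

theory Submission
  imports Defs
begin

text \<open>Pulling back along an isomorphism \<open>T\<close> of the two realizations turns the second basis of
  functionals into a constant change of basis \<open>P\<close> of the first, and all operators in the definition
  of the matrix commute with \<open>T\<close>, so that \<open>M(s) P = P M'(s)\<close>. The difficulty is that \<open>T\<close> only
  intertwines the values of \<open>\<sigma>\<close> and \<open>\<sigma>'\<close> on the torus, so that \<open>w t w\<^sup>-\<^sup>1\<close> has to be known to lie in the
  torus, that is, the Hilbert symbols occurring in it have to be roots of unity, while the Hilbert
  symbol is a definite description over all Artin maps. If there is no Artin map, all symbols
  coincide. Otherwise \<open>(a, a\<^sup>-\<^sup>1)\<close> reduces by Kummer theory to a quadratic symbol against a root of
  unity, which does not depend on the Artin map. In both cases the operators \<open>\<sigma>(t)\<close> are injective,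
  and the support of a nonzero section of \<open>I(\<sigma>\<^sub>s)\<close> then forces all Hilbert symbols to be roots of
  unity. If there is no nonzero section for any \<open>s\<close> at which the matrices are defined, there is no
  such \<open>s\<close>.\<close>

section \<open>Arithmetic of p-adic fields\<close>

text \<open>Neither existence nor uniqueness of the Artin map is established. If a symbol varied
  with the Artin map, the definite description would denote an unspecified field element, and
  products in the cover could leave its carrier. The symbols of the form (b, b^-1) are singled out
  because they are the central components of products of \<open>torus_elt b _\<close> with
  \<open>torus_elt (inverse b) _\<close>; once these are roots of unity, every \<sigma>(t) is
  invertible from the left up to a nonzero scalar. Independence of the quadratic symbol is within
  reach because its values are \<plusminus>1: the quotient of two candidates is again
  bimultiplicative, kills norms from quadratic extensions and hence satisfies Steinberg relations,
  and is trivial against unramified quadratic extensions, where the Frobenius is prescribed. Residue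
  characteristic 2 is the case that dictates the filtration argument. Completeness enters through
  Hensel's lemma for y^2 - y = c, which decides when a square root of 1 + 4c lies in the base
  field.\<close>

context padic_field
begin

lemma absv_0 [simp]: "absv 0 = 0"
  by (simp add: absv_eq_0)

lemma absv_1 [simp]: "absv 1 = 1"
  using absv_mult[of 1 1] absv_eq_0[of 1] by simp

lemma absv_minus [simp]: "absv (- x) = absv x"
proof -
  have "absv (- 1) * absv (- 1) = 1"
    using absv_mult[of "- 1" "- 1"] by simp
  then have "absv (- 1) = 1"
    using absv_nonneg[of "- 1"] by (metis abs_of_nonneg real_sqrt_abs2 real_sqrt_one)
  then show ?thesis
    using absv_mult[of "- 1" x] by simp
qed

lemma absv_pos: "x \<noteq> 0 \<Longrightarrow> absv x > 0"
  using absv_nonneg[of x] absv_eq_0[of x] by linarith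

lemma absv_diff_le: "absv (x - y) \<le> max (absv x) (absv y)"
  using absv_ultrametric[of x "- y"] by simp

lemma absv_diff_commute: "absv (x - y) = absv (y - x)"
  using absv_minus[of "x - y"] by simp

lemma absv_diff_trans: "absv (x - z) \<le> max (absv (x - y)) (absv (y - z))"
  using absv_ultrametric[of "x - y" "y - z"] by simp

lemma absv_inverse: "absv (inverse x) = inverse (absv x)"
proof (cases "x = 0")
  case False
  then have "absv x * absv (inverse x) = 1"
    by (metis absv_1 absv_mult right_inverse)
  then show ?thesis
    by (metis inverse_unique)
qed simp

lemma absv_divide: "absv (x / y) = absv x / absv y"
  by (simp add: field_class.field_divide_inverse absv_mult absv_inverse)

lemma absv_power: "absv (x ^ k) = absv x ^ k"
  by (induction k) (simp_all add: absv_mult)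

lemma absv_add_eq: "absv y < absv x \<Longrightarrow> absv (x + y) = absv x"
  using absv_ultrametric[of x y] absv_diff_le[of "x + y" y] by simp

lemma absv_of_nat_le: "absv (of_nat k) \<le> 1"
proof (induction k)
  case (Suc k)
  then show ?case
    using absv_ultrametric[of 1 "of_nat k"] by simp
qed simp

lemma absv_numeral_le: "absv (numeral k) \<le> 1"
  using absv_of_nat_le[of "numeral k"] by simp


subsection \<open>Completeness\<close>

definition converges :: "(nat \<Rightarrow> 'f) \<Rightarrow> 'f \<Rightarrow> bool" where
  "converges f x \<longleftrightarrow> (\<lambda>i. absv (f i - x)) \<longlonglongrightarrow> 0"

definition cauchy_seq :: "(nat \<Rightarrow> 'f) \<Rightarrow> bool" where
  "cauchy_seq f \<longleftrightarrow> (\<forall>e>0. \<exists>k. \<forall>i\<ge>k. \<forall>j\<ge>k. absv (f i - f j) < e)"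

definition complete_set :: "'f set \<Rightarrow> bool" where
  "complete_set S \<longleftrightarrow> (\<forall>f. cauchy_seq f \<longrightarrow> range f \<subseteq> S \<longrightarrow> (\<exists>x\<in>S. converges f x))"

lemma convergesD: "converges f x \<Longrightarrow> e > 0 \<Longrightarrow> \<exists>k. \<forall>i\<ge>k. absv (f i - x) < e"
  by (auto simp: converges_def lim_sequentially dist_real_def absv_nonneg)

lemma convergesI: "(\<And>e. e > 0 \<Longrightarrow> \<exists>k. \<forall>i\<ge>k. absv (f i - x) < e) \<Longrightarrow> converges f x"
  by (auto simp: converges_def lim_sequentially dist_real_def absv_nonneg)

lemma converges_unique:
  assumes "converges f x" "converges f y"
  shows "x = y"
proof (rule ccontr)
  assume "x \<noteq> y"
  then have e: "absv (x - y) > 0"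
    by (simp add: absv_pos)
  obtain k l where "\<forall>i\<ge>k. absv (f i - x) < absv (x - y)" "\<forall>i\<ge>l. absv (f i - y) < absv (x - y)"
    using assms convergesD e by metis
  then have "absv (x - f (max k l)) < absv (x - y)" "absv (f (max k l) - y) < absv (x - y)"
    by (simp_all add: absv_diff_commute)
  then show False
    using absv_diff_trans[of x y "f (max k l)"] by simp
qed

lemma converges_imp_cauchy:
  assumes "converges f x"
  shows "cauchy_seq f"
  unfolding cauchy_seq_def
proof (intro allI impI)
  fix e :: real
  assume "e > 0"
  then obtain k where k: "\<forall>i\<ge>k. absv (f i - x) < e"
    using assms convergesD by blast
  have "absv (f i - f j) < e" if "i \<ge> k" "j \<ge> k" for i j
  proof -
    have "absv (f i - x) < e" "absv (x - f j) < e"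
      using k that absv_diff_commute[of x "f j"] by simp_all
    then show ?thesis
      using absv_diff_trans[of "f i" "f j" x] by linarith
  qed
  then show "\<exists>k. \<forall>i\<ge>k. \<forall>j\<ge>k. absv (f i - f j) < e"
    by blast
qed

lemma converges_add:
  assumes "converges f x" "converges g y"
  shows "converges (\<lambda>i. f i + g i) (x + y)"
proof (rule convergesI)
  fix e :: real
  assume e: "e > 0"
  obtain k l where "\<forall>i\<ge>k. absv (f i - x) < e" "\<forall>i\<ge>l. absv (g i - y) < e"
    using assms convergesD e by metis
  moreover have "absv (f i + g i - (x + y)) \<le> max (absv (f i - x)) (absv (g i - y))" for i
    using absv_ultrametric[of "f i - x" "g i - y"] by (simp add: algebra_simps)
  ultimately show "\<exists>k. \<forall>i\<ge>k. absv (f i + g i - (x + y)) < e"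
    by (intro exI[of _ "max k l"]) (metis le_less_trans max_less_iff_conj max.bounded_iff)
qed

lemma converges_cmult:
  assumes "converges f x"
  shows "converges (\<lambda>i. f i * b) (x * b)"
proof -
  have "absv (f i * b - x * b) = absv (f i - x) * absv b" for i
    by (metis absv_mult left_diff_distrib)
  then show ?thesis
    using tendsto_mult[OF assms[unfolded converges_def] tendsto_const[of "absv b"]]
    by (simp add: converges_def)
qed

lemma cauchy_seq_diff:
  assumes "cauchy_seq f" "cauchy_seq g"
  shows "cauchy_seq (\<lambda>i. f i - g i)"
  unfolding cauchy_seq_def
proof (intro allI impI)
  fix e :: real
  assume e: "e > 0"
  obtain k l where kl: "\<forall>i\<ge>k. \<forall>j\<ge>k. absv (f i - f j) < e" "\<forall>i\<ge>l. \<forall>j\<ge>l. absv (g i - g j) < e"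
    using assms e unfolding cauchy_seq_def by metis
  have "absv (f i - g i - (f j - g j)) < e" if "i \<ge> max k l" "j \<ge> max k l" for i j
  proof -
    have "absv (f i - f j) < e" "absv (g i - g j) < e"
      using kl that by simp_all
    moreover have "absv (f i - g i - (f j - g j)) \<le> max (absv (f i - f j)) (absv (g i - g j))"
      using absv_diff_le[of "f i - f j" "g i - g j"] by (simp add: algebra_simps)
    ultimately show ?thesis
      by simp
  qed
  then show "\<exists>k. \<forall>i\<ge>k. \<forall>j\<ge>k. absv (f i - g i - (f j - g j)) < e"
    by blast
qed

lemma rat_closure_approx:
  assumes "x \<in> rat_closure absv" "e > 0"
  obtains r :: rat where "absv (x - of_rat r) < e"
  using assms unfolding rat_closure_def by blast

lemma rat_closure_add:
  assumes "x \<in> rat_closure absv" "y \<in> rat_closure absv"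
  shows "x + y \<in> rat_closure absv"
  unfolding rat_closure_def
proof (intro CollectI allI impI)
  fix e :: real
  assume e: "e > 0"
  obtain r s where "absv (x - of_rat r) < e" "absv (y - of_rat s) < e"
    using assms rat_closure_approx e by metis
  moreover have "absv (x + y - of_rat (r + s)) \<le> max (absv (x - of_rat r)) (absv (y - of_rat s))"
    using absv_ultrametric[of "x - of_rat r" "y - of_rat s"] by (simp add: of_rat_add algebra_simps)
  ultimately have "absv (x + y - of_rat (r + s)) < e"
    by simp
  then show "\<exists>t. absv (x + y - of_rat t) < e" ..
qed

lemma rat_closure_minus:
  assumes "x \<in> rat_closure absv"
  shows "- x \<in> rat_closure absv"
  unfolding rat_closure_def
proof (intro CollectI allI impI)
  fix e :: real
  assume e: "e > 0"
  obtain r where "absv (x - of_rat r) < e"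
    using assms rat_closure_approx e by metis
  moreover have "absv (- x - of_rat (- r)) = absv (x - of_rat r)"
    using absv_minus[of "x - of_rat r"] by (simp add: of_rat_minus)
  ultimately show "\<exists>t. absv (- x - of_rat t) < e"
    by metis
qed

lemma rat_closure_mult:
  assumes x: "x \<in> rat_closure absv" and y: "y \<in> rat_closure absv"
  shows "x * y \<in> rat_closure absv"
  unfolding rat_closure_def
proof (intro CollectI allI impI)
  fix e :: real
  assume e: "e > 0"
  define c where "c = 1 + absv x + absv y"
  have c: "c \<ge> 1" "absv x \<le> c" "absv y \<le> c"
    by (simp_all add: c_def absv_nonneg)
  have "min (e / c) 1 > 0"
    using e c by simp
  then obtain s where s: "absv (y - of_rat s) < min (e / c) 1"
    using y rat_closure_approx by metis
  obtain r where r: "absv (x - of_rat r) < e / c"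
    using x c e rat_closure_approx by (metis divide_pos_pos less_le_trans zero_less_one)
  have "absv (of_rat s) \<le> max (absv y) (absv (y - of_rat s))"
    using absv_diff_le[of y "y - of_rat s"] by simp
  then have s2: "absv (of_rat s) \<le> c"
    using s c by linarith
  have "absv (x * (y - of_rat s)) \<le> c * absv (y - of_rat s)"
    by (simp add: absv_mult absv_nonneg c mult_right_mono)
  moreover have "c * absv (y - of_rat s) < e"
    using s c by (simp add: field_simps)
  moreover have "absv ((x - of_rat r) * of_rat s) \<le> absv (x - of_rat r) * c"
    by (simp add: absv_mult absv_nonneg s2 mult_left_mono)
  moreover have "absv (x - of_rat r) * c < e"
    using r c by (simp add: field_simps)
  moreover have "x * y - of_rat (r * s) = x * (y - of_rat s) + (x - of_rat r) * of_rat s"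
    by (simp add: of_rat_mult algebra_simps)
  ultimately show "\<exists>t. absv (x * y - of_rat t) < e"
    using absv_ultrametric[of "x * (y - of_rat s)" "(x - of_rat r) * of_rat s"]
    by (metis le_less_trans max_less_iff_conj)
qed

lemma rat_closure_inverse:
  assumes x: "x \<in> rat_closure absv"
  shows "inverse x \<in> rat_closure absv"
proof (cases "x = 0")
  case True
  then show ?thesis
    using x by simp
next
  case False
  then have px: "absv x > 0"
    by (rule absv_pos)
  show ?thesis
    unfolding rat_closure_def
  proof (intro CollectI allI impI)
    fix e :: real
    assume e: "e > 0"
    have "min (absv x) (e * (absv x)\<^sup>2) > 0"
      using e px by simp
    then obtain r where r: "absv (x - of_rat r) < min (absv x) (e * (absv x)\<^sup>2)"
      using x rat_closure_approx by metis
    have "absv (of_rat r) = absv x"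
      using absv_add_eq[of "of_rat r - x" x] r by (simp add: absv_diff_commute)
    moreover from this have "of_rat r \<noteq> (0::'f)"
      using px by auto
    then have "inverse x - inverse (of_rat r) = (of_rat r - x) / (x * of_rat r)"
      using False by (simp add: field_simps)
    then have "inverse x - of_rat (inverse r) = (of_rat r - x) / (x * of_rat r)"
      by (simp only: of_rat_inverse)
    ultimately have "absv (inverse x - of_rat (inverse r)) = absv (x - of_rat r) / (absv x)\<^sup>2"
      by (simp add: absv_divide absv_mult absv_diff_commute power2_eq_square)
    also have "\<dots> < e"
      using r px by (simp add: field_simps)
    finally show "\<exists>t. absv (inverse x - of_rat t) < e" ..
  qed
qed

text \<open>Replace \<open>f i\<close> by a rational within 1/(i+1) of it. The errors tend to 0, so
  the rationals form a Cauchy sequence, and their limit, supplied by the locale axiom, is also the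
  limit of \<open>f\<close>.\<close>

lemma complete_rat_closure: "complete_set (rat_closure absv)"
  unfolding complete_set_def
proof (intro allI impI)
  fix f
  assume f: "cauchy_seq f" "range f \<subseteq> rat_closure absv"
  have "\<exists>r. absv (f i - of_rat r) < 1 / real (Suc i)" for i
    using f(2) rat_closure_approx[of "f i" "1 / real (Suc i)"] by (force simp: image_subset_iff)
  then obtain r where r: "absv (f i - of_rat (r i)) < 1 / real (Suc i)" for i
    by metis
  have small: "converges (\<lambda>i. f i - of_rat (r i)) 0"
    unfolding converges_def
    by (rule tendsto_sandwich[OF _ _ tendsto_const lim_inverse_n'[THEN LIMSEQ_Suc]])
      (use r in \<open>auto simp: absv_nonneg intro!: eventuallyI less_imp_le\<close>)
  have "cauchy_seq (\<lambda>i. f i - (f i - of_rat (r i)))"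
    by (intro cauchy_seq_diff f converges_imp_cauchy[OF small])
  then have "cauchy_seq (\<lambda>i. of_rat (r i))"
    by simp
  then obtain x where x: "converges (\<lambda>i. of_rat (r i)) x"
    using rat_cauchy_convergent unfolding cauchy_seq_def converges_def by blast
  have "x \<in> rat_closure absv"
    unfolding rat_closure_def
  proof (intro CollectI allI impI)
    fix e :: real
    assume "e > 0"
    then obtain k where "absv (of_rat (r k) - x) < e"
      using convergesD[OF x] by blast
    then show "\<exists>r. absv (x - of_rat r) < e"
      by (metis absv_diff_commute)
  qed
  moreover have "converges f x"
    using converges_add[OF small x] by simp
  ultimately show "\<exists>x\<in>rat_closure absv. converges f x"
    by blast
qed

section \<open>Completeness of finite spans over the closure of the rationals\<close>

definition rat_span :: "'f set \<Rightarrow> 'f set" where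
  "rat_span B = {x. \<exists>c. (\<forall>b\<in>B. c b \<in> rat_closure absv) \<and> x = (\<Sum>b\<in>B. c b * b)}"

lemma rat_span_diff:
  assumes "x \<in> rat_span B" "y \<in> rat_span B"
  shows "x - y \<in> rat_span B"
proof -
  obtain c d where c: "\<forall>b\<in>B. c b \<in> rat_closure absv" "x = (\<Sum>b\<in>B. c b * b)"
    and d: "\<forall>b\<in>B. d b \<in> rat_closure absv" "y = (\<Sum>b\<in>B. d b * b)"
    using assms unfolding rat_span_def by blast
  have "x - y = (\<Sum>b\<in>B. (c b - d b) * b)"
    by (simp add: c d sum_subtractf left_diff_distrib)
  moreover have "c b - d b \<in> rat_closure absv" if "b \<in> B" for b
    using rat_closure_add[of "c b" "- d b"] rat_closure_minus[of "d b"] c d that by simp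
  ultimately show ?thesis
    unfolding rat_span_def by (intro CollectI exI[of _ "\<lambda>b. c b - d b"]) simp
qed

lemma rat_span_scale:
  assumes "x \<in> rat_span B" "k \<in> rat_closure absv"
  shows "k * x \<in> rat_span B"
proof -
  obtain c where c: "\<forall>b\<in>B. c b \<in> rat_closure absv" "x = (\<Sum>b\<in>B. c b * b)"
    using assms unfolding rat_span_def by blast
  then have "k * x = (\<Sum>b\<in>B. (k * c b) * b)"
    by (simp add: sum_distrib_left mult.assoc)
  then show ?thesis
    unfolding rat_span_def using c assms(2) rat_closure_mult by (intro CollectI exI[of _ "\<lambda>b. k * c b"]) simp
qed

lemma rat_span_insert:
  assumes "finite B" "b \<notin> B" "x \<in> rat_span (insert b B)"
  obtains k y where "k \<in> rat_closure absv" "y \<in> rat_span B" "x = k * b + y"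
proof -
  obtain c where c: "\<forall>b\<in>insert b B. c b \<in> rat_closure absv" "x = (\<Sum>b\<in>insert b B. c b * b)"
    using assms unfolding rat_span_def by blast
  have "(\<Sum>b\<in>B. c b * b) \<in> rat_span B"
    using c unfolding rat_span_def by blast
  then show thesis
    using that[of "c b" "\<Sum>b\<in>B. c b * b"] c assms by simp
qed

lemma rat_span_insertI:
  assumes "finite B" "b \<notin> B" "k \<in> rat_closure absv" "y \<in> rat_span B"
  shows "k * b + y \<in> rat_span (insert b B)"
proof -
  obtain c where c: "\<forall>b\<in>B. c b \<in> rat_closure absv" "y = (\<Sum>b\<in>B. c b * b)"
    using assms unfolding rat_span_def by blast
  have "(\<Sum>b'\<in>B. (c(b := k)) b' * b') = y"
    unfolding c by (rule sum.cong) (use assms in auto)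
  then have "k * b + y = (\<Sum>b'\<in>insert b B. (c(b := k)) b' * b')"
    using assms by simp
  moreover have "\<forall>b'\<in>insert b B. (c(b := k)) b' \<in> rat_closure absv"
    using c assms by simp
  ultimately show ?thesis
    unfolding rat_span_def by blast
qed

text \<open>Otherwise elements \<open>- y i\<close> of the span come within 1/(i+1) of
  \<open>b\<close>, and completeness puts their limit \<open>b\<close> into the span.\<close>

lemma rat_span_distance:
  assumes comp: "complete_set (rat_span B)" and b: "b \<notin> rat_span B"
  obtains d where "d > 0" "\<And>y. y \<in> rat_span B \<Longrightarrow> absv (b + y) \<ge> d"
proof (rule ccontr)
  assume no: "\<not> thesis"
  have "\<exists>y\<in>rat_span B. absv (b + y) < 1 / real (Suc i)" for i
    using no that[of "1 / real (Suc i)"] by (meson not_less of_nat_0_less_iff zero_less_Suc zero_less_divide_1_iff)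
  then obtain y where y: "y i \<in> rat_span B" "absv (b + y i) < 1 / real (Suc i)" for i
    by metis
  have 0: "0 \<in> rat_span B"
    using rat_span_diff[OF y(1)[of 0] y(1)[of 0]] by simp
  have neg: "- y i \<in> rat_span B" for i
    using rat_span_diff[OF 0 y(1)[of i]] by simp
  have "converges (\<lambda>i. - y i) b"
    unfolding converges_def
  proof (rule tendsto_sandwich[OF _ _ tendsto_const lim_inverse_n'[THEN LIMSEQ_Suc]])
    have "absv (- y i - b) = absv (b + y i)" for i
      using absv_minus[of "b + y i"] by (simp add: minus_diff_commute)
    then show "\<forall>\<^sub>F i in sequentially. absv (- y i - b) \<le> 1 / real (Suc i)"
      using y(2) by (simp add: less_imp_le)
  qed (simp add: absv_nonneg)
  moreover from this obtain x where "x \<in> rat_span B" "converges (\<lambda>i. - y i) x"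
    using comp neg converges_imp_cauchy unfolding complete_set_def by blast
  ultimately show False
    using b converges_unique by blast
qed

text \<open>Induction on the generators. A generator \<open>b\<close> outside the span of the others
  has positive distance \<open>d\<close> from it, so the coefficient of \<open>b\<close> is a
  Lipschitz function of the vector. A Cauchy sequence therefore splits into a Cauchy sequence of
  coefficients and one in the smaller span.\<close>

lemma complete_rat_span:
  assumes "finite B"
  shows "complete_set (rat_span B)"
  using assms
proof (induction B rule: finite_induct)
  case empty
  have "converges f 0" if "range f \<subseteq> {0::'f}" for f :: "nat \<Rightarrow> 'f"
    using that by (simp add: converges_def image_subset_iff)
  moreover have "rat_span {} = {0}"
    by (auto simp: rat_span_def)
  ultimately show ?case
    by (auto simp: complete_set_def)
next
  case (insert b B)
  show ?case
  proof (cases "b \<in> rat_span B")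
    case True
    have "rat_span (insert b B) \<subseteq> rat_span B"
    proof
      fix x
      assume "x \<in> rat_span (insert b B)"
      then obtain k y where ky: "k \<in> rat_closure absv" "y \<in> rat_span B" "x = k * b + y"
        using rat_span_insert insert by metis
      have "k * b - (y - y - y) \<in> rat_span B"
        by (intro rat_span_diff rat_span_scale True ky)
      then show "x \<in> rat_span B"
        using ky by simp
    qed
    moreover have "rat_span B \<subseteq> rat_span (insert b B)"
    proof
      fix x
      assume x: "x \<in> rat_span B"
      have "(0::'f) \<in> rat_closure absv"
        by (auto simp: rat_closure_def intro!: exI[of _ 0])
      then show "x \<in> rat_span (insert b B)"
        using rat_span_insertI[OF insert(1,2), of 0 x] x by simp
    qed
    ultimately show ?thesis
      using insert by auto
  next
    case False
    then obtain d where d: "d > 0" "\<And>y. y \<in> rat_span B \<Longrightarrow> absv (b + y) \<ge> d"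
      using rat_span_distance insert by metis
    show ?thesis
      unfolding complete_set_def
    proof (intro allI impI)
      fix f
      assume f: "cauchy_seq f" "range f \<subseteq> rat_span (insert b B)"
      have "\<exists>k y. k \<in> rat_closure absv \<and> y \<in> rat_span B \<and> f i = k * b + y" for i
        using f(2) rat_span_insert[OF insert(1,2), of "f i"] by (metis range_subsetD)
      then obtain k y where ky: "k i \<in> rat_closure absv" "y i \<in> rat_span B" "f i = k i * b + y i" for i
        by metis
      have bound: "absv (k i - k j) * d \<le> absv (f i - f j)" for i j
      proof (cases "k i = k j")
        case False
        have kk: "k i - k j \<in> rat_closure absv"
          using rat_closure_add[OF ky(1)[of i] rat_closure_minus[OF ky(1)[of j]]] by simp
        \<comment> \<open>Dividing \<open>f i - f j\<close> by the difference of the coefficients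
          gives \<open>b\<close> plus an element of the span, which is where the distance bound
          applies.\<close>
        have "d \<le> absv (b + inverse (k i - k j) * (y i - y j))"
          by (intro d rat_span_scale rat_span_diff ky rat_closure_inverse kk)
        then have "absv (k i - k j) * d \<le> absv ((k i - k j) * (b + inverse (k i - k j) * (y i - y j)))"
          by (simp add: absv_mult absv_nonneg mult_left_mono)
        also have "(k i - k j) * (b + inverse (k i - k j) * (y i - y j)) = f i - f j"
          using False by (simp add: ky(3) field_simps)
        finally show ?thesis .
      qed (simp add: absv_nonneg)
      have "cauchy_seq k"
        unfolding cauchy_seq_def
      proof (intro allI impI)
        fix e :: real
        assume "e > 0"
        then obtain m where "\<forall>i\<ge>m. \<forall>j\<ge>m. absv (f i - f j) < e * d"
          using f(1) d unfolding cauchy_seq_def by (metis mult_pos_pos)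
        then have "\<forall>i\<ge>m. \<forall>j\<ge>m. absv (k i - k j) * d < e * d"
          using bound by (metis le_less_trans)
        then show "\<exists>m. \<forall>i\<ge>m. \<forall>j\<ge>m. absv (k i - k j) < e"
          using d by auto
      qed
      then obtain c where c: "c \<in> rat_closure absv" "converges k c"
        using complete_rat_closure ky unfolding complete_set_def by blast
      have "cauchy_seq (\<lambda>i. f i - k i * b)"
        by (intro cauchy_seq_diff f converges_imp_cauchy[OF converges_cmult[OF c(2)]])
      then have "cauchy_seq y"
        by (simp add: ky(3))
      then obtain z where z: "z \<in> rat_span B" "converges y z"
        using insert ky unfolding complete_set_def by blast
      have "converges (\<lambda>i. k i * b + y i) (c * b + z)"
        by (intro converges_add converges_cmult c z)
      then show "\<exists>x\<in>rat_span (insert b B). converges f x"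
        using rat_span_insertI[OF insert(1,2) c(1) z(1)] by (auto simp flip: ky(3))
    qed
  qed
qed

lemma cauchy_imp_converges:
  assumes "cauchy_seq f"
  shows "\<exists>x. converges f x"
proof -
  obtain B where B: "finite B" "\<forall>x. \<exists>c. (\<forall>b\<in>B. c b \<in> rat_closure absv) \<and> x = (\<Sum>b\<in>B. c b * b)"
    using finite_over_rat_closure by blast
  then have "rat_span B = UNIV"
    unfolding rat_span_def by blast
  then show ?thesis
    using complete_rat_span[OF B(1)] assms unfolding complete_set_def by auto
qed


subsection \<open>Hensel's lemma for quadratic equations\<close>

text \<open>Substituting y = x + t turns the equation into e + m t + t^2 = 0 with m = 2x - 1 a unit,
  that is, t = \<phi>(t). On the ball of radius |e| the map \<phi> is a contraction with factor |e|
  < 1, so its iterates from 0 converge to a fixed point.\<close>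

lemma hensel_quadratic:
  assumes x: "absv x \<le> 1" and small: "absv (x\<^sup>2 - x - c) < 1" and simple: "absv (2 * x - 1) = 1"
  obtains y where "y\<^sup>2 - y = c"
proof -
  define e where "e = x\<^sup>2 - x - c"
  define m where "m = 2 * x - 1"
  define \<phi> where "\<phi> t = - (e + t\<^sup>2) / m" for t
  define t where "t k = (\<phi> ^^ k) 0" for k
  have m: "m \<noteq> 0" "absv m = 1"
    using simple by (auto simp: m_def)
  have e1: "absv e < 1"
    using small by (simp add: e_def)
  have t_Suc: "t (Suc k) = \<phi> (t k)" for k
    by (simp add: t_def)
  have bound: "absv (t k) \<le> absv e" for k
  proof (induction k)
    case (Suc k)
    have "absv (t k) ^ 2 \<le> absv (t k) * 1"
      unfolding power2_eq_square using Suc e1 by (intro mult_left_mono) (auto simp: absv_nonneg)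
    then have "absv ((t k)\<^sup>2) \<le> absv e"
      using Suc by (simp add: absv_power)
    then show ?case
      using absv_ultrametric[of e "(t k)\<^sup>2"] absv_minus[of "e + (t k)\<^sup>2"]
      by (simp only: t_Suc \<phi>_def absv_divide m div_by_1)
  qed (simp add: t_def absv_nonneg)
  have contract: "absv (\<phi> u - \<phi> v) \<le> absv (u - v) * absv e" if "absv u \<le> absv e" "absv v \<le> absv e" for u v
  proof -
    have "\<phi> u - \<phi> v = (v - u) * (u + v) / m"
      using m by (simp add: \<phi>_def field_simps power2_eq_square)
    then have "absv (\<phi> u - \<phi> v) = absv (u - v) * absv (u + v)"
      by (simp add: absv_divide absv_mult m absv_diff_commute)
    then show ?thesis
      using absv_ultrametric[of u v] that by (simp add: absv_nonneg mult_left_mono)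
  qed
  have step: "absv (t (Suc k) - t k) \<le> absv e ^ k" for k
  proof (induction k)
    case 0
    then show ?case
      using bound[of 1] e1 by (simp add: t_def)
  next
    case (Suc k)
    have "absv (t (Suc (Suc k)) - t (Suc k)) \<le> absv (t (Suc k) - t k) * absv e"
      unfolding t_Suc[of "Suc k"] t_Suc[of k] using contract bound t_Suc by metis
    also have "\<dots> \<le> absv e ^ k * absv e"
      using Suc by (intro mult_right_mono) (auto simp: absv_nonneg)
    finally show ?case
      by (simp add: mult.commute)
  qed
  have tail: "absv (t (k + l) - t k) \<le> absv e ^ k" for k l
  proof (induction l)
    case (Suc l)
    have "absv e ^ (k + l) \<le> absv e ^ k"
      using e1 by (intro power_decreasing) (auto simp: absv_nonneg)
    then have "absv (t (k + Suc l) - t (k + l)) \<le> absv e ^ k"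
      using step[of "k + l"] by simp
    then show ?case
      using Suc absv_diff_trans[of "t (k + Suc l)" "t k" "t (k + l)"] by simp
  qed (simp add: absv_nonneg)
  have "cauchy_seq t"
    unfolding cauchy_seq_def
  proof (intro allI impI)
    fix d :: real
    assume "d > 0"
    then obtain k where k: "absv e ^ k < d"
      using e1 absv_nonneg real_arch_pow_inv by blast
    have "absv (t i - t j) < d" if "i \<ge> k" "j \<ge> k" for i j
    proof -
      have "absv (t i - t k) < d" "absv (t k - t j) < d"
        using tail[of k "i - k"] tail[of k "j - k"] that k by (simp_all add: absv_diff_commute)
      then show ?thesis
        using absv_diff_trans[of "t i" "t j" "t k"] by simp
    qed
    then show "\<exists>k. \<forall>i\<ge>k. \<forall>j\<ge>k. absv (t i - t j) < d"
      by blast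
  qed
  then obtain u where u: "converges t u"
    using cauchy_imp_converges by blast
  have u_bound: "absv u \<le> absv e"
  proof (rule ccontr)
    assume *: "\<not> absv u \<le> absv e"
    then have "absv u > 0"
      using absv_nonneg[of e] by linarith
    then obtain k where "absv (t k - u) < absv u"
      using convergesD[OF u] by blast
    then show False
      using * bound[of k] absv_diff_le[of "t k" "t k - u"] by simp
  qed
  have "converges (\<lambda>k. t (Suc k)) (\<phi> u)"
  proof (rule convergesI)
    fix d :: real
    assume "d > 0"
    then obtain k where k: "\<forall>i\<ge>k. absv (t i - u) < d"
      using convergesD[OF u] by blast
    have "absv (t (Suc i) - \<phi> u) < d" if "i \<ge> k" for i
    proof -
      have "absv (t (Suc i) - \<phi> u) \<le> absv (t i - u) * absv e"
        unfolding t_Suc using contract bound u_bound by blast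
      also have "\<dots> \<le> absv (t i - u) * 1"
        using e1 by (intro mult_left_mono) (auto simp: absv_nonneg)
      finally show ?thesis
        using k that by (metis le_less_trans mult.right_neutral)
    qed
    then show "\<exists>k. \<forall>i\<ge>k. absv (t (Suc i) - \<phi> u) < d"
      by blast
  qed
  moreover have "converges (\<lambda>k. t (Suc k)) u"
    using u unfolding converges_def by (rule LIMSEQ_Suc)
  ultimately have "\<phi> u = u"
    using converges_unique by blast
  then have "u\<^sup>2 + m * u + e = 0"
    using m by (simp add: \<phi>_def field_simps add_eq_0_iff)
  then have "(x + u)\<^sup>2 - (x + u) = c"
    by (simp add: m_def e_def power2_eq_square algebra_simps)
  then show thesis
    by (rule that)
qed


subsection \<open>Uniformizers and residues\<close>

text \<open>The cardinality 0 would stand for infinitely many residue classes, and the normalization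
  would then read |\<pi>| = 1/0 = 0. Positivity thus carries the finiteness of the residue
  field.\<close>

lemma residue_card_pos: "residue_card absv > 0"
proof (rule ccontr)
  assume "\<not> residue_card absv > 0"
  then obtain \<pi> where "uniformizer absv \<pi>" "absv \<pi> = 0"
    using normalized by auto
  then show False
    by (simp add: uniformizer_def absv_eq_0)
qed

lemma uniformizer_exists: "\<exists>\<pi>. uniformizer absv \<pi>"
  using normalized by blast

lemma uniformizer_props:
  assumes "uniformizer absv \<pi>"
  shows "\<pi> \<noteq> 0" "0 < absv \<pi>" "absv \<pi> < 1" "absv x < 1 \<longleftrightarrow> absv x \<le> absv \<pi>"
proof -
  show 0: "\<pi> \<noteq> 0"
    using assms by (simp add: uniformizer_def)
  then show pos: "0 < absv \<pi>"
    by (rule absv_pos)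
  have eq: "{x. absv x < 1} = (\<lambda>y. \<pi> * y) ` {x. absv x \<le> 1}"
    using assms by (simp add: uniformizer_def max_ideal_def int_ring_def)
  have "\<pi> * 1 \<in> {x. absv x < 1}"
    unfolding eq by (rule imageI) simp
  then show lt: "absv \<pi> < 1"
    by simp
  show "absv x < 1 \<longleftrightarrow> absv x \<le> absv \<pi>"
  proof
    assume "absv x < 1"
    then obtain y where y: "absv y \<le> 1" "x = \<pi> * y"
      using eq by blast
    then show "absv x \<le> absv \<pi>"
      using pos by (simp add: absv_mult mult_left_le)
  qed (use lt in linarith)
qed

lemma uniformizerI:
  assumes "uniformizer absv \<pi>" "absv \<pi>' = absv \<pi>"
  shows "uniformizer absv \<pi>'"
proof -
  note p = uniformizer_props[OF assms(1)]
  have "\<pi>' \<noteq> 0"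
    using assms(2) p(2) by auto
  moreover have "x \<in> max_ideal absv \<longleftrightarrow> x \<in> (\<lambda>y. \<pi>' * y) ` int_ring absv" for x
  proof
    assume "x \<in> max_ideal absv"
    then have "absv x \<le> absv \<pi>'"
      using p(4) assms(2) by (simp add: max_ideal_def)
    then have "x / \<pi>' \<in> int_ring absv"
      using p(2) by (simp add: int_ring_def absv_divide assms(2) absv_nonneg)
    then have "\<pi>' * (x / \<pi>') \<in> (\<lambda>y. \<pi>' * y) ` int_ring absv"
      by (rule imageI)
    then show "x \<in> (\<lambda>y. \<pi>' * y) ` int_ring absv"
      using \<open>\<pi>' \<noteq> 0\<close> by simp
  next
    assume "x \<in> (\<lambda>y. \<pi>' * y) ` int_ring absv"
    then have "absv x \<le> absv \<pi>"
      using p(2) assms(2) by (auto simp: int_ring_def absv_mult mult_left_le)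
    then show "x \<in> max_ideal absv"
      using p(4) by (simp add: max_ideal_def)
  qed
  ultimately show ?thesis
    unfolding uniformizer_def by blast
qed

lemma int_decomposition:
  assumes \<pi>: "uniformizer absv \<pi>" and a: "a \<noteq> 0" "absv a \<le> 1"
  obtains k :: nat and u where "absv u = 1" "a = \<pi> ^ k * u"
proof -
  note p = uniformizer_props[OF \<pi>]
  obtain m where m: "absv \<pi> ^ m < absv a"
    using real_arch_pow_inv[of "absv a" "absv \<pi>"] a p absv_pos by blast
  \<comment> \<open>The least such exponent places |a| above |\<pi>|^(k+1) and at most at |\<pi>|^k,
    which leaves no room for \<open>u\<close> except absolute value 1.\<close>
  define k where "k = (LEAST k. absv \<pi> ^ Suc k < absv a)"
  have "absv \<pi> ^ Suc m < absv a"
    using m p(2,3) mult_left_le_one_le[of "absv \<pi> ^ m" "absv \<pi>"]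
    unfolding power_Suc by (meson le_less_trans less_imp_le zero_le_power)
  then have k: "absv \<pi> ^ Suc k < absv a"
    unfolding k_def by (rule LeastI)
  have k': "absv a \<le> absv \<pi> ^ k"
  proof (cases k)
    case (Suc j)
    then show ?thesis
      using not_less_Least[of j "\<lambda>k. absv \<pi> ^ Suc k < absv a"] by (simp add: k_def not_less)
  qed (simp add: a)
  define u where "u = a / \<pi> ^ k"
  have "absv u = absv a / absv \<pi> ^ k"
    by (simp add: u_def absv_divide absv_power)
  then have "absv u \<le> 1" "absv u > absv \<pi>"
    using k k' p(2) by (simp_all add: divide_le_eq less_divide_eq)
  then have "absv u = 1"
    using p(4)[of u] by linarith
  moreover have "a = \<pi> ^ k * u"
    using p by (simp add: u_def)
  ultimately show thesis
    using that by blast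
qed

text \<open>Natural exponents on both sides take the place of one integer exponent; the proof makes
  one of them 0.\<close>

lemma decomposition:
  assumes \<pi>: "uniformizer absv \<pi>" and a: "a \<noteq> 0"
  obtains k l :: nat and u where "absv u = 1" "a * \<pi> ^ l = \<pi> ^ k * u"
proof (cases "absv a \<le> 1")
  case True
  then obtain k :: nat and u where "absv u = 1" "a = \<pi> ^ k * u"
    using int_decomposition[OF \<pi> a] by metis
  then show ?thesis
    using that[of u 0 k] by simp
next
  case False
  then have "absv (inverse a) \<le> 1" "inverse a \<noteq> 0"
    using a by (simp_all add: absv_inverse inverse_le_1_iff)
  then obtain l :: nat and u where u: "absv u = 1" "inverse a = \<pi> ^ l * u"
    using int_decomposition[OF \<pi>] by metis
  have "u \<noteq> 0"
    using u(1) by auto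
  have "a * \<pi> ^ l = inverse u"
    using arg_cong[OF u(2), of "\<lambda>x. a * x * inverse u"] a \<open>u \<noteq> 0\<close> by (simp add: field_simps)
  then show ?thesis
    using that[of "inverse u" l 0] u by (simp add: absv_inverse)
qed

text \<open>In residue characteristic 2, x + y and x - y are congruent modulo the maximal ideal, so
  squaring is injective on the residue field. The residue field is finite, so squaring is also
  surjective.\<close>

lemma residue_square:
  assumes two: "absv 2 < 1" and u: "absv u \<le> 1"
  obtains s where "absv s \<le> 1" "absv (u - s\<^sup>2) < 1"
proof -
  define cls where "cls x = {y. y - x \<in> max_ideal absv}" for x
  have cls_eq: "cls x = cls y \<longleftrightarrow> absv (x - y) < 1" for x y
  proof
    assume "cls x = cls y"
    moreover have "x \<in> cls x"
      by (simp add: cls_def max_ideal_def)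
    ultimately show "absv (x - y) < 1"
      by (auto simp: cls_def max_ideal_def)
  next
    assume xy: "absv (x - y) < 1"
    have "absv (z - x) < 1 \<longleftrightarrow> absv (z - y) < 1" for z
      using xy absv_diff_trans[of z x y] absv_diff_trans[of z y x] absv_diff_commute[of x y] by auto
    then show "cls x = cls y"
      by (simp add: cls_def max_ideal_def)
  qed
  define Res where "Res = cls ` int_ring absv"
  define pick where "pick A = (SOME x. x \<in> int_ring absv \<and> cls x = A)" for A
  define sq where "sq A = cls ((pick A)\<^sup>2)" for A
  have fin: "finite Res"
    using residue_card_pos unfolding residue_card_def Res_def cls_def[abs_def] by (meson card_gt_0_iff)
  have sq_eq: "absv (x\<^sup>2 - y\<^sup>2) < 1 \<longleftrightarrow> absv (x - y) < 1" if "absv x \<le> 1" "absv y \<le> 1" for x y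
  proof -
    have f: "absv (x\<^sup>2 - y\<^sup>2) = absv (x - y) * absv (x + y)"
      by (simp add: absv_mult[symmetric] power2_eq_square algebra_simps)
    have le: "absv (x - y) \<le> 1" "absv (x + y) \<le> 1"
      using absv_diff_le[of x y] absv_ultrametric[of x y] that by simp_all
    have "absv (2 * y) < 1"
      using two that by (simp add: absv_mult) (metis absv_nonneg le_less_trans mult_left_le)
    then have "absv (x + y) = 1" if "absv (x - y) = 1"
      using absv_add_eq[of "2 * y" "x - y"] that by (simp add: algebra_simps)
    then show ?thesis
      unfolding f using le
      by (metis absv_nonneg le_less_trans less_eq_real_def mult_cancel_left2 mult_left_le order_less_irrefl)
  qed
  have rep: "sq (cls x) = cls (x\<^sup>2)" if "x \<in> int_ring absv" for x
  proof -
    have "pick (cls x) \<in> int_ring absv \<and> cls (pick (cls x)) = cls x"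
      unfolding pick_def by (rule someI[of _ x]) (use that in simp)
    then show ?thesis
      using that sq_eq[of "pick (cls x)" x] by (simp add: sq_def cls_eq int_ring_def)
  qed
  have "sq ` Res \<subseteq> Res"
    unfolding Res_def by (force simp: rep int_ring_def absv_power power_le_one absv_nonneg)
  moreover have "inj_on sq Res"
    unfolding Res_def
  proof (intro inj_onI)
    fix A B
    assume "A \<in> cls ` int_ring absv" "B \<in> cls ` int_ring absv" "sq A = sq B"
    then obtain x y where "x \<in> int_ring absv" "y \<in> int_ring absv" "A = cls x" "B = cls y"
      "cls (x\<^sup>2) = cls (y\<^sup>2)"
      using rep by auto
    then show "A = B"
      by (simp add: cls_eq sq_eq int_ring_def)
  qed
  ultimately have "sq ` Res = Res"
    using fin by (simp add: endo_inj_surj)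
  moreover have "cls u \<in> Res"
    using u by (simp add: Res_def int_ring_def)
  ultimately obtain s where s: "s \<in> int_ring absv" "cls u = sq (cls s)"
    unfolding Res_def by blast
  then have "absv (u - s\<^sup>2) < 1"
    by (simp add: rep cls_eq)
  then show thesis
    using that[of s] s by (simp add: int_ring_def)
qed

lemma unit_square_mod:
  assumes two: "absv 2 < 1" and u: "absv u = 1"
  obtains s v where "absv s = 1" "absv (v - 1) < 1" "u = s\<^sup>2 * v"
proof -
  obtain s where s: "absv s \<le> 1" "absv (u - s\<^sup>2) < 1"
    using residue_square[OF two, of u] u by auto
  have s2: "absv (s\<^sup>2) = 1"
    using absv_add_eq[of "s\<^sup>2 - u" u] s u by (simp add: absv_diff_commute)
  then have s1: "absv s = 1"
    using absv_nonneg[of s] by (simp add: absv_power power2_eq_1_iff)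
  then have s0: "s \<noteq> 0"
    by auto
  have "u / s\<^sup>2 - 1 = (u - s\<^sup>2) / s\<^sup>2"
    using s0 by (simp add: field_simps)
  then have "absv (u / s\<^sup>2 - 1) < 1"
    using s s2 by (simp add: absv_divide)
  then show thesis
    using that[of s "u / s\<^sup>2"] s0 s1 by simp
qed

end


section \<open>Kummer extensions\<close>

subsection \<open>Roots of unity\<close>

lemma roots_of_unity_bound:
  assumes "k \<ge> 1"
  shows "finite (roots_of_unity k :: 'a::field_char_0 set)" "card (roots_of_unity k :: 'a set) \<le> k"
proof -
  let ?p = "Polynomial.monom 1 k - 1 :: 'a poly"
  have deg: "Polynomial.degree ?p = k"
  proof -
    have "Polynomial.degree (Polynomial.monom (1::'a) k + (- 1)) = Polynomial.degree (Polynomial.monom (1::'a) k)"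
      using assms by (intro degree_add_eq_left) (simp add: degree_monom_eq)
    then show ?thesis
      by (simp add: degree_monom_eq)
  qed
  have "?p \<noteq> 0"
    using deg assms by auto
  moreover have "roots_of_unity k = {x. poly ?p x = 0}"
    by (auto simp: roots_of_unity_def poly_monom)
  ultimately show "finite (roots_of_unity k :: 'a set)" "card (roots_of_unity k :: 'a set) \<le> k"
    using poly_roots_finite[of ?p] card_poly_roots_bound[of ?p] deg by simp_all
qed

text \<open>X^n - 1 = (X^k - 1) q with deg q \<le> k (l - 1). At most that many of the n roots come
  from \<open>q\<close>, so at least k are roots of X^k - 1.\<close>

lemma card_roots_of_unity_dvd:
  assumes n: "n \<ge> 1" and card: "card (roots_of_unity n :: 'a::field_char_0 set) = n" and "k dvd n"
  shows "card (roots_of_unity k :: 'a set) = k"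
proof -
  obtain l where l: "n = k * l"
    using \<open>k dvd n\<close> by blast
  have kl: "k \<ge> 1" "l \<ge> 1"
    using n l by (auto simp: Suc_le_eq)
  define q :: "'a poly" where "q = (\<Sum>i<l. Polynomial.monom 1 (k * i))"
  have pq: "poly q x = (\<Sum>i<l. (x ^ k) ^ i)" for x
    by (simp add: q_def poly_sum poly_monom power_mult)
  have "poly q 1 \<noteq> 0"
    using kl by (simp add: pq)
  then have "q \<noteq> 0"
    by auto
  have "Polynomial.degree q \<le> k * (l - 1)"
    unfolding q_def by (rule degree_sum_le) (auto intro!: order_trans[OF degree_monom_le])
  then have q: "finite {x. poly q x = 0}" "card {x. poly q x = 0} \<le> k * (l - 1)"
    using poly_roots_finite[OF \<open>q \<noteq> 0\<close>] card_poly_roots_bound[OF \<open>q \<noteq> 0\<close>] by simp_all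
  have "roots_of_unity n \<subseteq> roots_of_unity k \<union> {x. poly q x = 0}"
  proof
    fix x :: 'a
    assume "x \<in> roots_of_unity n"
    then have "(x ^ k) ^ l - 1 = 0"
      by (simp add: roots_of_unity_def l power_mult)
    then have "(x ^ k - 1) * poly q x = 0"
      by (simp add: pq power_diff_1_eq)
    then show "x \<in> roots_of_unity k \<union> {x. poly q x = 0}"
      by (simp add: roots_of_unity_def)
  qed
  then have "card (roots_of_unity n :: 'a set) \<le> card (roots_of_unity k \<union> {x. poly q x = 0})"
    by (intro card_mono finite_UnI q roots_of_unity_bound kl)
  also have "\<dots> \<le> card (roots_of_unity k :: 'a set) + card {x. poly q x = 0}"
    by (rule card_Un_le)
  finally have "card (roots_of_unity n :: 'a set) \<le> card (roots_of_unity k :: 'a set) + card {x. poly q x = 0}" .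
  then have "k * l \<le> card (roots_of_unity k :: 'a set) + k * (l - 1)"
    using q(2) card l by simp
  moreover have "k * l = k + k * (l - 1)"
    using kl by (cases l) simp_all
  ultimately show ?thesis
    using roots_of_unity_bound(2)[OF kl(1), where 'a = 'a] by simp
qed

text \<open>The base field already has n roots of X^n - 1, and the closure cannot have more.\<close>

lemma roots_of_unity_closure:
  fixes z :: "'a::field_char_0 alg_closure"
  assumes n: "n \<ge> 1" and card: "card (roots_of_unity n :: 'a set) = n" and "z ^ n = 1"
  obtains \<omega> :: 'a where "\<omega> \<in> roots_of_unity n" "z = to_ac \<omega>"
proof -
  have sub: "to_ac ` (roots_of_unity n :: 'a set) \<subseteq> roots_of_unity n"
    by (auto simp: roots_of_unity_def simp flip: to_ac_power)
  have "card (to_ac ` (roots_of_unity n :: 'a set)) = n"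
    using card by (subst card_image) (auto simp: inj_on_def)
  then have "to_ac ` (roots_of_unity n :: 'a set) = roots_of_unity n"
    using sub roots_of_unity_bound[OF n, where 'a = "'a alg_closure"] by (metis card_seteq)
  moreover have "z \<in> roots_of_unity n"
    using assms by (simp add: roots_of_unity_def)
  ultimately show thesis
    using that by auto
qed

text \<open>This is X^n - 1 = \<Prod>(X - \<omega>) at X = 0. The two sides agree because their
  difference has degree below n but n roots.\<close>

lemma prod_minus_roots_of_unity:
  assumes n: "n \<ge> 1" and card: "card (roots_of_unity n :: 'a::field_char_0 set) = n"
  shows "(\<Prod>\<omega>\<in>roots_of_unity n. - \<omega>) = (- 1 :: 'a)"
proof -
  let ?q = "\<Prod>\<omega>\<in>roots_of_unity n. [:- \<omega>, 1 :: 'a:]"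
  let ?p = "Polynomial.monom 1 n - 1 :: 'a poly"
  have fin: "finite (roots_of_unity n :: 'a set)"
    using roots_of_unity_bound[OF n] by blast
  have deg_q: "Polynomial.degree ?q = n"
    by (subst degree_prod_eq_sum_degree) (auto simp: card)
  have lead_q: "Polynomial.lead_coeff ?q = 1"
    by (simp add: lead_coeff_prod)
  have "?p = ?q"
  proof (rule ccontr)
    assume ne: "?p \<noteq> ?q"
    have "Polynomial.coeff (?p - ?q) n = 0"
      using lead_q n by (simp add: deg_q)
    moreover have "Polynomial.degree (?p - ?q) \<le> n"
      by (intro degree_diff_le) (auto simp: deg_q degree_monom_le)
    ultimately have "Polynomial.degree (?p - ?q) < n"
      using n by (metis eq_zero_or_degree_less ne right_minus_eq)
    moreover have "roots_of_unity n \<subseteq> {x. poly (?p - ?q) x = 0}"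
      using fin by (auto simp: poly_prod poly_monom roots_of_unity_def intro!: prod_zero)
    then have "n \<le> card {x. poly (?p - ?q) x = 0}"
      using ne poly_roots_finite[of "?p - ?q"] by (metis card card_mono right_minus_eq)
    ultimately show False
      using card_poly_roots_bound[of "?p - ?q"] ne by fastforce
  qed
  then have "poly ?q 0 = poly ?p 0"
    by simp
  then show ?thesis
    using n by (simp add: poly_prod poly_monom)
qed


subsection \<open>Evaluating polynomials in the algebraic closure\<close>

definition evp :: "'a::field_char_0 poly \<Rightarrow> 'a alg_closure \<Rightarrow> 'a alg_closure" where
  "evp p x = poly (map_poly to_ac p) x"

lemma evp_0 [simp]: "evp 0 x = 0"
  by (simp add: evp_def)

lemma evp_pCons [simp]: "evp (pCons a p) x = to_ac a + x * evp p x"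
  by (simp add: evp_def map_poly_pCons)

lemma evp_add [simp]: "evp (p + q) x = evp p x + evp q x"
proof -
  have "map_poly to_ac (p + q) = map_poly to_ac p + map_poly to_ac q"
    by (intro poly_eqI) (simp add: coeff_map_poly)
  then show ?thesis
    by (simp add: evp_def)
qed

lemma evp_diff [simp]: "evp (p - q) x = evp p x - evp q x"
  using evp_add[of "p - q" q x] by simp

lemma evp_smult [simp]: "evp (Polynomial.smult a p) x = to_ac a * evp p x"
  by (induction p) (simp_all add: algebra_simps)

lemma evp_mult [simp]: "evp (p * q) x = evp p x * evp q x"
  by (induction p) (simp_all add: algebra_simps)

lemma evp_monom [simp]: "evp (Polynomial.monom a k) x = to_ac a * x ^ k"
  by (simp add: evp_def map_poly_monom poly_monom)

lemma evp_eq_sum: "evp p x = (\<Sum>i\<le>Polynomial.degree p. to_ac (Polynomial.coeff p i) * x ^ i)"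
proof -
  have "Polynomial.degree (map_poly to_ac p) = Polynomial.degree p"
    by (intro degree_map_poly) simp
  then show ?thesis
    by (simp add: evp_def poly_altdef coeff_map_poly)
qed


subsection \<open>Subfields of the algebraic closure\<close>

text \<open>Closure under inverses is left out: all elements are algebraic over the base field, so
  it follows.\<close>

definition intermediate_ring :: "'a::field_char_0 alg_closure set \<Rightarrow> bool" where
  "intermediate_ring E \<longleftrightarrow> range to_ac \<subseteq> E \<and> (\<forall>x\<in>E. \<forall>y\<in>E. x - y \<in> E \<and> x * y \<in> E)"

lemma intermediate_ringD:
  assumes "intermediate_ring E"
  shows "to_ac a \<in> E" "0 \<in> E" "1 \<in> E" "x \<in> E \<Longrightarrow> y \<in> E \<Longrightarrow> x + y \<in> E" "x \<in> E \<Longrightarrow> - x \<in> E"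
    "x \<in> E \<Longrightarrow> y \<in> E \<Longrightarrow> x - y \<in> E" "x \<in> E \<Longrightarrow> y \<in> E \<Longrightarrow> x * y \<in> E"
proof -
  show F: "to_ac a \<in> E" for a
    using assms by (auto simp: intermediate_ring_def)
  show 0: "0 \<in> E" and "1 \<in> E"
    using F[of 0] F[of 1] by simp_all
  show "x \<in> E \<Longrightarrow> y \<in> E \<Longrightarrow> x - y \<in> E" "x \<in> E \<Longrightarrow> y \<in> E \<Longrightarrow> x * y \<in> E" for x y
    using assms by (auto simp: intermediate_ring_def)
  then show "x \<in> E \<Longrightarrow> - x \<in> E" for x
    using 0 by fastforce
  then show "x \<in> E \<Longrightarrow> y \<in> E \<Longrightarrow> x + y \<in> E"
    using \<open>\<And>y x. x \<in> E \<Longrightarrow> y \<in> E \<Longrightarrow> x - y \<in> E\<close> by (metis diff_minus_eq_add)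
qed

lemma intermediate_ring_power: "intermediate_ring E \<Longrightarrow> x \<in> E \<Longrightarrow> x ^ k \<in> E"
  by (induction k) (auto intro: intermediate_ringD)

lemma intermediate_ring_prod: "intermediate_ring E \<Longrightarrow> (\<And>i. i \<in> A \<Longrightarrow> f i \<in> E) \<Longrightarrow> prod f A \<in> E"
  by (induction A rule: infinite_finite_induct) (auto intro: intermediate_ringD)

lemma intermediate_ring_evp: "intermediate_ring E \<Longrightarrow> x \<in> E \<Longrightarrow> evp p x \<in> E"
  by (induction p) (auto intro: intermediate_ringD)

text \<open>A minimal equation over the base field expresses \<open>x\<^sup>-\<^sup>1\<close> as a polynomial in \<open>x\<close>.\<close>

lemma intermediate_ring_inverse:
  assumes E: "intermediate_ring E" and x: "x \<in> E"
  shows "inverse x \<in> E"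
proof (cases "x = 0")
  case True
  then show ?thesis
    using x by simp
next
  case False
  define P where "P p \<longleftrightarrow> p \<noteq> 0 \<and> evp p x = 0" for p
  obtain p0 where "P p0"
    unfolding P_def evp_def by (rule alg_closure_algebraic[of x]) blast
  then obtain p where p: "P p" "\<And>q. P q \<Longrightarrow> Polynomial.degree p \<le> Polynomial.degree q"
    using ex_has_least_nat[of P p0 Polynomial.degree] by blast
  obtain a q where q: "p = pCons a q"
    by (cases p)
  have "a \<noteq> 0"
  proof
    assume a: "a = 0"
    then have "P q"
      using p(1) False by (auto simp: P_def q)
    then show False
      using p(2)[of q] a p(1) by (auto simp: q P_def)
  qed
  moreover have eq: "to_ac a + x * evp q x = 0"
    using p(1) by (simp add: P_def q)
  ultimately have "inverse x = - (evp q x * to_ac (inverse a))"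
    using False by (simp add: field_simps eq_neg_iff_add_eq_0)
  then show ?thesis
    using E x by (simp del: to_ac_inverse add: intermediate_ringD intermediate_ring_evp)
qed

lemma finite_extension_intermediate: "finite_extension E \<Longrightarrow> intermediate_ring E"
  by (simp add: finite_extension_def intermediate_ring_def)

text \<open>\<open>finite_extension\<close> wants a set of generators. Here they come as a family,
  possibly with repetitions, and the coefficients of equal generators are added up.\<close>

lemma finite_extensionI:
  assumes E: "intermediate_ring E" and fin: "finite I"
    and span: "\<And>x. x \<in> E \<Longrightarrow> \<exists>c. x = (\<Sum>i\<in>I. to_ac (c i) * g i)"
  shows "finite_extension E"
proof -
  have "\<exists>c. x = (\<Sum>b\<in>g ` I. to_ac (c b) * b)" if x: "x \<in> E" for x
  proof -
    obtain c where "x = (\<Sum>i\<in>I. to_ac (c i) * g i)"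
      using span[OF x] by blast
    also have "\<dots> = (\<Sum>b\<in>g ` I. \<Sum>i\<in>{i \<in> I. g i = b}. to_ac (c i) * g i)"
      by (rule sum.image_gen[OF fin])
    also have "\<dots> = (\<Sum>b\<in>g ` I. to_ac (\<Sum>i\<in>{i \<in> I. g i = b}. c i) * b)"
      by (intro sum.cong refl) (simp add: to_ac_sum sum_distrib_right)
    finally show ?thesis
      by (rule exI[where x = "\<lambda>b. \<Sum>i\<in>{i \<in> I. g i = b}. c i"])
  qed
  then have "(\<forall>x\<in>E. inverse x \<in> E) \<and> (\<exists>B. finite B \<and> (\<forall>x\<in>E. \<exists>c. x = (\<Sum>b\<in>B. to_ac (c b) * b)))"
    using intermediate_ring_inverse[OF E] finite_imageI[OF fin] by blast
  then show ?thesis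
    using E unfolding finite_extension_def intermediate_ring_def by blast
qed

lemma galoisD:
  assumes "\<tau> \<in> galois_group E"
  shows "x \<in> E \<Longrightarrow> \<tau> x \<in> E" "x \<in> E \<Longrightarrow> y \<in> E \<Longrightarrow> \<tau> (x + y) = \<tau> x + \<tau> y"
    "x \<in> E \<Longrightarrow> y \<in> E \<Longrightarrow> \<tau> (x * y) = \<tau> x * \<tau> y" "\<tau> (to_ac a) = to_ac a" "\<tau> 0 = 0" "\<tau> 1 = 1"
    "\<tau> \<in> extensional E"
proof -
  have b: "bij_betw \<tau> E E"
    using assms by (simp add: galois_group_def)
  then show "x \<in> E \<Longrightarrow> \<tau> x \<in> E"
    by (auto simp: bij_betw_def)
  show F: "\<tau> (to_ac a) = to_ac a" for a
    using assms by (simp add: galois_group_def)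
  show "\<tau> 0 = 0" "\<tau> 1 = 1"
    using F[of 0] F[of 1] by simp_all
qed (use assms in \<open>auto simp: galois_group_def\<close>)

context
  fixes E :: "'a::field_char_0 alg_closure set" and \<tau>
  assumes E: "intermediate_ring E" and \<tau>: "\<tau> \<in> galois_group E"
begin

lemma galois_evp: "x \<in> E \<Longrightarrow> \<tau> (evp p x) = evp p (\<tau> x)"
  by (induction p) (simp_all add: galoisD[OF \<tau>] intermediate_ringD[OF E] intermediate_ring_evp[OF E])

lemma galois_power: "x \<in> E \<Longrightarrow> \<tau> (x ^ k) = \<tau> x ^ k"
  using galois_evp[of x "Polynomial.monom 1 k"] by simp

lemma galois_prod: "(\<And>i. i \<in> A \<Longrightarrow> f i \<in> E) \<Longrightarrow> \<tau> (prod f A) = (\<Prod>i\<in>A. \<tau> (f i))"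
  by (induction A rule: infinite_finite_induct)
    (simp_all add: galoisD[OF \<tau>] intermediate_ring_prod[OF E])

end


subsection \<open>Adjoining an n-th root\<close>

text \<open>X^n - b may be reducible: the degree of \<beta> over the base field turns out to be some
  divisor \<open>deg\<close> of n, possibly 1.\<close>

locale kummer =
  fixes n :: nat and b :: "'f::field_char_0" and \<beta> :: "'f alg_closure"
  assumes n_pos: "n \<ge> 1"
    and roots: "card (roots_of_unity n :: 'f set) = n"
    and b_nonzero: "b \<noteq> 0"
    and root: "\<beta> ^ n = to_ac b"
begin

definition K :: "'f alg_closure set" where
  "K = range (\<lambda>p. evp p \<beta>)"

lemma \<beta>_nonzero: "\<beta> \<noteq> 0"
  using root b_nonzero n_pos by (metis not_one_le_zero power_0_left to_ac_eq_0_iff)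

lemma intermediate_K: "intermediate_ring K"
  unfolding intermediate_ring_def
proof (intro conjI ballI)
  show "range to_ac \<subseteq> K"
  proof (rule image_subsetI)
    fix a
    have "to_ac a = evp [:a:] \<beta>"
      by simp
    then show "to_ac a \<in> K"
      unfolding K_def by blast
  qed
  fix x y
  assume "x \<in> K" "y \<in> K"
  then obtain p q where "x = evp p \<beta>" "y = evp q \<beta>"
    unfolding K_def by blast
  then have "x - y = evp (p - q) \<beta>" "x * y = evp (p * q) \<beta>"
    by simp_all
  then show "x - y \<in> K" "x * y \<in> K"
    unfolding K_def by blast+
qed

lemma \<beta>_in_K: "\<beta> \<in> K"
  unfolding K_def using evp_monom[of 1 1 \<beta>] by (metis mult_1 power_one_right rangeI to_ac_1)

definition deg :: nat where
  "deg = (LEAST d. \<exists>p. p \<noteq> 0 \<and> evp p \<beta> = 0 \<and> Polynomial.degree p = d)"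

lemma deg_least:
  assumes "evp p \<beta> = 0" "Polynomial.degree p < deg"
  shows "p = 0"
  using assms not_less_Least[of "Polynomial.degree p" "\<lambda>d. \<exists>p. p \<noteq> 0 \<and> evp p \<beta> = 0 \<and> Polynomial.degree p = d"]
  unfolding deg_def by blast

lemma minimal_poly:
  obtains p where "p \<noteq> 0" "evp p \<beta> = 0" "Polynomial.degree p = deg"
proof -
  have "evp (Polynomial.monom 1 n - [:b:]) \<beta> = 0"
    by (simp add: root)
  moreover have "Polynomial.coeff (Polynomial.monom 1 n - [:b:]) n = 1"
    using n_pos by (cases n) simp_all
  ultimately have "\<exists>d p. p \<noteq> 0 \<and> evp p \<beta> = 0 \<and> Polynomial.degree p = d"
    by (metis Polynomial.coeff_0 zero_neq_one)
  then have "\<exists>p. p \<noteq> 0 \<and> evp p \<beta> = 0 \<and> Polynomial.degree p = deg"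
    unfolding deg_def by (rule LeastI_ex)
  then show thesis
    using that by blast
qed

lemma deg_pos: "deg \<ge> 1"
proof (rule ccontr)
  assume "\<not> deg \<ge> 1"
  then obtain p where p: "p \<noteq> 0" "evp p \<beta> = 0" "Polynomial.degree p = 0"
    using minimal_poly by (metis less_one not_less)
  then obtain a where "p = [:a:]"
    using degree_eq_zeroE by blast
  then show False
    using p by simp
qed

text \<open>All roots of the minimal polynomial of \<open>\<beta>\<close> are products of \<open>\<beta>\<close> with roots of unity, so its
  constant coefficient puts \<open>\<beta>\<^bsup>deg\<^esup>\<close> into the base field.\<close>

lemma \<beta>_power_deg: "\<exists>e. \<beta> ^ deg = to_ac e"
proof -
  obtain p where p: "p \<noteq> 0" "evp p \<beta> = 0" "Polynomial.degree p = deg"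
    by (rule minimal_poly)
  \<comment> \<open>Division with remainder: by minimality of \<open>deg\<close> the remainder
    vanishes, so the minimal polynomial divides X^n - b and all of its roots are n-th roots of
    b.\<close>
  have "evp ((Polynomial.monom 1 n - [:b:]) mod p) \<beta> =
      evp (Polynomial.monom 1 n - [:b:]) \<beta> - evp ((Polynomial.monom 1 n - [:b:]) div p * p) \<beta>"
    by (metis evp_diff minus_div_mult_eq_mod)
  then have "evp ((Polynomial.monom 1 n - [:b:]) mod p) \<beta> = 0"
    by (simp add: root p)
  moreover have "Polynomial.degree ((Polynomial.monom 1 n - [:b:]) mod p) < deg"
    using degree_mod_less[OF p(1), of "Polynomial.monom 1 n - [:b:]"] deg_pos p(3) by fastforce
  ultimately have "(Polynomial.monom 1 n - [:b:]) mod p = 0"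
    by (rule deg_least)
  then obtain q where q: "Polynomial.monom 1 n - [:b:] = p * q"
    by blast
  define P where "P = map_poly to_ac p"
  have degP: "Polynomial.degree P = deg"
    unfolding P_def p(3)[symmetric] by (intro degree_map_poly) simp
  have leadP: "Polynomial.lead_coeff P = to_ac (Polynomial.lead_coeff p)"
    unfolding degP p(3) by (simp add: P_def coeff_map_poly)
  have "P \<noteq> 0"
    using deg_pos degP by auto
  then obtain A where A: "size A = deg" "P = Polynomial.smult (Polynomial.lead_coeff P) (\<Prod>x\<in>#A. [:- x, 1:])"
    using alg_closed_imp_factorization degP by metis
  have "\<exists>\<omega>. \<omega> \<noteq> 0 \<and> x = to_ac \<omega> * \<beta>" if "x \<in># A" for x
  proof -
    have "(\<Prod>x\<in>#A. poly [:- x, 1:] y) = 0" if "y = x" for y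
      using \<open>x \<in># A\<close> that by (auto simp: prod_mset_zero_iff)
    then have "poly P x = 0"
      by (subst A(2)) (simp add: poly_prod_mset)
    then have "evp (Polynomial.monom 1 n - [:b:]) x = 0"
      unfolding q by (simp add: evp_def[of p] P_def)
    then have "(x / \<beta>) ^ n = 1"
      using root \<beta>_nonzero by (simp add: power_divide b_nonzero)
    then obtain \<omega> where \<omega>: "\<omega> \<in> roots_of_unity n" "x / \<beta> = to_ac \<omega>"
      by (rule roots_of_unity_closure[OF n_pos roots])
    have "\<omega> \<noteq> 0"
      using \<omega>(1) n_pos by (auto simp: roots_of_unity_def power_0_left)
    then show ?thesis
      using \<omega> \<beta>_nonzero by (auto simp: field_simps)
  qed
  then have "\<exists>c. c \<noteq> 0 \<and> (\<Prod>x\<in>#A. - x) = to_ac c * \<beta> ^ size A"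
  proof (induction A)
    case empty
    then show ?case
      by (intro exI[of _ 1]) simp
  next
    case (add x A)
    then obtain c \<omega> where "c \<noteq> 0" "(\<Prod>x\<in>#A. - x) = to_ac c * \<beta> ^ size A" "\<omega> \<noteq> 0" "x = to_ac \<omega> * \<beta>"
      by (metis insert_iff set_mset_add_mset_insert)
    then show ?case
      by (intro exI[of _ "- \<omega> * c"]) (simp add: algebra_simps)
  qed
  then obtain c where c: "c \<noteq> 0" "(\<Prod>x\<in>#A. - x) = to_ac c * \<beta> ^ deg"
    using A(1) by auto
  have "to_ac (Polynomial.coeff p 0) = poly P 0"
    by (simp add: poly_0_coeff_0 P_def coeff_map_poly)
  also have "\<dots> = Polynomial.lead_coeff P * (\<Prod>x\<in>#A. - x)"
    by (subst A(2)) (simp add: poly_prod_mset)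
  also have "\<dots> = to_ac (Polynomial.lead_coeff p * c) * \<beta> ^ deg"
    by (simp add: leadP c)
  finally have "\<beta> ^ deg = to_ac (Polynomial.coeff p 0 / (Polynomial.lead_coeff p * c))"
    using c(1) p(1) by (simp add: field_simps)
  then show ?thesis ..
qed

definition e :: 'f where
  "e = (SOME e. \<beta> ^ deg = to_ac e)"

lemma \<beta>_deg: "\<beta> ^ deg = to_ac e"
  unfolding e_def using \<beta>_power_deg by (rule someI_ex)

text \<open>A remainder m > 0 of n modulo \<open>deg\<close> would give the polynomial e^(n div deg)
  X^m - b, which has root \<beta>, degree below \<open>deg\<close> and nonzero constant
  coefficient.\<close>

lemma deg_dvd: "deg dvd n"
proof (rule ccontr)
  assume "\<not> deg dvd n"
  then have m: "n mod deg > 0" "n mod deg < deg"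
    using deg_pos by (auto simp: mod_greater_zero_iff_not_dvd)
  define p where "p = Polynomial.monom (e ^ (n div deg)) (n mod deg) - [:b:]"
  have "\<beta> ^ n = (\<beta> ^ deg) ^ (n div deg) * \<beta> ^ (n mod deg)"
    by (metis div_mult_mod_eq mult.commute power_add power_mult)
  then have "evp p \<beta> = 0"
    by (simp add: p_def \<beta>_deg root)
  moreover have "Polynomial.degree p < deg"
    unfolding p_def using m by (intro degree_diff_less) (auto intro: le_less_trans[OF degree_monom_le])
  ultimately have "p = 0"
    by (rule deg_least)
  then have "Polynomial.coeff p 0 = 0"
    by simp
  then show False
    using m b_nonzero by (simp add: p_def)
qed

lemma roots_deg: "card (roots_of_unity deg :: 'f set) = deg"
  using card_roots_of_unity_dvd[OF n_pos roots deg_dvd] .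

lemma roots_deg_subset: "roots_of_unity deg \<subseteq> (roots_of_unity n :: 'f set)"
  using deg_dvd by (auto simp: roots_of_unity_def power_mult elim!: dvdE)

definition min_poly :: "'f poly" where
  "min_poly = Polynomial.monom 1 deg - [:e:]"

lemma min_poly_degree: "Polynomial.degree min_poly = deg"
proof -
  have "Polynomial.degree (Polynomial.monom 1 deg + (- [:e:])) = Polynomial.degree (Polynomial.monom (1::'f) deg)"
    using deg_pos by (intro degree_add_eq_left) (simp add: degree_monom_eq)
  then show ?thesis
    unfolding min_poly_def diff_conv_add_uminus by (simp only: degree_monom_eq[OF one_neq_zero])
qed

lemma evp_mod_min_poly:
  assumes "x ^ deg = to_ac e"
  shows "evp (p mod min_poly) x = evp p x"
proof -
  have "evp p x = evp (p div min_poly * min_poly) x + evp (p mod min_poly) x"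
    by (metis div_mult_mod_eq evp_add)
  also have "evp (p div min_poly * min_poly) x = 0"
    using assms by (simp add: min_poly_def)
  finally show ?thesis
    by simp
qed

lemma degree_mod_min_poly: "Polynomial.degree (p mod min_poly) < deg"
proof -
  have "min_poly \<noteq> 0"
    using min_poly_degree deg_pos by auto
  then show ?thesis
    using degree_mod_less[of min_poly p] min_poly_degree deg_pos by fastforce
qed

text \<open>Polynomial relations satisfied by \<beta> are multiples of X^deg - e and hence hold at
  every root of it. This is what makes \<open>conj_aut\<close> independent of the chosen
  polynomial.\<close>

lemma evp_eq_transfer:
  assumes "evp p \<beta> = evp q \<beta>" "x ^ deg = to_ac e"
  shows "evp p x = evp q x"
proof -
  have "evp ((p - q) mod min_poly) \<beta> = 0"
    using assms(1) by (simp add: evp_mod_min_poly[OF \<beta>_deg])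
  then have "(p - q) mod min_poly = 0"
    using degree_mod_min_poly deg_least by blast
  then have "evp (p - q) x = 0"
    using evp_mod_min_poly[OF assms(2), of "p - q"] by simp
  then show ?thesis
    by simp
qed

text \<open>The automorphism with \<beta> \<mapsto> \<omega>\<beta>, for \<omega> a
  \<open>deg\<close>-th root of unity. The restriction to \<open>K\<close> matches the extensional
  functions in \<open>galois_group\<close>.\<close>

definition conj_aut :: "'f \<Rightarrow> 'f alg_closure \<Rightarrow> 'f alg_closure" where
  "conj_aut \<omega> = restrict (\<lambda>x. evp (SOME p. evp p \<beta> = x) (to_ac \<omega> * \<beta>)) K"

lemma conj_root: "\<omega> \<in> roots_of_unity deg \<Longrightarrow> (to_ac \<omega> * \<beta>) ^ deg = to_ac e"
  by (simp add: power_mult_distrib \<beta>_deg roots_of_unity_def flip: to_ac_power)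

lemma conj_in_K: "to_ac \<omega> * \<beta> \<in> K"
  by (intro intermediate_ringD[OF intermediate_K] \<beta>_in_K)

lemma conj_aut_evp:
  assumes "\<omega> \<in> roots_of_unity deg"
  shows "conj_aut \<omega> (evp p \<beta>) = evp p (to_ac \<omega> * \<beta>)"
proof -
  have "evp (SOME q. evp q \<beta> = evp p \<beta>) \<beta> = evp p \<beta>"
    by (rule someI) simp
  then have "evp (SOME q. evp q \<beta> = evp p \<beta>) (to_ac \<omega> * \<beta>) = evp p (to_ac \<omega> * \<beta>)"
    using conj_root[OF assms] by (rule evp_eq_transfer)
  then show ?thesis
    by (simp add: conj_aut_def K_def)
qed

lemma conj_aut_hom:
  assumes \<omega>: "\<omega> \<in> roots_of_unity deg"
  shows "x \<in> K \<Longrightarrow> conj_aut \<omega> x \<in> K" "x \<in> K \<Longrightarrow> y \<in> K \<Longrightarrow> conj_aut \<omega> (x + y) = conj_aut \<omega> x + conj_aut \<omega> y"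
    "x \<in> K \<Longrightarrow> y \<in> K \<Longrightarrow> conj_aut \<omega> (x * y) = conj_aut \<omega> x * conj_aut \<omega> y"
    "conj_aut \<omega> (to_ac a) = to_ac a" "conj_aut \<omega> \<beta> = to_ac \<omega> * \<beta>"
proof -
  show "x \<in> K \<Longrightarrow> conj_aut \<omega> x \<in> K"
    using intermediate_ring_evp[OF intermediate_K conj_in_K] by (auto simp: K_def conj_aut_evp[OF \<omega>])
  show "conj_aut \<omega> (x + y) = conj_aut \<omega> x + conj_aut \<omega> y"
    "conj_aut \<omega> (x * y) = conj_aut \<omega> x * conj_aut \<omega> y" if xy: "x \<in> K" "y \<in> K"
  proof -
    obtain p q where pq: "x = evp p \<beta>" "y = evp q \<beta>"
      using xy by (auto simp: K_def)
    show "conj_aut \<omega> (x + y) = conj_aut \<omega> x + conj_aut \<omega> y"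
      using conj_aut_evp[OF \<omega>, of "p + q"] by (simp add: pq conj_aut_evp[OF \<omega>])
    show "conj_aut \<omega> (x * y) = conj_aut \<omega> x * conj_aut \<omega> y"
      using conj_aut_evp[OF \<omega>, of "p * q"] by (simp add: pq conj_aut_evp[OF \<omega>])
  qed
  show "conj_aut \<omega> (to_ac a) = to_ac a"
    using conj_aut_evp[OF \<omega>, of "[:a:]"] by simp
  show "conj_aut \<omega> \<beta> = to_ac \<omega> * \<beta>"
    using conj_aut_evp[OF \<omega>, of "Polynomial.monom 1 1"] by simp
qed

lemma conj_aut_inverse:
  assumes \<omega>: "\<omega> \<in> roots_of_unity deg" and \<omega>': "\<omega>' \<in> roots_of_unity deg" and "\<omega> * \<omega>' = 1"
    and x: "x \<in> K"
  shows "conj_aut \<omega> (conj_aut \<omega>' x) = x"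
proof -
  have hom: "conj_aut \<omega> (evp p y) = evp p (conj_aut \<omega> y)" if "y \<in> K" for p y
    using that
  proof (induction p)
    case 0
    then show ?case
      using conj_aut_hom(4)[OF \<omega>, of 0] by simp
  next
    case (pCons a p)
    then show ?case
      by (simp add: conj_aut_hom[OF \<omega>] intermediate_ringD[OF intermediate_K] intermediate_ring_evp[OF intermediate_K])
  qed
  have "conj_aut \<omega> (to_ac \<omega>' * \<beta>) = to_ac \<omega>' * (to_ac \<omega> * \<beta>)"
    by (simp add: conj_aut_hom[OF \<omega>] intermediate_ringD[OF intermediate_K] \<beta>_in_K)
  also have "\<dots> = to_ac (\<omega> * \<omega>') * \<beta>"
    by (simp add: mult_ac)
  also have "\<dots> = \<beta>"
    by (simp add: \<open>\<omega> * \<omega>' = 1\<close> del: to_ac_mult)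
  finally have "conj_aut \<omega> (to_ac \<omega>' * \<beta>) = \<beta>" .
  moreover obtain p where "x = evp p \<beta>"
    using x by (auto simp: K_def)
  ultimately show ?thesis
    using hom[OF conj_in_K] by (simp only: conj_aut_evp[OF \<omega>'])
qed

lemma conj_aut_galois:
  assumes \<omega>: "\<omega> \<in> roots_of_unity deg"
  shows "conj_aut \<omega> \<in> galois_group K"
proof -
  have "\<omega> \<noteq> 0"
    using \<omega> deg_pos by (auto simp: roots_of_unity_def power_0_left)
  then have \<omega>': "inverse \<omega> \<in> roots_of_unity deg" "\<omega> * inverse \<omega> = 1" "inverse \<omega> * \<omega> = 1"
    using \<omega> by (simp_all add: roots_of_unity_def power_inverse)
  have "bij_betw (conj_aut \<omega>) K K"
    by (rule bij_betw_byWitness[where f' = "conj_aut (inverse \<omega>)"])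
      (auto simp: conj_aut_inverse \<omega> \<omega>' conj_aut_hom)
  then show ?thesis
    using conj_aut_hom[OF \<omega>] by (simp add: galois_group_def conj_aut_def)
qed

lemma galois_determined:
  assumes "\<tau> \<in> galois_group K" "\<tau>' \<in> galois_group K" "\<tau> \<beta> = \<tau>' \<beta>"
  shows "\<tau> = \<tau>'"
proof (rule extensionalityI)
  fix x
  assume "x \<in> K"
  then obtain p where "x = evp p \<beta>"
    by (auto simp: K_def)
  then show "\<tau> x = \<tau>' x"
    using assms galois_evp[OF intermediate_K _ \<beta>_in_K] by metis
qed (use assms in \<open>auto intro: galoisD\<close>)

lemma galois_root:
  assumes "\<tau> \<in> galois_group K"
  obtains \<omega> where "\<omega> \<in> roots_of_unity deg" "\<tau> \<beta> = to_ac \<omega> * \<beta>"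
proof -
  have "\<tau> \<beta> ^ deg = to_ac e"
    using galois_power[OF intermediate_K assms \<beta>_in_K, of deg] galoisD(4)[OF assms] by (simp add: \<beta>_deg)
  then have "(\<tau> \<beta> / \<beta>) ^ deg = 1"
    using \<beta>_nonzero \<beta>_deg by (metis power_divide power_not_zero divide_self)
  then obtain \<omega> where "\<omega> \<in> roots_of_unity deg" "\<tau> \<beta> / \<beta> = to_ac \<omega>"
    by (rule roots_of_unity_closure[OF deg_pos roots_deg])
  then show thesis
    using that \<beta>_nonzero by (simp add: field_simps)
qed

lemma galois_bij: "bij_betw conj_aut (roots_of_unity deg) (galois_group K)"
  unfolding bij_betw_def
proof (intro conjI inj_onI equalityI subsetI)
  fix \<omega> \<omega>'
  assume *: "\<omega> \<in> roots_of_unity deg" "\<omega>' \<in> roots_of_unity deg" "conj_aut \<omega> = conj_aut \<omega>'"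
  then have "to_ac \<omega> * \<beta> = to_ac \<omega>' * \<beta>"
    using conj_aut_hom(5) by metis
  then show "\<omega> = \<omega>'"
    using \<beta>_nonzero by simp
next
  fix \<tau>
  assume \<tau>: "\<tau> \<in> galois_group K"
  then obtain \<omega> where "\<omega> \<in> roots_of_unity deg" "\<tau> \<beta> = to_ac \<omega> * \<beta>"
    by (rule galois_root)
  then show "\<tau> \<in> conj_aut ` roots_of_unity deg"
    using galois_determined[OF \<tau>] conj_aut_galois conj_aut_hom(5) by (metis imageI)
qed (auto simp: conj_aut_galois)

lemma galois_prod_conj: "(\<Prod>\<tau>\<in>galois_group K. g (\<tau> \<beta>)) = (\<Prod>\<omega>\<in>roots_of_unity deg. g (to_ac \<omega> * \<beta>))"
proof -
  have "(\<Prod>\<omega>\<in>roots_of_unity deg. g (conj_aut \<omega> \<beta>)) = (\<Prod>\<tau>\<in>galois_group K. g (\<tau> \<beta>))"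
    by (rule prod.reindex_bij_betw[OF galois_bij])
  then show ?thesis
    by (simp add: conj_aut_hom)
qed

lemma finite_extension_K: "finite_extension K"
proof (rule finite_extensionI[OF intermediate_K, where I = "{..<deg}" and g = "\<lambda>i. \<beta> ^ i"])
  fix x
  assume "x \<in> K"
  then obtain q where "x = evp q \<beta>"
    by (auto simp: K_def)
  define p where "p = q mod min_poly"
  have x: "x = evp p \<beta>" and deg: "Polynomial.degree p < deg"
    using \<open>x = evp q \<beta>\<close> by (simp_all add: p_def evp_mod_min_poly \<beta>_deg degree_mod_min_poly)
  have "x = (\<Sum>i<deg. to_ac (Polynomial.coeff p i) * \<beta> ^ i)"
    unfolding x evp_eq_sum using deg by (intro sum.mono_neutral_left) (auto simp: coeff_eq_0)
  then show "\<exists>c. x = (\<Sum>i<deg. to_ac (c i) * \<beta> ^ i)"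
    by (rule exI[where x = "Polynomial.coeff p"])
qed simp

text \<open>The automorphism for \<omega> multiplies the coefficient of \<beta>^j by \<omega>^j. For
  0 < j < deg there are too few j-th roots of unity to contain all \<open>deg\<close>-th ones, so
  some \<omega> forces that coefficient to vanish.\<close>

lemma fixed_field:
  assumes x: "x \<in> K" and fixed: "\<forall>\<tau>\<in>galois_group K. \<tau> x = x"
  shows "x \<in> range to_ac"
proof -
  obtain q where "x = evp q \<beta>"
    using x by (auto simp: K_def)
  define p where "p = q mod min_poly"
  have xp: "x = evp p \<beta>" and deg: "Polynomial.degree p < deg"
    using \<open>x = evp q \<beta>\<close> by (simp_all add: p_def evp_mod_min_poly \<beta>_deg degree_mod_min_poly)
  have "Polynomial.coeff p j = 0" if j: "j > 0" for j
  proof (cases "j < deg")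
    case True
    have "\<not> roots_of_unity deg \<subseteq> (roots_of_unity j :: 'f set)"
    proof
      assume "roots_of_unity deg \<subseteq> (roots_of_unity j :: 'f set)"
      then have "deg \<le> j"
        using roots_of_unity_bound[of j, where 'a = 'f] j roots_deg
        by (metis One_nat_def Suc_leI card_mono le_trans)
      then show False
        using True by simp
    qed
    then obtain \<omega> :: 'f where \<omega>: "\<omega> \<in> roots_of_unity deg" "\<omega> ^ j \<noteq> 1"
      by (auto simp: roots_of_unity_def)
    \<comment> \<open>\<open>r\<close> is p(\<omega>X) - p(X); its value at \<beta> is the change of
      \<open>x\<close> under the automorphism, and its degree is below \<open>deg\<close>.\<close>
    define r where "r = pcompose p [:0, \<omega>:] - p"
    have coeff_r: "Polynomial.coeff r i = Polynomial.coeff p i * (\<omega> ^ i - 1)" for i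
      by (simp add: r_def coeff_pcompose_linear algebra_simps)
    have "evp (pcompose p [:0, \<omega>:]) \<beta> = evp p (to_ac \<omega> * \<beta>)" for p
      by (induction p) (simp_all add: pcompose_pCons algebra_simps)
    then have "evp r \<beta> = conj_aut \<omega> x - x"
      by (simp add: r_def xp conj_aut_evp[OF \<omega>(1)])
    then have "evp r \<beta> = 0"
      using fixed conj_aut_galois[OF \<omega>(1)] by simp
    moreover have "Polynomial.degree r < deg"
      unfolding r_def using deg by (intro degree_diff_less) (auto intro: le_less_trans[OF degree_pcompose_le])
    ultimately have "r = 0"
      by (rule deg_least)
    then show ?thesis
      using coeff_r[of j] \<omega>(2) by simp
  next
    case False
    then show ?thesis
      using deg by (simp add: coeff_eq_0)
  qed
  then have "p = [:Polynomial.coeff p 0:]"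
    by (intro poly_eqI) (simp add: coeff_pCons split: nat.split)
  then have "x = to_ac (Polynomial.coeff p 0)"
    unfolding xp by (metis evp_0 evp_pCons add.right_neutral mult_zero_right)
  then show ?thesis
    by blast
qed

text \<open>Automorphisms scale \<beta> by elements of the base field, and such scalings
  commute.\<close>

lemma abelian_K: "abelian_extension K"
  unfolding abelian_extension_def
proof (intro conjI ballI finite_extension_K)
  show "{x \<in> K. \<forall>\<tau>\<in>galois_group K. \<tau> x = x} = range to_ac"
    using fixed_field intermediate_ringD(1)[OF intermediate_K] by (auto simp: galoisD)
  fix \<tau> \<tau>' x
  assume \<tau>: "\<tau> \<in> galois_group K" "\<tau>' \<in> galois_group K" and "x \<in> K"
  then obtain p where x: "x = evp p \<beta>"
    by (auto simp: K_def)
  obtain \<omega> \<omega>' where "\<tau> \<beta> = to_ac \<omega> * \<beta>" "\<tau>' \<beta> = to_ac \<omega>' * \<beta>"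
    using \<tau> galois_root by metis
  then have "\<tau> (\<tau>' \<beta>) = \<tau>' (\<tau> \<beta>)"
    by (simp add: galoisD[OF \<tau>(1)] galoisD[OF \<tau>(2)] \<beta>_in_K intermediate_ringD[OF intermediate_K])
  then show "\<tau> (\<tau>' x) = \<tau>' (\<tau> x)"
    by (simp add: x galois_evp[OF intermediate_K] \<tau> galoisD[OF \<tau>(1)] galoisD[OF \<tau>(2)] \<beta>_in_K)
qed

lemma field_norm_eqI: "(\<Prod>\<tau>\<in>galois_group K. \<tau> y) = to_ac a \<Longrightarrow> field_norm K y = a"
  unfolding field_norm_def by (rule the_equality) auto

text \<open>At \<open>X = 0\<close>, the factorization of \<open>X\<^sup>n - b\<close> into the polynomials \<open>X - \<omega>\<beta>\<close> shows that \<open>- b\<close> is a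
  product of norms, one for each coset of the \<open>deg\<close>-th roots of unity.\<close>

lemma minus_b_norm: "\<exists>y\<in>K. y \<noteq> 0 \<and> field_norm K y = - b"
proof -
  define I where "I = (\<lambda>\<omega>. \<omega> ^ deg) ` (roots_of_unity n :: 'f set)"
  have fin: "finite (roots_of_unity n :: 'f set)"
    using roots_of_unity_bound[OF n_pos] by blast
  have "\<exists>\<xi>\<in>roots_of_unity n. \<xi> ^ deg = \<eta>" if "\<eta> \<in> I" for \<eta> :: 'f
    using that by (auto simp: I_def)
  then obtain \<xi> :: "'f \<Rightarrow> 'f" where \<xi>: "\<And>\<eta>. \<eta> \<in> I \<Longrightarrow> \<xi> \<eta> \<in> roots_of_unity n"
      "\<And>\<eta>. \<eta> \<in> I \<Longrightarrow> \<xi> \<eta> ^ deg = \<eta>"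
    by metis
  have nz: "\<omega> \<noteq> 0" if "\<omega> \<in> roots_of_unity n" for \<omega> :: 'f
    using that n_pos by (auto simp: roots_of_unity_def power_0_left)
  \<comment> \<open>One factor per coset of the \<open>deg\<close>-th roots of unity in the n-th
    ones, with representative \<open>\<xi> \<eta>\<close>: the norm of a factor is the product of -
    \<omega>\<beta> over its coset.\<close>
  define y where "y = (\<Prod>\<eta>\<in>I. - to_ac (\<xi> \<eta>) * \<beta>)"
  have yi: "- to_ac (\<xi> \<eta>) * \<beta> \<in> K" for \<eta>
    using conj_in_K[of "- \<xi> \<eta>"] by simp
  have fibre: "{\<omega> \<in> roots_of_unity n. \<omega> ^ deg = \<eta>} = (\<lambda>\<omega>. \<xi> \<eta> * \<omega>) ` roots_of_unity deg"
    if \<eta>: "\<eta> \<in> I" for \<eta>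
  proof (intro equalityI subsetI)
    fix \<omega> :: 'f
    assume \<omega>: "\<omega> \<in> {\<omega> \<in> roots_of_unity n. \<omega> ^ deg = \<eta>}"
    then have "\<omega> / \<xi> \<eta> \<in> roots_of_unity deg"
      using \<xi>[OF \<eta>] nz[of "\<xi> \<eta>"] by (auto simp: roots_of_unity_def power_divide)
    moreover have "\<omega> = \<xi> \<eta> * (\<omega> / \<xi> \<eta>)"
      using \<xi>[OF \<eta>] nz by simp
    ultimately show "\<omega> \<in> (\<lambda>\<omega>. \<xi> \<eta> * \<omega>) ` roots_of_unity deg"
      by blast
  next
    fix \<omega> :: 'f
    assume "\<omega> \<in> (\<lambda>\<omega>. \<xi> \<eta> * \<omega>) ` roots_of_unity deg"
    then obtain \<omega>' where "\<omega> = \<xi> \<eta> * \<omega>'" "\<omega>' \<in> roots_of_unity deg" "\<omega>' \<in> roots_of_unity n"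
      using roots_deg_subset by blast
    then show "\<omega> \<in> {\<omega> \<in> roots_of_unity n. \<omega> ^ deg = \<eta>}"
      using \<xi>[OF \<eta>] by (simp add: roots_of_unity_def power_mult_distrib)
  qed
  have "(\<Prod>\<tau>\<in>galois_group K. \<tau> y) = (\<Prod>\<tau>\<in>galois_group K. \<Prod>\<eta>\<in>I. - to_ac (\<xi> \<eta>) * \<tau> \<beta>)"
  proof (rule prod.cong[OF refl])
    fix \<tau>
    assume \<tau>: "\<tau> \<in> galois_group K"
    have "\<tau> (to_ac (- \<xi> \<eta>) * \<beta>) = to_ac (- \<xi> \<eta>) * \<tau> \<beta>" for \<eta>
      by (simp add: galoisD[OF \<tau>] \<beta>_in_K intermediate_ringD[OF intermediate_K] del: to_ac_minus)
    then show "\<tau> y = (\<Prod>\<eta>\<in>I. - to_ac (\<xi> \<eta>) * \<tau> \<beta>)"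
      unfolding y_def by (subst galois_prod[OF intermediate_K \<tau>]) (use yi in simp_all)
  qed
  also have "\<dots> = (\<Prod>\<omega>\<in>roots_of_unity deg. \<Prod>\<eta>\<in>I. - to_ac (\<xi> \<eta>) * (to_ac \<omega> * \<beta>))"
    by (rule galois_prod_conj)
  also have "\<dots> = (\<Prod>\<eta>\<in>I. \<Prod>\<omega>\<in>roots_of_unity deg. - to_ac (\<xi> \<eta> * \<omega>) * \<beta>)"
    by (subst prod.swap) (simp add: mult.assoc)
  also have "\<dots> = (\<Prod>\<eta>\<in>I. \<Prod>\<omega>\<in>{\<omega> \<in> roots_of_unity n. \<omega> ^ deg = \<eta>}. - to_ac \<omega> * \<beta>)"
  proof (rule prod.cong[OF refl])
    fix \<eta>
    assume \<eta>: "\<eta> \<in> I"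
    have "inj_on (\<lambda>\<omega>. \<xi> \<eta> * \<omega>) (roots_of_unity deg)"
      using \<xi>[OF \<eta>] nz by (auto simp: inj_on_def)
    then show "(\<Prod>\<omega>\<in>roots_of_unity deg. - to_ac (\<xi> \<eta> * \<omega>) * \<beta>) =
        (\<Prod>\<omega>\<in>{\<omega> \<in> roots_of_unity n. \<omega> ^ deg = \<eta>}. - to_ac \<omega> * \<beta>)"
      unfolding fibre[OF \<eta>] by (simp add: prod.reindex)
  qed
  also have "\<dots> = (\<Prod>\<omega>\<in>roots_of_unity n. - to_ac \<omega> * \<beta>)"
    unfolding I_def by (rule prod.image_gen[OF fin, symmetric])
  also have "\<dots> = to_ac (\<Prod>\<omega>\<in>roots_of_unity n. - \<omega>) * \<beta> ^ n"
    by (simp only: prod.distrib prod_constant roots to_ac_prod to_ac_minus)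
  also have "\<dots> = to_ac (- b)"
    unfolding prod_minus_roots_of_unity[OF n_pos roots] root by simp
  finally have "field_norm K y = - b"
    by (rule field_norm_eqI)
  moreover have "y \<in> K"
    unfolding y_def by (intro intermediate_ring_prod[OF intermediate_K] yi)
  moreover have "y \<noteq> 0"
    unfolding y_def using \<xi> nz \<beta>_nonzero fin by (auto simp: I_def)
  ultimately show ?thesis
    by blast
qed

end


subsection \<open>Quadratic and biquadratic extensions\<close>

lemma roots_of_unity_2: "roots_of_unity 2 = {1, - 1 :: 'a::field_char_0}"
  by (auto simp: roots_of_unity_def power2_eq_1_iff)

lemma kummer_2:
  assumes "b \<noteq> 0" "r\<^sup>2 = to_ac b"
  shows "kummer 2 b r"
  using assms by unfold_locales (simp_all add: roots_of_unity_2)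

lemma quadratic_elements:
  assumes "kummer 2 b r"
  shows "kummer.K r = {to_ac x + to_ac y * r |x y. True}"
proof -
  interpret kummer 2 b r by fact
  show ?thesis
  proof (intro equalityI subsetI)
    fix z
    assume "z \<in> K"
    then obtain p where "z = evp p r"
      by (auto simp: K_def)
    moreover have "\<exists>x y. evp p r = to_ac x + to_ac y * r" for p
    proof (induction p)
      case 0
      show ?case
        by (intro exI[of _ 0]) simp
    next
      case (pCons a p)
      then obtain x y where "evp p r = to_ac x + to_ac y * r"
        by blast
      then have "evp (pCons a p) r = to_ac (a + y * b) + to_ac x * r"
        by (simp add: algebra_simps flip: root) (simp add: power2_eq_square)
      then show ?case
        by blast
    qed
    ultimately show "z \<in> {to_ac x + to_ac y * r |x y. True}"
      by blast
  qed (auto intro!: intermediate_ringD[OF intermediate_K] \<beta>_in_K)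
qed

lemma quadratic_norm:
  assumes "kummer 2 b r" and r: "r \<notin> range to_ac"
  shows "field_norm (kummer.K r) (to_ac x + to_ac y * r) = x\<^sup>2 - b * y\<^sup>2"
proof -
  interpret kummer 2 b r by fact
  have "deg \<noteq> 1"
    using \<beta>_deg r by (metis power_one_right rangeI)
  then have "deg = 2"
    using deg_dvd deg_pos by (metis One_nat_def dvd_imp_le le_antisym le_neq_implies_less less_2_cases_iff not_less_eq_eq one_le_numeral zero_less_numeral)
  have "(\<Prod>\<tau>\<in>galois_group K. \<tau> (to_ac x + to_ac y * r)) = (\<Prod>\<tau>\<in>galois_group K. to_ac x + to_ac y * \<tau> r)"
    by (rule prod.cong) (simp_all add: galoisD \<beta>_in_K intermediate_ringD[OF intermediate_K])
  also have "\<dots> = (\<Prod>\<omega>\<in>roots_of_unity 2. to_ac x + to_ac y * (to_ac \<omega> * r))"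
    using galois_prod_conj[of "\<lambda>z. to_ac x + to_ac y * z"] by (simp only: \<open>deg = 2\<close>)
  also have "\<dots> = (to_ac x + to_ac y * r) * (to_ac x - to_ac y * r)"
    by (simp add: roots_of_unity_2)
  also have "\<dots> = to_ac x ^ 2 - r\<^sup>2 * to_ac y ^ 2"
    by (simp add: power2_eq_square algebra_simps)
  also have "\<dots> = to_ac (x\<^sup>2 - b * y\<^sup>2)"
    by (simp add: root)
  finally show ?thesis
    by (rule field_norm_eqI)
qed

text \<open>An Artin map is multiplicative on each single abelian extension, so comparing its action
  on r, t and r t requires one extension containing both roots. If t is not in K, this is E = K + K
  t, with automorphisms built from one of K and a sign on t.\<close>

lemma biquadratic_abelian:
  fixes b c :: "'f::field_char_0"
  assumes b: "b \<noteq> 0" "r\<^sup>2 = to_ac b" and c: "c \<noteq> 0" "t\<^sup>2 = to_ac c"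
  obtains E where "abelian_extension E" "r \<in> E" "t \<in> E"
proof -
  interpret kummer 2 b r
    by (rule kummer_2) fact+
  note KD = intermediate_ringD[OF intermediate_K]
  show thesis
  proof (cases "t \<in> K")
    case True
    then show ?thesis
      using that abelian_K \<beta>_in_K by blast
  next
    case False
    have tt: "t * t = to_ac c"
      using c by (simp add: power2_eq_square)
    have unique: "x = x' \<and> y = y'" if "x \<in> K" "x' \<in> K" "y \<in> K" "y' \<in> K" "x + y * t = x' + y' * t" for x x' y y'
    proof -
      have "y = y'"
      proof (rule ccontr)
        assume "y \<noteq> y'"
        then have "t = (x' - x) * inverse (y - y')"
          using that(5) by (simp add: field_simps)
        then show False
          using False that by (simp add: KD intermediate_ring_inverse[OF intermediate_K])
      qed
      then show ?thesis
        using that by simp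
    qed
    define E where "E = {x + y * t |x y. x \<in> K \<and> y \<in> K}"
    have EI: "x \<in> K \<Longrightarrow> y \<in> K \<Longrightarrow> x + y * t \<in> E" for x y
      by (auto simp: E_def)
    have tE: "t \<in> E"
      using EI[of 0 1] KD by simp
    have KE: "x \<in> E" if "x \<in> K" for x
      using EI[of x 0] that KD by simp
    have E: "intermediate_ring E"
      unfolding intermediate_ring_def
    proof (intro conjI ballI)
      show "range to_ac \<subseteq> E"
        using KE KD(1) by blast
      fix z z'
      assume "z \<in> E" "z' \<in> E"
      then obtain x y x' y' where z: "x \<in> K" "y \<in> K" "z = x + y * t" "x' \<in> K" "y' \<in> K" "z' = x' + y' * t"
        by (auto simp: E_def)
      have "z - z' = (x - x') + (y - y') * t"
        by (simp add: z algebra_simps)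
      moreover have "(x - x') + (y - y') * t \<in> E"
        using z by (intro EI KD)
      ultimately show "z - z' \<in> E"
        by simp
      have "z * z' = x * x' + y * y' * (t * t) + (x * y' + x' * y) * t"
        by (simp add: z algebra_simps)
      then have "z * z' = (x * x' + y * y' * to_ac c) + (x * y' + x' * y) * t"
        by (simp add: tt)
      moreover have "(x * x' + y * y' * to_ac c) + (x * y' + x' * y) * t \<in> E"
        using z by (intro EI KD)
      ultimately show "z * z' \<in> E"
        by simp
    qed
    note ED = intermediate_ringD[OF E]
    define cx where "cx z = (SOME x. x \<in> K \<and> (\<exists>y\<in>K. z = x + y * t))" for z
    define cy where "cy z = (SOME y. y \<in> K \<and> z = cx z + y * t)" for z
    have cxy: "cx z \<in> K \<and> cy z \<in> K \<and> z = cx z + cy z * t" if "z \<in> E" for z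
    proof -
      have "\<exists>x. x \<in> K \<and> (\<exists>y\<in>K. z = x + y * t)"
        using that by (auto simp: E_def)
      then have cx: "cx z \<in> K \<and> (\<exists>y\<in>K. z = cx z + y * t)"
        unfolding cx_def by (rule someI_ex)
      then have "\<exists>y. y \<in> K \<and> z = cx z + y * t"
        by blast
      then have "cy z \<in> K \<and> z = cx z + cy z * t"
        unfolding cy_def by (rule someI_ex)
      then show ?thesis
        using cx by blast
    qed
    have cx_eq: "cx (x + y * t) = x" and cy_eq: "cy (x + y * t) = y" if "x \<in> K" "y \<in> K" for x y
      using unique[of x "cx (x + y * t)" y "cy (x + y * t)"] cxy[OF EI[OF that]] that by simp_all
    \<comment> \<open>The extension of \<tau> to \<open>E\<close> that sends t to \<delta> t, with
      \<delta> = \<plusminus>1 in the uses below.\<close>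
    define lift where "lift \<tau> \<delta> = restrict (\<lambda>z. \<tau> (cx z) + to_ac \<delta> * \<tau> (cy z) * t) E" for \<tau> and \<delta> :: 'f
    have lift_eq: "lift \<tau> \<delta> (x + y * t) = \<tau> x + to_ac \<delta> * \<tau> y * t" if "x \<in> K" "y \<in> K" for \<tau> \<delta> x y
      using that by (simp add: lift_def EI cx_eq cy_eq)
    have lift_galois: "lift \<tau> \<delta> \<in> galois_group E" if \<tau>: "\<tau> \<in> galois_group K" and \<delta>: "\<delta> * \<delta> = 1" for \<tau> \<delta>
    proof -
      note \<tau>D = galoisD[OF \<tau>]
      have bij: "bij_betw \<tau> K K"
        using \<tau> by (simp add: galois_group_def)
      have \<delta>': "to_ac \<delta> * to_ac \<delta> = (1 :: 'f alg_closure)"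
        using \<delta> by (simp flip: to_ac_mult)
      have into: "lift \<tau> \<delta> z \<in> E" if "z \<in> E" for z
      proof -
        obtain x y where "x \<in> K" "y \<in> K" "z = x + y * t"
          using \<open>z \<in> E\<close> by (auto simp: E_def)
        then show ?thesis
          by (simp add: lift_eq EI \<tau>D KD)
      qed
      have "inj_on (lift \<tau> \<delta>) E"
      proof (rule inj_onI)
        fix z z'
        assume zz: "z \<in> E" "z' \<in> E" "lift \<tau> \<delta> z = lift \<tau> \<delta> z'"
        then obtain x y x' y' where z: "x \<in> K" "y \<in> K" "z = x + y * t" "x' \<in> K" "y' \<in> K" "z' = x' + y' * t"
          by (auto simp: E_def)
        have "\<tau> x + to_ac \<delta> * \<tau> y * t = \<tau> x' + to_ac \<delta> * \<tau> y' * t"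
          using zz(3) unfolding z(3,6) lift_eq[OF z(1,2)] lift_eq[OF z(4,5)] .
        then have "\<tau> x = \<tau> x' \<and> to_ac \<delta> * \<tau> y = to_ac \<delta> * \<tau> y'"
          using z by (intro unique \<tau>D(1) KD(1,7))
        moreover have "\<delta> \<noteq> 0"
          using \<delta> by auto
        ultimately have "\<tau> x = \<tau> x'" "\<tau> y = \<tau> y'"
          by simp_all
        then have "x = x'" "y = y'"
          using bij z(1,2,4,5) unfolding bij_betw_def by (metis inj_onD)+
        then show "z = z'"
          by (simp only: z(3,6))
      qed
      moreover have "lift \<tau> \<delta> ` E = E"
      proof
        show "lift \<tau> \<delta> ` E \<subseteq> E"
          using into by blast
        show "E \<subseteq> lift \<tau> \<delta> ` E"
        proof
          fix z
          assume "z \<in> E"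
          then obtain x y where z: "x \<in> K" "y \<in> K" "z = x + y * t"
            by (auto simp: E_def)
          obtain x' y' where "x' \<in> K" "\<tau> x' = x" "y' \<in> K" "\<tau> y' = y"
            using z bij unfolding bij_betw_def by (metis imageE)
          then have "lift \<tau> \<delta> (x' + (to_ac \<delta> * y') * t) = x + to_ac \<delta> * (to_ac \<delta> * y) * t"
            by (subst lift_eq) (simp_all add: KD \<tau>D)
          also have "\<dots> = z"
            using \<delta>' z by (simp add: mult.assoc[symmetric])
          finally show "z \<in> lift \<tau> \<delta> ` E"
            using EI[of x' "to_ac \<delta> * y'"] \<open>x' \<in> K\<close> \<open>y' \<in> K\<close> KD by (metis imageI)
        qed
      qed
      ultimately have "bij_betw (lift \<tau> \<delta>) E E"
        by (simp add: bij_betw_def)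
      moreover have "lift \<tau> \<delta> (z + z') = lift \<tau> \<delta> z + lift \<tau> \<delta> z' \<and> lift \<tau> \<delta> (z * z') = lift \<tau> \<delta> z * lift \<tau> \<delta> z'"
        if "z \<in> E" "z' \<in> E" for z z'
      proof -
        obtain x y x' y' where z: "x \<in> K" "y \<in> K" "z = x + y * t" "x' \<in> K" "y' \<in> K" "z' = x' + y' * t"
          using \<open>z \<in> E\<close> \<open>z' \<in> E\<close> by (auto simp: E_def)
        have "lift \<tau> \<delta> ((x + x') + (y + y') * t) = \<tau> (x + x') + to_ac \<delta> * \<tau> (y + y') * t"
          by (intro lift_eq KD z)
        also have "\<dots> = lift \<tau> \<delta> z + lift \<tau> \<delta> z'"
          unfolding z(3,6) lift_eq[OF z(1,2)] lift_eq[OF z(4,5)]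
          using z by (simp add: \<tau>D distrib_left distrib_right)
        finally have "lift \<tau> \<delta> ((x + x') + (y + y') * t) = lift \<tau> \<delta> z + lift \<tau> \<delta> z'" .
        have "z + z' = (x + x') + (y + y') * t"
          by (simp add: z algebra_simps)
        have "z * z' = x * x' + y * y' * (t * t) + (x * y' + x' * y) * t"
          by (simp add: z algebra_simps)
        then have "z * z' = (x * x' + y * y' * to_ac c) + (x * y' + x' * y) * t"
          by (simp add: tt)
        then have "lift \<tau> \<delta> (z * z') = \<tau> (x * x' + y * y' * to_ac c) + to_ac \<delta> * \<tau> (x * y' + x' * y) * t"
          by (simp only:) (intro lift_eq KD z)
        also have "\<dots> = (\<tau> x * \<tau> x' + \<tau> y * \<tau> y' * to_ac c) + to_ac \<delta> * (\<tau> x * \<tau> y' + \<tau> x' * \<tau> y) * t"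
          using z by (simp add: KD \<tau>D)
        also have "\<dots> = \<tau> x * \<tau> x' + (to_ac \<delta> * to_ac \<delta>) * (\<tau> y * \<tau> y' * (t * t))
            + to_ac \<delta> * (\<tau> x * \<tau> y' + \<tau> x' * \<tau> y) * t"
          by (simp add: tt \<delta>')
        also have "\<dots> = lift \<tau> \<delta> z * lift \<tau> \<delta> z'"
          unfolding z(3,6) lift_eq[OF z(1,2)] lift_eq[OF z(4,5)] by (simp only: algebra_simps)
        finally show ?thesis
          using \<open>z + z' = (x + x') + (y + y') * t\<close>
            \<open>lift \<tau> \<delta> ((x + x') + (y + y') * t) = lift \<tau> \<delta> z + lift \<tau> \<delta> z'\<close> by (simp only:)
      qed
      moreover have "lift \<tau> \<delta> (to_ac a) = to_ac a" for a
        using lift_eq[of "to_ac a" 0 \<tau> \<delta>] by (simp add: KD \<tau>D)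
      moreover have "lift \<tau> \<delta> \<in> extensional E"
        by (simp add: lift_def)
      ultimately show ?thesis
        by (simp add: galois_group_def)
    qed
    have id: "restrict (\<lambda>x. x) K \<in> galois_group K"
      by (auto simp: galois_group_def bij_betw_def inj_on_def KD)
    have sq: "\<tau> u = u \<or> \<tau> u = - u" if "\<tau> \<in> galois_group E" "u \<in> E" "u\<^sup>2 = to_ac a" for \<tau> u a
    proof -
      have "(\<tau> u)\<^sup>2 = u\<^sup>2"
        using galois_power[OF E that(1,2), of 2] galoisD(4)[OF that(1)] that(3) by simp
      then show ?thesis
        by (simp add: power2_eq_iff)
    qed
    have neg: "\<tau> (- u) = - \<tau> u" if "\<tau> \<in> galois_group E" "u \<in> E" for \<tau> u
    proof -
      have "\<tau> (to_ac (- 1) * u) = to_ac (- 1) * \<tau> u"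
        using that ED(1)[of "- 1"] by (simp add: galoisD(3)[OF that(1)] galoisD(4)[OF that(1)] del: to_ac_minus)
      then show ?thesis
        by simp
    qed
    have "finite_extension E"
    proof -
      obtain B where B: "finite B" "\<forall>x\<in>K. \<exists>d. x = (\<Sum>b\<in>B. to_ac (d b) * b)"
        using finite_extension_K unfolding finite_extension_def by blast
      show ?thesis
      proof (rule finite_extensionI[OF E, where I = "B \<times> UNIV" and g = "\<lambda>(b, k). if k then b * t else b"])
        show "finite (B \<times> (UNIV :: bool set))"
          using B by simp
        fix z
        assume "z \<in> E"
        then obtain x y where z: "x \<in> K" "y \<in> K" "z = x + y * t"
          by (auto simp: E_def)
        have "\<exists>d. x = (\<Sum>b\<in>B. to_ac (d b) * b)" "\<exists>d. y = (\<Sum>b\<in>B. to_ac (d b) * b)"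
          by (rule bspec[OF B(2) z(1)], rule bspec[OF B(2) z(2)])
        then obtain d d' where d: "x = (\<Sum>b\<in>B. to_ac (d b) * b)" "y = (\<Sum>b\<in>B. to_ac (d' b) * b)"
          by (elim exE)
        have "z = (\<Sum>i\<in>B \<times> UNIV. to_ac (if snd i then d' (fst i) else d (fst i)) *
            (case i of (b, k) \<Rightarrow> if k then b * t else b))"
          unfolding z(3) d
          by (simp add: sum.cartesian_product' UNIV_bool sum_distrib_right sum.distrib mult.assoc add.commute)
        then show "\<exists>c. z = (\<Sum>i\<in>B \<times> UNIV. to_ac (c i) * (case i of (b, k) \<Rightarrow> if k then b * t else b))"
          by (rule exI[where x = "\<lambda>i. if snd i then d' (fst i) else d (fst i)"])
      qed
    qed
    moreover have "z \<in> range to_ac" if z: "z \<in> E" "\<forall>\<tau>\<in>galois_group E. \<tau> z = z" for z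
    proof -
      obtain x y where xy: "x \<in> K" "y \<in> K" "z = x + y * t"
        using z by (auto simp: E_def)
      \<comment> \<open>The lift of the identity that negates t kills the t-coordinate of a fixed
        element; the lifts with \<delta> = 1 then put the other coordinate into the fixed field of
        K.\<close>
      have "lift (restrict (\<lambda>x. x) K) (- 1) z = z"
        using z lift_galois[OF id, of "- 1"] by simp
      then have "y = - y"
        using unique[of x x "- y" y] xy by (simp add: lift_eq KD)
      then have "y = 0"
        by (simp add: eq_neg_iff_add_eq_0)
      have "\<tau> x = x" if \<tau>: "\<tau> \<in> galois_group K" for \<tau>
      proof -
        have "lift \<tau> 1 z = z"
          using z lift_galois[OF \<tau>, of 1] by simp
        then show ?thesis
          using xy \<open>y = 0\<close> lift_eq[of x 0 \<tau> 1] \<tau> by (simp add: KD galoisD[OF \<tau>])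
      qed
      then show ?thesis
        using fixed_field xy \<open>y = 0\<close> by simp
    qed
    moreover have "\<tau> (\<tau>' z) = \<tau>' (\<tau> z)" if \<tau>: "\<tau> \<in> galois_group E" "\<tau>' \<in> galois_group E" and "z \<in> E" for \<tau> \<tau>' z
    proof -
      have rE: "r \<in> E"
        using KE \<beta>_in_K by blast
      obtain p q where z: "z = evp p r + evp q r * t"
        using \<open>z \<in> E\<close> by (auto simp: E_def K_def)
      have step: "\<rho> (evp p u + evp q u * v) = evp p (\<rho> u) + evp q (\<rho> u) * \<rho> v"
        if "\<rho> \<in> galois_group E" "u \<in> E" "v \<in> E" for \<rho> u v
        using that by (simp add: galoisD[OF that(1)] galois_evp[OF E] ED intermediate_ring_evp[OF E])
      \<comment> \<open>Each automorphism changes r and t at most by a sign, and \<open>E\<close> is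
        generated by the two.\<close>
      have "\<tau> (\<tau>' r) = \<tau>' (\<tau> r)" "\<tau> (\<tau>' t) = \<tau>' (\<tau> t)"
        using sq[OF \<tau>(1) rE b(2)] sq[OF \<tau>(2) rE b(2)] sq[OF \<tau>(1) tE c(2)] sq[OF \<tau>(2) tE c(2)]
        by (auto simp: neg \<tau> rE tE)
      then show ?thesis
        unfolding z by (simp add: step \<tau> rE tE galoisD(1)[OF \<tau>(1)] galoisD(1)[OF \<tau>(2)])
    qed
    ultimately have "abelian_extension E"
      unfolding abelian_extension_def using ED(1) by (auto simp: galoisD)
    then show ?thesis
      using that KE \<beta>_in_K tE by blast
  qed
qed


section \<open>Uniqueness of quadratic symbols\<close>

context padic_field
begin

text \<open>A bimultiplicative symbol with values \<open>\<plusminus>1\<close> that kills norms from quadratic extensions and is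
  trivial against unramified quadratic extensions. On units it vanishes by descending induction
  along the filtration by the subgroups \<open>1 + \<pi>\<^sup>i\<O>\<close>.\<close>

context
  fixes D :: "'f \<Rightarrow> 'f \<Rightarrow> int"
  assumes D_sign: "a \<noteq> 0 \<Longrightarrow> b \<noteq> 0 \<Longrightarrow> D a b = 1 \<or> D a b = - 1"
    and D_mult_left: "a \<noteq> 0 \<Longrightarrow> a' \<noteq> 0 \<Longrightarrow> b \<noteq> 0 \<Longrightarrow> D (a * a') b = D a b * D a' b"
    and D_mult_right: "a \<noteq> 0 \<Longrightarrow> b \<noteq> 0 \<Longrightarrow> b' \<noteq> 0 \<Longrightarrow> D a (b * b') = D a b * D a b'"
    and D_norm: "a \<noteq> 0 \<Longrightarrow> b \<noteq> 0 \<Longrightarrow> a = x\<^sup>2 - b * y\<^sup>2 \<Longrightarrow> D a b = 1"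
    and D_unramified: "a \<noteq> 0 \<Longrightarrow> absv c \<le> 1 \<Longrightarrow> absv (1 + 4 * c) = 1 \<Longrightarrow> D a (1 + 4 * c) = 1"
begin

lemma D_square: "a \<noteq> 0 \<Longrightarrow> b \<noteq> 0 \<Longrightarrow> D a b * D a b = 1"
  using D_sign[of a b] by auto

lemma D_one_left: "b \<noteq> 0 \<Longrightarrow> D 1 b = 1"
  using D_mult_left[of 1 1 b] D_square[of 1 b] by simp

lemma D_power_left: "a \<noteq> 0 \<Longrightarrow> b \<noteq> 0 \<Longrightarrow> D (a ^ k) b = D a b ^ k"
  by (induction k) (simp_all add: D_one_left D_mult_left)

lemma D_minus: "a \<noteq> 0 \<Longrightarrow> D a (- a) = 1"
  by (rule D_norm[of _ _ 0 1]) simp_all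

text \<open>Expanding D (ab) (-ab) = 1 bimultiplicatively and cancelling D a (-a) and D b (-b)
  leaves D a b * D b a = 1.\<close>

lemma D_commute:
  assumes "a \<noteq> 0" "b \<noteq> 0"
  shows "D a b = D b a"
proof -
  have "D a (- (a * b)) = D a b" "D b (- (a * b)) = D b a"
    using D_mult_right[of a "- a" b] D_mult_right[of b a "- b"] assms by (simp_all add: D_minus)
  moreover have "D (a * b) (- (a * b)) = 1"
    using assms by (intro D_minus) simp
  moreover have "D (a * b) (- (a * b)) = D a (- (a * b)) * D b (- (a * b))"
    using assms by (intro D_mult_left) simp_all
  ultimately have "1 = D a b * D b a"
    by simp
  then show ?thesis
    using D_sign[of a b] D_sign[of b a] assms by auto
qed

lemma D_power_right: "a \<noteq> 0 \<Longrightarrow> b \<noteq> 0 \<Longrightarrow> D a (b ^ k) = D a b ^ k"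
  using D_power_left[of b a k] by (simp add: D_commute)

text \<open>The element a is the norm of 1 plus a square root of 1 - a.\<close>

lemma D_steinberg: "a \<noteq> 0 \<Longrightarrow> a \<noteq> 1 \<Longrightarrow> D a (1 - a) = 1"
  by (rule D_norm[of _ _ 1 1]) simp_all

lemma D_times_square: "s \<noteq> 0 \<Longrightarrow> a \<noteq> 0 \<Longrightarrow> b \<noteq> 0 \<Longrightarrow> D (s\<^sup>2 * a) b = D a b"
  by (simp add: D_mult_left D_power_left power2_eq_square D_square)

text \<open>With v = (1 - xy)^-1 the elements (1 - x) v and x (1 - y) v add up to 1. In the
  resulting Steinberg relation all factors but D (1 - x) (1 - y) are either Steinberg themselves or
  involve v. The point is that 1 - xy is closer to 1 than 1 - x and 1 - y when x and y are
  small.\<close>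

lemma D_steinberg_units:
  assumes x: "x \<noteq> 0" "1 - x \<noteq> 0" and y: "1 - y \<noteq> 0" and w: "1 - x * y \<noteq> 0" "D (1 - x * y) x = 1"
    "D (1 - x * y) (1 - x) = 1" "D (1 - x * y) (1 - y) = 1" "D (1 - x * y) (1 - x * y) = 1"
  shows "D (1 - x) (1 - y) = 1"
proof -
  define v where "v = inverse (1 - x * y)"
  have v: "v \<noteq> 0" "v * (1 - x * y) = 1"
    using w(1) by (simp_all add: v_def)
  have Dv: "D v z = D (1 - x * y) z" if "z \<noteq> 0" for z
    using D_mult_left[of v "1 - x * y" z] D_square[of "1 - x * y" z] D_one_left[OF that] that v w(1)
      D_sign[of v z] D_sign[of "1 - x * y" z] by auto
  have sum: "1 - (1 - x) * v = x * (1 - y) * v"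
    using v(2) by (simp add: algebra_simps)
  have "1 = D ((1 - x) * v) (1 - (1 - x) * v)"
  proof -
    have "(1 - x) * v \<noteq> 1"
      using sum x y v by (metis diff_self mult_eq_0_iff)
    then show ?thesis
      using D_steinberg[of "(1 - x) * v"] x v by simp
  qed
  also have "\<dots> = D ((1 - x) * v) (x * (1 - y) * v)"
    by (simp only: sum)
  also have "\<dots> = D (1 - x) x * D (1 - x) (1 - y) * D (1 - x) v * (D v x * D v (1 - y) * D v v)"
    using x y v by (simp add: D_mult_left D_mult_right)
  also have "D (1 - x) x = 1"
    using D_steinberg[of x] x by (simp add: D_commute)
  also have "D (1 - x) v = 1"
    using Dv[of "1 - x"] w x v by (simp add: D_commute)
  also have "D v v = 1"
    using Dv[of v] Dv[of "1 - x * y"] D_commute[of v "1 - x * y"] w v by simp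
  finally show ?thesis
    using Dv x y w by simp
qed

text \<open>At level i, write u = 1 - x. If i is even, u is a square times an element of the next
  level. If i is odd, D u is trivial on units, and the Steinberg relation D u x = 1 with x of odd
  valuation settles the uniformizer.\<close>

lemma D_principal_units:
  assumes \<pi>: "uniformizer absv \<pi>" and two: "absv 2 < 1" and i: "i \<ge> 1"
    and u: "absv (u - 1) \<le> absv \<pi> ^ i" and a: "a \<noteq> 0"
  shows "D u a = 1"
proof -
  note p = uniformizer_props[OF \<pi>]
  have unit: "absv v = 1" if "absv (v - 1) \<le> absv \<pi> ^ j" "j \<ge> 1" for v j
  proof -
    have "absv \<pi> ^ j \<le> absv \<pi> ^ 1"
      using p(2,3) that by (intro power_decreasing) auto
    then have "absv (v - 1) < 1"
      using that p(3) by simp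
    then show ?thesis
      using absv_add_eq[of "v - 1" 1] by simp
  qed
  \<comment> \<open>Levels this deep consist of elements 1 + 4c with c integral, where the
    unramified hypothesis applies after exchanging the arguments.\<close>
  have base: "D u a = 1" if i: "i \<ge> 1" "absv \<pi> ^ i \<le> absv 4" and u: "absv (u - 1) \<le> absv \<pi> ^ i" and a: "a \<noteq> 0"
    for i u a
  proof -
    define c where "c = (u - 1) / 4"
    have uc: "u = 1 + 4 * c"
      by (simp add: c_def field_simps)
    have "absv c \<le> 1"
      using i(2) u absv_pos[of 4] by (simp add: c_def absv_divide)
    then have "D a u = 1"
      unfolding uc using D_unramified a unit[OF u i(1)] uc by metis
    moreover have "u \<noteq> 0"
      using unit[OF u i(1)] by auto
    ultimately show ?thesis
      using D_commute[of u a] a by simp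
  qed
  have step: "D u a = 1"
    if IH: "\<And>u a. absv (u - 1) \<le> absv \<pi> ^ Suc i \<Longrightarrow> a \<noteq> 0 \<Longrightarrow> D u a = 1"
      and i: "i \<ge> 1" "\<not> absv \<pi> ^ i \<le> absv 4" and u: "absv (u - 1) \<le> absv \<pi> ^ i" and a: "a \<noteq> 0"
    for i u a
  proof (cases "absv (u - 1) \<le> absv \<pi> ^ Suc i")
    case True
    then show ?thesis
      using IH a by blast
  next
    case False
    have u1: "absv u = 1" "u \<noteq> 0"
      using unit[OF u i(1)] by auto
    define x where "x = 1 - u"
    have ux: "u = 1 - x" "1 - x \<noteq> 0"
      using u1 by (simp_all add: x_def)
    have x: "absv x \<le> absv \<pi> ^ i" "\<not> absv x \<le> absv \<pi> ^ Suc i" "x \<noteq> 0"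
      using u False p by (auto simp: x_def absv_diff_commute[of 1 u])
    define c where "c = x / \<pi> ^ i"
    have xc: "x = c * \<pi> ^ i"
      using p by (simp add: c_def)
    have absc: "absv c = 1"
    proof -
      have "absv c = absv x / absv \<pi> ^ i"
        by (simp add: c_def absv_divide absv_power)
      then have "absv c \<le> 1" "\<not> absv c \<le> absv \<pi>"
        using x p(2) by (simp_all add: divide_le_eq)
      then show ?thesis
        using p(4)[of c] by linarith
    qed
    have sqrt_mod: "\<exists>s v. absv s = 1 \<and> absv (v - 1) \<le> absv \<pi> ^ 1 \<and> w = s\<^sup>2 * v" if w: "absv w = 1" for w
      using unit_square_mod[OF two w] p(4) by (metis power_one_right)
    show ?thesis
    proof (cases "even i")
      case True
      then obtain j where j: "i = 2 * j"
        by blast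
      obtain s v where sv: "absv s = 1" "absv (v - 1) \<le> absv \<pi> ^ 1" "c = s\<^sup>2 * v"
        using sqrt_mod[OF absc] by blast
      define t where "t = s * \<pi> ^ j"
      \<comment> \<open>As i = 2j, failure of the base case means |2| < |\<pi>|^j, hence |2| \<le>
        |\<pi>|^(j+1). The cross term 2t of (1 + t)^2 therefore lies in the next level.\<close>
      have "absv 4 < absv \<pi> ^ i"
        using i(2) by simp
      moreover have "absv 4 = absv 2 ^ 2"
        by (simp flip: absv_power)
      ultimately have "absv 2 ^ 2 < (absv \<pi> ^ j) ^ 2"
        by (simp add: j power_mult[symmetric] mult.commute)
      then have "absv 2 < absv \<pi> ^ j"
        by (rule power2_less_imp_less) (use p in simp)
      then have "absv (2 / \<pi> ^ j) < 1"
        using p(2) by (simp add: absv_divide absv_power)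
      then have "absv (2 / \<pi> ^ j) \<le> absv \<pi>"
        using p(4) by blast
      then have two': "absv 2 \<le> absv \<pi> * absv \<pi> ^ j"
        using p(2) by (simp add: absv_divide absv_power divide_le_eq)
      have abst: "absv t = absv \<pi> ^ j"
        by (simp add: t_def absv_mult sv absv_power)
      have t2: "absv (t\<^sup>2) = absv \<pi> ^ i"
        by (simp add: absv_power abst j power_mult[symmetric] mult.commute)
      have 1: "absv (2 * t) \<le> absv \<pi> ^ Suc i"
      proof -
        have "absv (2 * t) \<le> absv \<pi> * absv \<pi> ^ j * absv \<pi> ^ j"
          using two' p(2) by (simp add: absv_mult abst mult_right_mono)
        also have "\<dots> = absv \<pi> ^ Suc i"
          by (simp add: j mult_2 power_add)
        finally show ?thesis .
      qed
      have 2: "absv (2 * t\<^sup>2) \<le> absv \<pi> ^ Suc i"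
      proof -
        have "absv 2 \<le> absv \<pi>"
          using two p(4) by blast
        then show ?thesis
          using p(2) by (simp add: absv_mult t2 mult_right_mono)
      qed
      have 3: "absv (t\<^sup>2 * (v - 1)) \<le> absv \<pi> ^ Suc i"
        using sv(2) p(2) by (simp add: absv_mult t2 mult_right_mono mult.commute)
      have xt: "x = t\<^sup>2 * v"
        by (simp add: xc sv(3) t_def j power_mult_distrib power_mult[symmetric] mult.commute mult.left_commute)
      have jpos: "j \<ge> 1"
        using i(1) j by simp
      have "absv ((1 + t) - 1) \<le> absv \<pi> ^ j"
        by (simp add: abst)
      then have t1: "absv (1 + t) = 1"
        using unit jpos by blast
      then have t0: "1 + t \<noteq> 0"
        by auto
      define w where "w = u / (1 + t)\<^sup>2"
      \<comment> \<open>Here u = 1 - t^2 v whereas the square contains + t^2; the mismatch of signs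
        costs 2 t^2, which is small because |2| < 1.\<close>
      have "u - (1 + t)\<^sup>2 = - (2 * t + (2 * t\<^sup>2 + t\<^sup>2 * (v - 1)))"
        by (simp add: ux xt power2_eq_square algebra_simps)
      moreover have "w - 1 = (u - (1 + t)\<^sup>2) / (1 + t)\<^sup>2"
        using t0 by (simp add: w_def diff_divide_distrib)
      ultimately have "absv (w - 1) = absv (2 * t + (2 * t\<^sup>2 + t\<^sup>2 * (v - 1)))"
        by (simp add: absv_divide absv_power t1 del: minus_add_distrib)
      also have "\<dots> \<le> absv \<pi> ^ Suc i"
        using 1 2 3 absv_ultrametric[of "2 * t" "2 * t\<^sup>2 + t\<^sup>2 * (v - 1)"]
          absv_ultrametric[of "2 * t\<^sup>2" "t\<^sup>2 * (v - 1)"] by linarith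
      finally have "D w a = 1"
        using IH a by blast
      moreover have "w \<noteq> 0"
        using u1 t0 by (simp add: w_def)
      moreover have "u = (1 + t)\<^sup>2 * w"
        using t0 by (simp add: w_def)
      ultimately show ?thesis
        using D_times_square[of "1 + t" w a] t0 a by simp
    next
      case False
      \<comment> \<open>For \<open>x\<close> of level i and \<open>y = 1 - v\<close> of level 1, the
        element 1 - xy has level i + 1, so the induction hypothesis supplies the four premises about
        it.\<close>
      have princ: "D u v = 1" if v: "absv (v - 1) \<le> absv \<pi> ^ 1" for v
      proof -
        define y where "y = 1 - v"
        have v0: "v \<noteq> 0"
          using unit[OF v] by auto
        have "absv (1 - x * y - 1) = absv x * absv (v - 1)"
          by (simp add: y_def absv_mult absv_diff_commute)
        also have "\<dots> \<le> absv \<pi> ^ i * absv \<pi> ^ 1"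
          using x(1) v p(2) by (intro mult_mono) (auto simp: absv_nonneg)
        finally have w: "absv (1 - x * y - 1) \<le> absv \<pi> ^ Suc i"
          by (simp add: mult.commute)
        then have "1 - x * y \<noteq> 0"
          using unit[OF w] by auto
        moreover have "1 - y \<noteq> 0"
          using v0 by (simp add: y_def)
        ultimately have "D (1 - x) (1 - y) = 1"
          using D_steinberg_units[OF x(3) ux(2) _ _ IH[OF w] IH[OF w] IH[OF w] IH[OF w]] x(3) ux(2)
          by blast
        moreover have "1 - y = v"
          by (simp add: y_def)
        ultimately show ?thesis
          by (simp only: ux(1)[symmetric])
      qed
      have units: "D u w = 1" if w: "absv w = 1" for w
      proof -
        obtain s v where sv: "absv s = 1" "absv (v - 1) \<le> absv \<pi> ^ 1" "w = s\<^sup>2 * v"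
          using sqrt_mod[OF w] by blast
        moreover have "v \<noteq> 0" "s \<noteq> 0"
          using unit[OF sv(2)] sv(1) by auto
        ultimately show ?thesis
          using princ[OF sv(2)] D_times_square[of s v u] u1 by (simp add: D_commute)
      qed
      have "c \<noteq> 0"
        using absc by auto
      \<comment> \<open>As x = c \<pi>^i with c a unit, this gives D u \<pi> ^ i = 1, and an odd i
        determines the sign.\<close>
      have "1 = D u x"
        using D_steinberg[of x] x(3) ux by (simp add: D_commute)
      also have "\<dots> = D u c * D u \<pi> ^ i"
        using u1 p \<open>c \<noteq> 0\<close> by (simp add: xc D_mult_right D_power_right)
      finally have "D u \<pi> ^ i = 1"
        using units[OF absc] by simp
      moreover have "D u \<pi> = 1 \<or> D u \<pi> = - 1"
        using D_sign u1 p by blast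
      ultimately have u\<pi>: "D u \<pi> = 1"
        using False by auto
      obtain k l :: nat and w where w: "absv w = 1" "a * \<pi> ^ l = \<pi> ^ k * w"
        using decomposition[OF \<pi> a] by metis
      have "w \<noteq> 0"
        using w(1) by auto
      have "D u (a * \<pi> ^ l) = D u (\<pi> ^ k * w)"
        by (simp add: w)
      then show ?thesis
        using u1 p a \<open>w \<noteq> 0\<close> units[OF w(1)] by (simp add: D_mult_right D_power_right u\<pi>)
    qed
  qed
  have "0 < absv 4"
    by (simp add: absv_pos)
  then obtain m where m: "absv \<pi> ^ m < absv 4"
    using real_arch_pow_inv[of "absv 4" "absv \<pi>"] p(3) by blast
  have large: "absv \<pi> ^ j \<le> absv 4" if "j \<ge> m" for j
    using m p(2,3) power_decreasing[OF that, of "absv \<pi>"] by linarith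
  \<comment> \<open>The descent is counted by k, starting from level m + i where the base case
    holds; k = m reaches level i.\<close>
  have "\<forall>u a. absv (u - 1) \<le> absv \<pi> ^ (m + i - k) \<longrightarrow> a \<noteq> 0 \<longrightarrow> D u a = 1" if "k < m + i" for k
    using that
  proof (induction k)
    case 0
    then show ?case
      using base[of "m + i"] large i by simp
  next
    case (Suc k)
    then have IH: "\<forall>u a. absv (u - 1) \<le> absv \<pi> ^ Suc (m + i - Suc k) \<longrightarrow> a \<noteq> 0 \<longrightarrow> D u a = 1"
      by (simp add: Suc_diff_Suc)
    have "m + i - Suc k \<ge> 1"
      using Suc.prems by simp
    then show ?case
      using base[of "m + i - Suc k"] step[of "m + i - Suc k"] IH by blast
  qed
  from this[of m] show ?thesis
    using i u a by simp
qed

text \<open>In residue characteristic 2 a unit is a square times a principal unit. Otherwise 4 is a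
  unit, and u itself has the form 1 + 4c with c integral.\<close>

lemma D_units_trivial:
  assumes u: "absv u = 1" and a: "a \<noteq> 0"
  shows "D u a = 1"
proof -
  have u0: "u \<noteq> 0"
    using u by auto
  show ?thesis
  proof (cases "absv 2 < 1")
    case True
    obtain \<pi> where \<pi>: "uniformizer absv \<pi>"
      using uniformizer_exists by blast
    obtain s v where sv: "absv s = 1" "absv (v - 1) < 1" "u = s\<^sup>2 * v"
      by (rule unit_square_mod[OF True u])
    then have "absv (v - 1) \<le> absv \<pi> ^ 1"
      using uniformizer_props(4)[OF \<pi>] by simp
    then have "D v a = 1"
      using D_principal_units[OF \<pi> True, of 1] a by simp
    then show ?thesis
      using D_times_square[of s v a] u0 sv(3) a by auto
  next
    case False
    then have "absv 2 = 1"
      using absv_numeral_le[of "num.Bit0 num.One"] by simp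
    then have "absv 4 = 1"
      using absv_power[of 2 2] by simp
    define c where "c = (u - 1) / 4"
    have uc: "u = 1 + 4 * c"
      by (simp add: c_def field_simps)
    have "absv c \<le> 1"
      using absv_diff_le[of u 1] u \<open>absv 4 = 1\<close> by (simp add: c_def absv_divide)
    then have "D a u = 1"
      using D_unramified[OF a, of c] u uc by simp
    then show ?thesis
      using D_commute a u0 by simp
  qed
qed

end

end


section \<open>Artin maps and the Hilbert symbol\<close>

lemma artin_galois:
  assumes "artin_map absv \<theta>" "abelian_extension E" "a \<noteq> 0"
  shows "restrict (\<theta> a) E \<in> galois_group E"
  using assms(3) conjunct1[OF mp[OF spec[OF assms(1)[unfolded artin_map_def]] assms(2)]] by blast

lemma artin_hom:
  assumes \<theta>: "artin_map absv \<theta>" and E: "abelian_extension E" and a: "a \<noteq> 0"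
  shows "x \<in> E \<Longrightarrow> \<theta> a x \<in> E" "x \<in> E \<Longrightarrow> y \<in> E \<Longrightarrow> \<theta> a (x + y) = \<theta> a x + \<theta> a y"
    "x \<in> E \<Longrightarrow> y \<in> E \<Longrightarrow> \<theta> a (x * y) = \<theta> a x * \<theta> a y" "\<theta> a (to_ac c) = to_ac c"
    "b \<noteq> 0 \<Longrightarrow> x \<in> E \<Longrightarrow> \<theta> (a * b) x = \<theta> a (\<theta> b x)"
    "y \<in> E \<Longrightarrow> y \<noteq> 0 \<Longrightarrow> x \<in> E \<Longrightarrow> \<theta> (field_norm E y) x = x"
    "x \<in> E \<Longrightarrow> \<theta> a (x ^ k) = \<theta> a x ^ k"
proof -
  note g = galoisD[OF artin_galois[OF assms]]
  have I: "intermediate_ring E"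
    using E by (simp add: abelian_extension_def finite_extension_intermediate)
  note ID = intermediate_ringD[OF I]
  show "x \<in> E \<Longrightarrow> \<theta> a x \<in> E" "x \<in> E \<Longrightarrow> y \<in> E \<Longrightarrow> \<theta> a (x + y) = \<theta> a x + \<theta> a y"
    "x \<in> E \<Longrightarrow> y \<in> E \<Longrightarrow> \<theta> a (x * y) = \<theta> a x * \<theta> a y" "\<theta> a (to_ac c) = to_ac c"
    using g(1)[of x] g(2)[of x y] g(3)[of x y] g(4)[of c] by (simp_all add: ID)
  show "x \<in> E \<Longrightarrow> \<theta> a (x ^ k) = \<theta> a x ^ k"
    using galois_power[OF I artin_galois[OF assms], of x k] by (simp add: intermediate_ring_power[OF I])
  note A = conjunct2[OF mp[OF spec[OF \<theta>[unfolded artin_map_def]] E]]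
  show "b \<noteq> 0 \<Longrightarrow> x \<in> E \<Longrightarrow> \<theta> (a * b) x = \<theta> a (\<theta> b x)"
    using conjunct1[OF A] a by blast
  show "y \<in> E \<Longrightarrow> y \<noteq> 0 \<Longrightarrow> x \<in> E \<Longrightarrow> \<theta> (field_norm E y) x = x"
    using conjunct1[OF conjunct2[OF A]] by blast
qed

text \<open>Multiplicativity makes \<theta> 1 idempotent on \<open>E\<close>, and it is injective
  there.\<close>

lemma artin_one:
  assumes \<theta>: "artin_map absv \<theta>" and E: "abelian_extension E" and x: "x \<in> E"
  shows "\<theta> 1 x = x"
proof -
  have "bij_betw (restrict (\<theta> 1) E) E E"
    using artin_galois[OF \<theta> E, of 1] by (simp add: galois_group_def)
  then have "inj_on (\<theta> 1) E"
    by (simp add: bij_betw_def inj_on_restrict_eq)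
  moreover have "\<theta> 1 (\<theta> 1 x) = \<theta> 1 x"
    using artin_hom(5)[OF \<theta> E, of 1 1 x] x by simp
  ultimately show ?thesis
    using x artin_hom(1)[OF \<theta> E, of 1 x] by (metis inj_onD zero_neq_one)
qed

lemma artin_scale_power:
  assumes \<theta>: "artin_map absv \<theta>" and E: "abelian_extension E" and a: "a \<noteq> 0" and x: "x \<in> E"
    and eq: "\<theta> a x = to_ac c * x"
  shows "\<theta> (a ^ k) x = to_ac c ^ k * x"
proof (induction k)
  case 0
  then show ?case
    using artin_one[OF \<theta> E x] by simp
next
  case (Suc k)
  have I: "intermediate_ring E"
    using E by (simp add: abelian_extension_def finite_extension_intermediate)
  have "\<theta> (a ^ Suc k) x = \<theta> a (to_ac (c ^ k) * x)"
    using artin_hom(5)[OF \<theta> E a, of "a ^ k" x] a x Suc by simp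
  also have "\<dots> = to_ac (c ^ k) * (to_ac c * x)"
    using x by (subst artin_hom(3)[OF \<theta> E a]) (simp_all only: artin_hom(4)[OF \<theta> E a] eq intermediate_ringD[OF I])
  finally show ?case
    by (simp add: mult_ac)
qed

text \<open>Quantifying over both square roots avoids choosing one; Artin maps treat them alike.
  Integer values allow the cancellation argument for \<plusminus>1-valued symbols.\<close>

definition quadratic_symbol ::
  "('a::field_char_0 \<Rightarrow> 'a alg_closure \<Rightarrow> 'a alg_closure) \<Rightarrow> 'a \<Rightarrow> 'a \<Rightarrow> int" where
  "quadratic_symbol \<theta> a b = (if \<forall>r. r\<^sup>2 = to_ac b \<longrightarrow> \<theta> a r = r then 1 else - 1)"

lemma quadratic_symbol_sign: "quadratic_symbol \<theta> a b = 1 \<or> quadratic_symbol \<theta> a b = - 1"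
  by (simp add: quadratic_symbol_def)

lemma sqrt_alg_closure:
  obtains r :: "'a::field alg_closure" where "r\<^sup>2 = to_ac b"
  using nth_root_exists[of 2 "to_ac b"] by auto

context
  fixes absv :: "'f::field_char_0 \<Rightarrow> real" and \<theta>
  assumes \<theta>: "artin_map absv \<theta>"
begin

lemma artin_sqrt:
  assumes a: "a \<noteq> 0" and b: "b \<noteq> 0" and r: "r\<^sup>2 = to_ac b"
  shows "\<theta> a r = to_ac (of_int (quadratic_symbol \<theta> a b)) * r"
proof -
  interpret kummer 2 b r
    by (rule kummer_2) fact+
  note h = artin_hom[OF \<theta> abelian_K a]
  have "(\<theta> a r)\<^sup>2 = r\<^sup>2"
    using h(7)[OF \<beta>_in_K, of 2] h(4) r by simp
  then have pm: "\<theta> a r = r \<or> \<theta> a r = - r"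
    by (simp add: power2_eq_iff)
  have "\<theta> a (to_ac (- 1) * r) = to_ac (- 1) * \<theta> a r"
    by (subst h(3)) (simp_all only: h(4) \<beta>_in_K intermediate_ringD(1)[OF intermediate_K])
  then have neg: "\<theta> a (- r) = - \<theta> a r"
    by simp
  have all: "(\<forall>r'. r'\<^sup>2 = to_ac b \<longrightarrow> \<theta> a r' = r') \<longleftrightarrow> \<theta> a r = r"
  proof
    assume fix_r: "\<theta> a r = r"
    show "\<forall>r'. r'\<^sup>2 = to_ac b \<longrightarrow> \<theta> a r' = r'"
    proof (intro allI impI)
      fix r'
      assume "r'\<^sup>2 = to_ac b"
      then have "r' = r \<or> r' = - r"
        using r by (metis power2_eq_iff)
      then show "\<theta> a r' = r'"
        using fix_r neg by auto
    qed
  qed (use r in blast)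
  show ?thesis
  proof (cases "\<theta> a r = r")
    case True
    then show ?thesis
      using all by (simp add: quadratic_symbol_def)
  next
    case False
    then have "quadratic_symbol \<theta> a b = - 1"
      using all by (simp add: quadratic_symbol_def)
    then show ?thesis
      using pm False by simp
  qed
qed

lemma quadratic_symbol_eqI:
  assumes a: "a \<noteq> 0" and b: "b \<noteq> 0" and r: "r\<^sup>2 = to_ac b" and eq: "\<theta> a r = to_ac (of_int k) * r"
  shows "quadratic_symbol \<theta> a b = k"
proof -
  have "r \<noteq> 0"
    using r b by auto
  then have "to_ac (of_int (quadratic_symbol \<theta> a b)) = (to_ac (of_int k) :: 'f alg_closure)"
    using artin_sqrt[OF a b r] eq by (metis mult_cancel_right)
  then show ?thesis
    by (simp del: to_ac_of_int)
qed

lemma quadratic_symbol_mult_left: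
  assumes "a \<noteq> 0" "a' \<noteq> 0" "b \<noteq> 0"
  shows "quadratic_symbol \<theta> (a * a') b = quadratic_symbol \<theta> a b * quadratic_symbol \<theta> a' b"
proof -
  obtain r :: "'f alg_closure" where r: "r\<^sup>2 = to_ac b"
    by (rule sqrt_alg_closure)
  interpret kummer 2 b r
    by (rule kummer_2) fact+
  have "\<theta> (a * a') r = \<theta> a (to_ac (of_int (quadratic_symbol \<theta> a' b)) * r)"
    using artin_hom(5)[OF \<theta> abelian_K] \<beta>_in_K artin_sqrt[OF _ _ r] assms by metis
  also have "\<dots> = to_ac (of_int (quadratic_symbol \<theta> a' b)) * (to_ac (of_int (quadratic_symbol \<theta> a b)) * r)"
    by (subst artin_hom(3)[OF \<theta> abelian_K assms(1)])
      (simp_all only: artin_hom(4)[OF \<theta> abelian_K assms(1)] \<beta>_in_K intermediate_ringD(1)[OF intermediate_K]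
        artin_sqrt[OF assms(1,3) r])
  finally show ?thesis
    using assms r by (intro quadratic_symbol_eqI) (simp_all add: mult_ac)
qed

lemma quadratic_symbol_mult_right:
  assumes "a \<noteq> 0" "b \<noteq> 0" "b' \<noteq> 0"
  shows "quadratic_symbol \<theta> a (b * b') = quadratic_symbol \<theta> a b * quadratic_symbol \<theta> a b'"
proof -
  obtain r t :: "'f alg_closure" where r: "r\<^sup>2 = to_ac b" and t: "t\<^sup>2 = to_ac b'"
    by (metis sqrt_alg_closure)
  obtain E where E: "abelian_extension E" "r \<in> E" "t \<in> E"
    by (rule biquadratic_abelian[OF assms(2) r assms(3) t])
  have "\<theta> a (r * t) = to_ac (of_int (quadratic_symbol \<theta> a b)) * r * (to_ac (of_int (quadratic_symbol \<theta> a b')) * t)"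
    using artin_hom(3)[OF \<theta> E(1) assms(1) E(2,3)] artin_sqrt[OF assms(1,2) r] artin_sqrt[OF assms(1,3) t]
    by simp
  then show ?thesis
    using assms r t by (intro quadratic_symbol_eqI[where r = "r * t"]) (simp_all add: power_mult_distrib mult_ac)
qed

lemma quadratic_symbol_split:
  assumes a: "a \<noteq> 0" and r: "r \<in> range to_ac" "r\<^sup>2 = to_ac b" and b: "b \<noteq> 0"
  shows "quadratic_symbol \<theta> a b = 1"
proof -
  interpret kummer 2 b r
    by (rule kummer_2) fact+
  show ?thesis
    using artin_hom(4)[OF \<theta> abelian_K a] r by (intro quadratic_symbol_eqI[OF a b r(2)]) auto
qed

lemma quadratic_symbol_norm:
  assumes a: "a \<noteq> 0" and b: "b \<noteq> 0" and eq: "a = x\<^sup>2 - b * y\<^sup>2"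
  shows "quadratic_symbol \<theta> a b = 1"
proof -
  obtain r :: "'f alg_closure" where r: "r\<^sup>2 = to_ac b"
    by (rule sqrt_alg_closure)
  have k: "kummer 2 b r"
    by (rule kummer_2) fact+
  interpret kummer 2 b r
    by (fact k)
  show ?thesis
  proof (cases "r \<in> range to_ac")
    case True
    then show ?thesis
      using quadratic_symbol_split a b r by blast
  next
    case False
    define z where "z = to_ac x + to_ac y * r"
    have "z \<in> K"
      unfolding z_def by (intro intermediate_ringD[OF intermediate_K] \<beta>_in_K)
    moreover have norm: "field_norm K z = a"
      unfolding z_def eq by (rule quadratic_norm[OF k False])
    moreover have "z \<noteq> 0"
    proof
      assume "z = 0"
      \<comment> \<open>\<open>field_norm\<close> is a definite description, so its value at 0 has
        to be read off from the product, which vanishes because the Galois group is nonempty and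
        finite.\<close>
      moreover have "\<exists>\<tau>. \<tau> \<in> galois_group K"
        using artin_galois[OF \<theta> abelian_K a] by blast
      moreover have "finite (galois_group K)"
        using galois_bij roots_of_unity_bound(1)[OF deg_pos] bij_betw_finite by blast
      ultimately have "(\<Prod>\<tau>\<in>galois_group K. \<tau> z) = 0"
        by (intro prod_zero) (auto simp: galoisD)
      then have "(\<Prod>\<tau>\<in>galois_group K. \<tau> z) = to_ac 0"
        by simp
      then show False
        using field_norm_eqI norm a by blast
    qed
    ultimately have "\<theta> a r = r"
      using artin_hom(6)[OF \<theta> abelian_K a, of z r] \<beta>_in_K by simp
    then show ?thesis
      by (intro quadratic_symbol_eqI[OF a b r]) simp
  qed
qed

end

context padic_field
begin

text \<open>The form s^2 + st - c t^2 is the norm of s + t \<omega>, where \<omega>^2 - \<omega> =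
  c. If |t| < |s|, the term s^2 dominates; otherwise the form is t^2 times a value of x^2 - x - c at
  the integral point x = - s/t, a unit by assumption.\<close>

lemma anisotropic_absv:
  assumes c: "absv c \<le> 1" and no: "\<And>x. absv x \<le> 1 \<Longrightarrow> absv (x\<^sup>2 - x - c) = 1"
  shows "absv (s\<^sup>2 + s * t - c * t\<^sup>2) = (max (absv s) (absv t))\<^sup>2"
proof (cases "absv t < absv s")
  case True
  have s: "absv s > 0"
    using True absv_nonneg[of t] by linarith
  have "absv (s * t) < absv s ^ 2"
    using True s by (simp add: absv_mult power2_eq_square)
  moreover have "absv (c * t\<^sup>2) \<le> absv t ^ 2"
    using c by (simp add: absv_mult absv_power mult_left_le_one_le absv_nonneg)
  moreover have "absv t ^ 2 < absv s ^ 2"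
    using True by (simp add: power_strict_mono absv_nonneg)
  ultimately have "absv (s * t - c * t\<^sup>2) < absv (s\<^sup>2)"
    using absv_diff_le[of "s * t" "c * t\<^sup>2"] by (simp add: absv_power)
  then have "absv (s\<^sup>2 + (s * t - c * t\<^sup>2)) = absv (s\<^sup>2)"
    by (rule absv_add_eq)
  then show ?thesis
    using True by (simp add: absv_power add_diff_eq max_def)
next
  case False
  show ?thesis
  proof (cases "t = 0")
    case True
    then show ?thesis
      using False absv_nonneg[of s] absv_eq_0[of s] by simp
  next
    case t: False
    then have "absv (- s / t) \<le> 1"
      using False absv_pos[OF t] by (simp add: absv_divide)
    then have "absv ((- s / t)\<^sup>2 - (- s / t) - c) = 1"
      by (rule no)
    moreover have "s\<^sup>2 + s * t - c * t\<^sup>2 = t\<^sup>2 * ((- s / t)\<^sup>2 - (- s / t) - c)"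
      using t by (simp add: power2_eq_square field_simps)
    ultimately show ?thesis
      using False by (simp add: absv_mult absv_power max_def)
  qed
qed

text \<open>Two Artin maps agree on uniformizers modulo the maximal ideal of an unramified extension, while
  a square root of a unit is not in that ideal.\<close>

lemma quadratic_symbol_unramified:
  assumes \<theta>: "artin_map absv \<theta>" and \<theta>': "artin_map absv \<theta>'" and a: "a \<noteq> 0"
    and c: "absv c \<le> 1" and u: "absv (1 + 4 * c) = 1"
  shows "quadratic_symbol \<theta> a (1 + 4 * c) = quadratic_symbol \<theta>' a (1 + 4 * c)"
proof -
  define u where "u = 1 + 4 * c"
  have u1: "absv u = 1" "u \<noteq> 0"
    using u by (auto simp: u_def)
  obtain r :: "'f alg_closure" where r: "r\<^sup>2 = to_ac u"
    by (rule sqrt_alg_closure)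
  have k: "kummer 2 u r"
    by (rule kummer_2) fact+
  interpret kummer 2 u r
    by (fact k)
  have "quadratic_symbol \<theta> a u = quadratic_symbol \<theta>' a u"
  proof (cases "r \<in> range to_ac")
    case True
    then show ?thesis
      using quadratic_symbol_split[OF \<theta> a _ r] quadratic_symbol_split[OF \<theta>' a _ r] u1 by simp
  next
    case False
    \<comment> \<open>Otherwise (2x - 1)^2 = u + 4 (x^2 - x - c) is a unit, Hensel's lemma solves
      y^2 - y = c, and 2y - 1 is a square root of u in the base field.\<close>
    have no: "absv (x\<^sup>2 - x - c) = 1" if x: "absv x \<le> 1" for x
    proof (rule ccontr)
      assume "absv (x\<^sup>2 - x - c) \<noteq> 1"
      moreover have "absv (x\<^sup>2) \<le> 1"
        using x absv_nonneg[of x] by (simp add: absv_power power_le_one)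
      then have "absv (x\<^sup>2 - x - c) \<le> 1"
        using absv_diff_le[of "x\<^sup>2 - x" c] absv_diff_le[of "x\<^sup>2" x] x c by linarith
      ultimately have small: "absv (x\<^sup>2 - x - c) < 1"
        by simp
      have "absv 4 * absv (x\<^sup>2 - x - c) \<le> absv (x\<^sup>2 - x - c)"
        using absv_numeral_le[of "num.Bit0 (num.Bit0 num.One)"]
        by (intro mult_left_le_one_le) (simp_all add: absv_nonneg)
      then have "absv (4 * (x\<^sup>2 - x - c)) < absv u"
        unfolding absv_mult
        using small u1 by simp
      then have "absv (u + 4 * (x\<^sup>2 - x - c)) = 1"
        using absv_add_eq u1 by metis
      moreover have "u + 4 * (x\<^sup>2 - x - c) = (2 * x - 1)\<^sup>2"
        by (simp add: u_def power2_eq_square algebra_simps)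
      ultimately have "absv (2 * x - 1) = 1"
        using absv_nonneg[of "2 * x - 1"] by (simp add: absv_power power2_eq_1_iff)
      then obtain y where "y\<^sup>2 - y = c"
        by (rule hensel_quadratic[OF x small])
      then have "(2 * y - 1)\<^sup>2 = u"
        by (simp add: u_def power2_eq_square algebra_simps flip: \<open>y\<^sup>2 - y = c\<close>)
      then have "r\<^sup>2 = (to_ac (2 * y - 1))\<^sup>2"
        by (simp only: r to_ac_power[symmetric])
      then have "r = to_ac (2 * y - 1) \<or> r = to_ac (- (2 * y - 1))"
        by (simp only: power2_eq_iff to_ac_minus)
      then show False
        using False by blast
    qed
    \<comment> \<open>This is s + t \<omega> for \<omega> = (1 + r)/2, a root of \<omega>^2 -
      \<omega> = c. In these coordinates integrality and the maximal ideal are read off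
      coordinatewise, also in residue characteristic 2.\<close>
    define el where "el s t = to_ac (s + t / 2) + to_ac (t / 2) * r" for s t
    have norm: "field_norm K (el s t) = s\<^sup>2 + s * t - c * t\<^sup>2" for s t
      unfolding el_def quadratic_norm[OF k False] by (simp add: u_def power2_eq_square field_simps)
    have K_el: "K = {el s t |s t. True}"
    proof -
      have "\<exists>s t. to_ac x + to_ac y * r = el s t" for x y
        by (intro exI[of _ "x - y"] exI[of _ "2 * y"]) (simp add: el_def)
      moreover have "\<exists>x y. el s t = to_ac x + to_ac y * r" for s t
        unfolding el_def by (intro exI) (rule refl)
      ultimately show ?thesis
        unfolding quadratic_elements[OF k] by (auto intro: sym)
    qed
    have el_K: "el s t \<in> K" for s t
      using K_el by blast
    have norm_abs: "absv (field_norm K (el s t)) = (max (absv s) (absv t))\<^sup>2" for s t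
      unfolding norm by (rule anisotropic_absv[OF c no])
    have maxnn: "0 \<le> max (absv s) (absv t)" for s t
      by (simp add: absv_nonneg le_max_iff_disj)
    have el_int: "el s t \<in> int_ring_ext absv K \<longleftrightarrow> absv s \<le> 1 \<and> absv t \<le> 1" for s t
    proof -
      have "el s t \<in> int_ring_ext absv K \<longleftrightarrow> (max (absv s) (absv t))\<^sup>2 \<le> 1\<^sup>2"
        using el_K by (simp add: int_ring_ext_def norm_abs)
      also have "\<dots> \<longleftrightarrow> max (absv s) (absv t) \<le> 1"
        using maxnn[of s t] by (subst power2_le_iff_abs_le) simp_all
      finally show ?thesis
        by simp
    qed
    have el_max: "el s t \<in> max_ideal_ext absv K \<longleftrightarrow> absv s < 1 \<and> absv t < 1" for s t
    proof -
      have "el s t \<in> max_ideal_ext absv K \<longleftrightarrow> (max (absv s) (absv t))\<^sup>2 < 1"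
        using el_K by (simp add: max_ideal_ext_def norm_abs)
      also have "\<dots> \<longleftrightarrow> max (absv s) (absv t) < 1"
        using maxnn[of s t] by (simp add: abs_square_less_1)
      finally show ?thesis
        by simp
    qed
    have el_scale: "to_ac x * el s t = el (x * s) (x * t)" for x s t
      by (simp add: el_def algebra_simps)
    obtain \<pi> where \<pi>: "uniformizer absv \<pi>"
      using uniformizer_exists by blast
    note p = uniformizer_props[OF \<pi>]
    have "max_ideal_ext absv K = (\<lambda>y. to_ac \<pi> * y) ` int_ring_ext absv K"
    proof (intro equalityI subsetI)
      fix z
      assume z: "z \<in> max_ideal_ext absv K"
      then obtain s t where st: "z = el s t"
        using K_el by (auto simp: max_ideal_ext_def)
      then have "absv s \<le> absv \<pi>" "absv t \<le> absv \<pi>"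
        using z el_max p(4) by blast+
      then have "el (s / \<pi>) (t / \<pi>) \<in> int_ring_ext absv K"
        using p(2) by (simp add: el_int absv_divide)
      moreover have "z = to_ac \<pi> * el (s / \<pi>) (t / \<pi>)"
        using p(1) by (simp add: st el_scale)
      ultimately show "z \<in> (\<lambda>y. to_ac \<pi> * y) ` int_ring_ext absv K"
        by blast
    next
      fix z
      assume "z \<in> (\<lambda>y. to_ac \<pi> * y) ` int_ring_ext absv K"
      then obtain s t where st: "el s t \<in> int_ring_ext absv K" "z = to_ac \<pi> * el s t"
        using K_el by (auto simp: int_ring_ext_def)
      then have "absv (\<pi> * s) \<le> absv \<pi>" "absv (\<pi> * t) \<le> absv \<pi>"
        using p(2) by (simp_all add: el_int absv_mult mult_left_le)
      then show "z \<in> max_ideal_ext absv K"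
        using p(4) by (simp add: st el_scale el_max)
    qed
    then have unr: "unramified absv K"
      unfolding unramified_def using \<pi> by blast
    have \<omega>: "el 0 1 \<in> int_ring_ext absv K"
      by (simp add: el_int)
    have uniformizers: "quadratic_symbol \<theta> \<pi>' u = quadratic_symbol \<theta>' \<pi>' u" if \<pi>': "uniformizer absv \<pi>'" for \<pi>'
    proof -
      have \<pi>0: "\<pi>' \<noteq> 0"
        using uniformizer_props[OF \<pi>'] by blast
      have el01: "el 0 1 = to_ac (1 / 2) + to_ac (1 / 2) * r"
        by (simp add: el_def)
      \<comment> \<open>The symbol 1 fixes \<omega>, and the symbol -1 sends it to 1 -
        \<omega>.\<close>
      have val: "\<rho> \<pi>' (el 0 1) = el (1 / 2 - of_int (quadratic_symbol \<rho> \<pi>' u) / 2) (of_int (quadratic_symbol \<rho> \<pi>' u))"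
        if \<rho>: "artin_map absv \<rho>" for \<rho>
      proof -
        have "\<rho> \<pi>' (el 0 1) = to_ac (1 / 2) + to_ac (1 / 2) * \<rho> \<pi>' r"
          unfolding el01 using \<beta>_in_K
          by (simp only: artin_hom[OF \<rho> abelian_K \<pi>0] intermediate_ringD[OF intermediate_K])
        also have "\<rho> \<pi>' r = to_ac (of_int (quadratic_symbol \<rho> \<pi>' u)) * r"
          by (rule artin_sqrt[OF \<rho> \<pi>0 u1(2) r])
        finally show ?thesis
          by (simp add: el_def del: to_ac_of_int)
      qed
      have cong: "\<rho> \<pi>' (el 0 1) - el 0 1 ^ residue_card absv \<in> max_ideal_ext absv K" if "artin_map absv \<rho>" for \<rho>
        using conjunct2[OF conjunct2[OF conjunct2[OF mp[OF spec[OF that[unfolded artin_map_def]] abelian_K]]]]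
          unr \<pi>' \<omega> by blast
      obtain s t s' t' where
        st: "\<theta> \<pi>' (el 0 1) - el 0 1 ^ residue_card absv = el s t" "absv s < 1" "absv t < 1"
        and st': "\<theta>' \<pi>' (el 0 1) - el 0 1 ^ residue_card absv = el s' t'" "absv s' < 1" "absv t' < 1"
      proof -
        obtain s t where "\<theta> \<pi>' (el 0 1) - el 0 1 ^ residue_card absv = el s t"
          using cong[OF \<theta>] K_el by (auto simp: max_ideal_ext_def)
        moreover obtain s' t' where "\<theta>' \<pi>' (el 0 1) - el 0 1 ^ residue_card absv = el s' t'"
          using cong[OF \<theta>'] K_el by (auto simp: max_ideal_ext_def)
        ultimately show ?thesis
          using that cong[OF \<theta>] cong[OF \<theta>'] el_max by metis
      qed
      have el_diff: "el s t - el s' t' = el (s - s') (t - t')" for s t s' t'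
        by (simp add: el_def diff_divide_distrib algebra_simps)
      have "\<theta> \<pi>' (el 0 1) - \<theta>' \<pi>' (el 0 1) = el (s - s') (t - t')"
        unfolding el_diff[symmetric] st(1)[symmetric] st'(1)[symmetric] by simp
      moreover have "absv (s - s') < 1" "absv (t - t') < 1"
        using absv_diff_le[of s s'] absv_diff_le[of t t'] st st' by linarith+
      \<comment> \<open>Both images are congruent to the same Frobenius power of \<omega>. Different
        signs would make the first coordinate of their difference \<plusminus>1, which is not in the
        maximal ideal.\<close>
      ultimately have "el (of_int (quadratic_symbol \<theta>' \<pi>' u) / 2 - of_int (quadratic_symbol \<theta> \<pi>' u) / 2)
          (of_int (quadratic_symbol \<theta> \<pi>' u) - of_int (quadratic_symbol \<theta>' \<pi>' u)) \<in> max_ideal_ext absv K"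
        by (simp add: val[OF \<theta>] val[OF \<theta>'] el_diff el_max)
      then have "absv (of_int (quadratic_symbol \<theta>' \<pi>' u) / 2 - of_int (quadratic_symbol \<theta> \<pi>' u) / 2) < 1"
        by (simp add: el_max)
      then show ?thesis
        using quadratic_symbol_sign[of \<theta> \<pi>' u] quadratic_symbol_sign[of \<theta>' \<pi>' u]
        by (auto simp: absv_divide)
    qed
    \<comment> \<open>A unit is a quotient of two uniformizers.\<close>
    have units: "quadratic_symbol \<theta> v u = quadratic_symbol \<theta>' v u" if v: "absv v = 1" for v
    proof -
      have "v \<noteq> 0"
        using v by auto
      have "uniformizer absv (v * \<pi>)"
        by (rule uniformizerI[OF \<pi>]) (simp add: absv_mult v)
      then have "quadratic_symbol \<theta> (v * \<pi>) u = quadratic_symbol \<theta>' (v * \<pi>) u"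
        by (rule uniformizers)
      then show ?thesis
        using uniformizers[OF \<pi>] quadratic_symbol_sign[of \<theta>' \<pi> u] p(1) u1 \<open>v \<noteq> 0\<close>
        by (auto simp: quadratic_symbol_mult_left[OF \<theta>] quadratic_symbol_mult_left[OF \<theta>'])
    qed
    have powers: "quadratic_symbol \<theta> (\<pi> ^ j) u = quadratic_symbol \<theta>' (\<pi> ^ j) u" for j
    proof (induction j)
      case 0
      then show ?case
        using units[of 1] by simp
    next
      case (Suc j)
      then show ?case
        using uniformizers[OF \<pi>] p(1) u1
        by (simp add: quadratic_symbol_mult_left[OF \<theta>] quadratic_symbol_mult_left[OF \<theta>'])
    qed
    obtain j l :: nat and v where v: "absv v = 1" "a * \<pi> ^ l = \<pi> ^ j * v"
      using decomposition[OF \<pi> a] by metis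
    have "v \<noteq> 0"
      using v by auto
    have "quadratic_symbol \<theta> (a * \<pi> ^ l) u = quadratic_symbol \<theta>' (a * \<pi> ^ l) u"
      unfolding v(2) using powers[of j] units[OF v(1)] p(1) u1 \<open>v \<noteq> 0\<close>
      by (simp add: quadratic_symbol_mult_left[OF \<theta>] quadratic_symbol_mult_left[OF \<theta>'])
    then show ?thesis
      using powers[of l] quadratic_symbol_sign[of \<theta>' "\<pi> ^ l" u] p(1) u1 a
      by (auto simp: quadratic_symbol_mult_left[OF \<theta>] quadratic_symbol_mult_left[OF \<theta>'])
  qed
  then show ?thesis
    by (simp add: u_def)
qed

text \<open>For \<plusminus>1-valued symbols the product of the two is their quotient. It inherits
  bimultiplicativity and triviality on norms from both factors, and the factors cancel against
  unramified extensions, so it is trivial on units.\<close>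

lemma quadratic_symbol_unique:
  assumes \<theta>: "artin_map absv \<theta>" and \<theta>': "artin_map absv \<theta>'" and u: "absv u = 1" and b: "b \<noteq> 0"
  shows "quadratic_symbol \<theta> u b = quadratic_symbol \<theta>' u b"
proof -
  have "quadratic_symbol \<theta> u b * quadratic_symbol \<theta>' u b = 1"
  proof (rule D_units_trivial[of "\<lambda>a b. quadratic_symbol \<theta> a b * quadratic_symbol \<theta>' a b", OF _ _ _ _ _ u b])
    fix a b :: 'f
    show "quadratic_symbol \<theta> a b * quadratic_symbol \<theta>' a b = 1 \<or> quadratic_symbol \<theta> a b * quadratic_symbol \<theta>' a b = - 1"
      using quadratic_symbol_sign[of \<theta> a b] quadratic_symbol_sign[of \<theta>' a b] by auto
  next
    fix a c :: 'f
    assume "a \<noteq> 0" "absv c \<le> 1" "absv (1 + 4 * c) = 1"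
    then show "quadratic_symbol \<theta> a (1 + 4 * c) * quadratic_symbol \<theta>' a (1 + 4 * c) = 1"
      using quadratic_symbol_unramified[OF \<theta> \<theta>'] quadratic_symbol_sign[of \<theta>' a "1 + 4 * c"] by auto
  qed (simp_all add: quadratic_symbol_mult_left[OF \<theta>] quadratic_symbol_mult_left[OF \<theta>']
      quadratic_symbol_mult_right[OF \<theta>] quadratic_symbol_mult_right[OF \<theta>']
      quadratic_symbol_norm[OF \<theta>] quadratic_symbol_norm[OF \<theta>'])
  then show ?thesis
    using quadratic_symbol_sign[of \<theta> u b] quadratic_symbol_sign[of \<theta>' u b] by auto
qed


subsection \<open>Values of the Hilbert symbol\<close>

lemma hilbert_symbol_no_artin:
  assumes "\<nexists>\<theta>. artin_map absv \<theta>"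
  shows "hilbert_symbol absv n a b = hilbert_symbol absv n a' b'"
  using assms by (simp add: hilbert_symbol_def)

text \<open>The definite description ranges over all Artin maps and all roots, so the value has to
  be verified for every pair; the given Artin map serves for existence.\<close>

lemma hilbert_symbol_eqI:
  assumes "artin_map absv \<theta>" and n: "n \<ge> 1" and b: "b \<noteq> 0"
    and eq: "\<And>\<theta> \<beta>. artin_map absv \<theta> \<Longrightarrow> \<beta> ^ n = to_ac b \<Longrightarrow> \<theta> a \<beta> = to_ac z * \<beta>"
  shows "hilbert_symbol absv n a b = z"
  unfolding hilbert_symbol_def
proof (rule the_equality)
  obtain \<beta> :: "'f alg_closure" where "\<beta> ^ n = to_ac b"
    using nth_root_exists[of n "to_ac b"] n by auto
  then show "\<exists>\<theta> \<beta>. artin_map absv \<theta> \<and> \<beta> ^ n = to_ac b \<and> \<theta> a \<beta> = to_ac z * \<beta>"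
    using assms by blast
next
  fix z'
  assume "\<exists>\<theta> \<beta>. artin_map absv \<theta> \<and> \<beta> ^ n = to_ac b \<and> \<theta> a \<beta> = to_ac z' * \<beta>"
  then obtain \<theta> \<beta> where \<beta>: "artin_map absv \<theta>" "\<beta> ^ n = to_ac b" "\<theta> a \<beta> = to_ac z' * \<beta>"
    by blast
  then have "to_ac z' * \<beta> = to_ac z * \<beta>"
    using eq by metis
  moreover have "\<beta> \<noteq> 0"
    using \<beta>(2) b n by (auto simp: power_0_left split: if_splits)
  ultimately show "z' = z"
    by simp
qed

context
  fixes n :: nat
  assumes n: "n \<ge> 1" and roots: "card (roots_of_unity n :: 'f set) = n"
begin

lemma hilbert_symbol_one_left:
  assumes "artin_map absv \<theta>" "b \<noteq> 0"
  shows "hilbert_symbol absv n 1 b = 1"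
proof (rule hilbert_symbol_eqI[OF assms(1) n assms(2)])
  fix \<theta> \<beta>
  assume \<theta>: "artin_map absv \<theta>" and \<beta>: "\<beta> ^ n = to_ac b"
  interpret kummer n b \<beta>
    by unfold_locales fact+
  show "\<theta> 1 \<beta> = to_ac 1 * \<beta>"
    using artin_one[OF \<theta> abelian_K \<beta>_in_K] by simp
qed

lemma hilbert_symbol_one_right:
  assumes "artin_map absv \<theta>" "a \<noteq> 0"
  shows "hilbert_symbol absv n a 1 = 1"
proof (rule hilbert_symbol_eqI[OF assms(1) n])
  fix \<theta> \<beta>
  assume \<theta>: "artin_map absv \<theta>" and \<beta>: "\<beta> ^ n = to_ac (1::'f)"
  interpret kummer n 1 \<beta>
    by unfold_locales (use n roots \<beta> in simp_all)
  obtain \<omega> where "\<beta> = to_ac \<omega>"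
    using roots_of_unity_closure[OF n roots] \<beta> by (metis to_ac_1)
  then show "\<theta> a \<beta> = to_ac 1 * \<beta>"
    using artin_hom(4)[OF \<theta> abelian_K assms(2)] by simp
qed simp

text \<open>Since \<open>- a\<^sup>-\<^sup>1\<close> is a norm from the extension generated by \<open>\<beta>\<close>, the elements \<open>a\<close> and \<open>- 1\<close> act on
  \<open>\<beta>\<close> in the same way. For even \<open>n\<close>, the latter is a power of a root of unity, which reduces its
  action to a quadratic symbol.\<close>

lemma hilbert_symbol_inverse:
  assumes \<theta>\<^sub>0: "artin_map absv \<theta>\<^sub>0" and a: "a \<noteq> 0"
  shows "hilbert_symbol absv n a (inverse a) \<in> roots_of_unity n"
proof -
  have reduce: "\<theta> a \<beta> = \<theta> (- 1) \<beta>" if \<theta>: "artin_map absv \<theta>" and \<beta>: "\<beta> ^ n = to_ac (inverse a)" for \<theta> \<beta>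
  proof -
    interpret kummer n "inverse a" \<beta>
      by unfold_locales (use n roots \<beta> a in simp_all)
    obtain y where "y \<in> K" "y \<noteq> 0" "field_norm K y = - inverse a"
      using minus_b_norm by blast
    then have trivial: "\<theta> (- inverse a) \<beta> = \<beta>"
      using artin_hom(6)[OF \<theta> abelian_K a, of y \<beta>] \<beta>_in_K by simp
    have "\<theta> (a * (- inverse a)) \<beta> = \<theta> a (\<theta> (- inverse a) \<beta>)"
      using a by (intro artin_hom(5)[OF \<theta> abelian_K a] \<beta>_in_K) simp
    then show ?thesis
      using a by (simp add: trivial)
  qed
  show ?thesis
  proof (cases "even n")
    case True
    then obtain m where m: "n = 2 * m"
      by blast
    \<comment> \<open>A root of unity outside the m-th ones has m-th power -1, which exhibits -1 as
      an m-th power.\<close>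
    have "\<not> roots_of_unity n \<subseteq> (roots_of_unity m :: 'f set)"
    proof
      assume "roots_of_unity n \<subseteq> (roots_of_unity m :: 'f set)"
      then have "n \<le> m"
        using roots roots_of_unity_bound[of m, where 'a = 'f] m n
        by (metis card_mono le_trans mult_0_right nat_le_linear not_one_le_zero less_one linorder_not_le)
      then show False
        using m n by simp
    qed
    then obtain \<zeta> :: 'f where \<zeta>: "\<zeta> ^ n = 1" "\<zeta> ^ m \<noteq> 1"
      by (auto simp: roots_of_unity_def)
    have "(\<zeta> ^ m)\<^sup>2 = 1"
      using \<zeta>(1) by (simp add: m power_mult[symmetric] mult.commute)
    then have \<zeta>m: "\<zeta> ^ m = - 1"
      using \<zeta>(2) by (simp add: power2_eq_1_iff)
    have "absv \<zeta> ^ n = 1"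
      using \<zeta>(1) by (simp flip: absv_power)
    then have \<zeta>1: "absv \<zeta> = 1"
      using n absv_nonneg[of \<zeta>] by (metis power_eq_1_iff real_norm_def abs_of_nonneg not_one_le_zero)
    then have \<zeta>0: "\<zeta> \<noteq> 0"
      by auto
    define q where "q = quadratic_symbol \<theta>\<^sub>0 \<zeta> (inverse a)"
    have "hilbert_symbol absv n a (inverse a) = of_int q"
    proof (rule hilbert_symbol_eqI[OF \<theta>\<^sub>0 n])
      fix \<theta> \<beta>
      assume \<theta>: "artin_map absv \<theta>" and \<beta>: "\<beta> ^ n = to_ac (inverse a)"
      interpret kummer n "inverse a" \<beta>
        by unfold_locales (use n roots \<beta> a in simp_all)
      obtain \<omega> where \<omega>: "\<theta> \<zeta> \<beta> = to_ac \<omega> * \<beta>"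
        using galois_root[OF artin_galois[OF \<theta> abelian_K \<zeta>0]] \<beta>_in_K by auto
      have "\<theta> (- 1) \<beta> = to_ac \<omega> ^ m * \<beta>"
        using artin_scale_power[OF \<theta> abelian_K \<zeta>0 \<beta>_in_K \<omega>, of m] \<zeta>m by simp
      \<comment> \<open>\<beta>^m is a square root of a^-1, and \<theta> \<zeta> scales it by
        \<omega>^m, so this scalar is a quadratic symbol.\<close>
      moreover have "to_ac \<omega> ^ m = to_ac (of_int q)"
      proof -
        have r: "(\<beta> ^ m)\<^sup>2 = to_ac (inverse a)"
          using \<beta> by (simp add: m power_mult[symmetric] mult.commute)
        have "to_ac \<omega> ^ m * \<beta> ^ m = \<theta> \<zeta> (\<beta> ^ m)"
          using artin_hom(7)[OF \<theta> abelian_K \<zeta>0 \<beta>_in_K, of m] \<omega> by (simp add: power_mult_distrib)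
        also have "\<dots> = to_ac (of_int (quadratic_symbol \<theta> \<zeta> (inverse a))) * \<beta> ^ m"
          using a by (intro artin_sqrt[OF \<theta> \<zeta>0 _ r]) simp
        also have "quadratic_symbol \<theta> \<zeta> (inverse a) = q"
          unfolding q_def using a by (intro quadratic_symbol_unique[OF \<theta> \<theta>\<^sub>0 \<zeta>1]) simp
        finally show ?thesis
          using \<beta>_nonzero by simp
      qed
      ultimately show "\<theta> a \<beta> = to_ac (of_int q) * \<beta>"
        using reduce[OF \<theta> \<beta>] by simp
    qed (use a in simp)
    moreover have "(of_int q :: 'f) ^ n = 1"
      using quadratic_symbol_sign[of \<theta>\<^sub>0 \<zeta> "inverse a"] True by (auto simp: q_def)
    ultimately show ?thesis
      by (simp add: roots_of_unity_def)
  next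
    case False
    have "hilbert_symbol absv n a (inverse a) = 1"
    proof (rule hilbert_symbol_eqI[OF \<theta>\<^sub>0 n])
      fix \<theta> \<beta>
      assume \<theta>: "artin_map absv \<theta>" and \<beta>: "\<beta> ^ n = to_ac (inverse a)"
      interpret kummer n "inverse a" \<beta>
        by unfold_locales (use n roots \<beta> a in simp_all)
      have neg: "(- 1 :: 'f) \<noteq> 0"
        by simp
      obtain \<omega> where \<omega>: "\<omega> \<in> roots_of_unity deg" "\<theta> (- 1) \<beta> = to_ac \<omega> * \<beta>"
        using galois_root[OF artin_galois[OF \<theta> abelian_K neg]] \<beta>_in_K by auto
      \<comment> \<open>For odd n, -1 is its own n-th power, so it scales \<beta> by \<omega>^n =
        1.\<close>
      have "\<theta> ((- 1) ^ n) \<beta> = to_ac \<omega> ^ n * \<beta>"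
        by (rule artin_scale_power[OF \<theta> abelian_K neg \<beta>_in_K \<omega>(2)])
      moreover have "\<omega> ^ n = 1"
        using \<omega>(1) roots_deg_subset by (auto simp: roots_of_unity_def)
      ultimately show "\<theta> a \<beta> = to_ac 1 * \<beta>"
        using reduce[OF \<theta> \<beta>] False by (simp flip: to_ac_power)
    qed (use a in simp)
    then show ?thesis
      by (simp add: roots_of_unity_def)
  qed
qed

end

end


section \<open>Kubota's cover\<close>

lemma mat2_nth [simp]:
  "mat2 a b c d $ 1 $ 1 = a" "mat2 a b c d $ 1 $ 2 = b" "mat2 a b c d $ 2 $ 1 = c" "mat2 a b c d $ 2 $ 2 = d"
  by (simp_all add: mat2_def)

lemma mat2_eq_iff: "mat2 a b c d = mat2 a' b' c' d' \<longleftrightarrow> a = a' \<and> b = b' \<and> c = c' \<and> d = d'"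
  by (metis mat2_nth)

lemma mat2_cases:
  obtains a b c d where "g = mat2 a b c d"
proof
  show "g = mat2 (g $ 1 $ 1) (g $ 1 $ 2) (g $ 2 $ 1) (g $ 2 $ 2)"
    by (simp add: vec_eq_iff forall_2)
qed

lemma mat_1_eq_mat2: "mat 1 = mat2 1 0 0 (1 :: 'a::field_char_0)"
  by (simp add: vec_eq_iff forall_2 mat_def)

lemma mat2_mult:
  "mat2 a b c d ** mat2 a' b' c' d' =
    mat2 (a * a' + b * c') (a * b' + b * d') (c * a' + d * c') (c * b' + d * d' :: 'a::field_char_0)"
  by (simp add: vec_eq_iff forall_2 matrix_matrix_mult_def sum_2)

lemma det_mat2: "det (mat2 a b c d) = a * d - b * (c :: 'a::field_char_0)"
  by (simp add: det_2)

lemma kubota_x_mat2 [simp]: "kubota_x (mat2 a b c d) = (if c \<noteq> 0 then c else d)"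
  by (simp add: kubota_x_def)

lemma kubota_cocycle_mat2:
  "kubota_cocycle absv n (mat2 a b c d) (mat2 a' b' c' d') =
    (let x = if c * a' + d * c' \<noteq> 0 then c * a' + d * c' else c * b' + d * d' in
      hilbert_symbol absv n (x * inverse (if c \<noteq> 0 then c else d)) (x * inverse (if c' \<noteq> 0 then c' else d')))"
  by (simp add: kubota_cocycle_def mat2_mult Let_def)

lemma cover_mult [simp]:
  "(g, \<epsilon>) \<otimes>\<^bsub>cover absv n\<^esub> (g', \<epsilon>') = (g ** g', kubota_cocycle absv n g g' * \<epsilon> * \<epsilon>')"
  by (simp add: cover_def)

lemma cover_one: "\<one>\<^bsub>cover absv n\<^esub> = (mat 1, 1)"
  by (simp add: cover_def)

lemma cover_carrier: "carrier (cover absv n) = SL2 \<times> roots_of_unity n"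
  by (simp add: cover_def)

lemma mat2_SL2: "mat2 a b c d \<in> SL2 \<longleftrightarrow> a * d - b * c = 1"
  by (simp add: SL2_def det_mat2)

lemma roots_of_unity_mult: "x \<in> roots_of_unity n \<Longrightarrow> y \<in> roots_of_unity n \<Longrightarrow> x * y \<in> roots_of_unity n"
  by (simp add: roots_of_unity_def power_mult_distrib)

lemma roots_of_unity_1 [simp]: "1 \<in> roots_of_unity n"
  by (simp add: roots_of_unity_def)

lemma roots_of_unity_inverse: "x \<in> roots_of_unity n \<Longrightarrow> inverse x \<in> roots_of_unity n"
  by (simp add: roots_of_unity_def power_inverse)

definition torus_elt :: "'a::field_char_0 \<Rightarrow> 'a \<Rightarrow> 'a cover_elt" where
  "torus_elt a \<epsilon> = (mat2 a 0 0 (inverse a), \<epsilon>)"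

lemma torus_eq: "torus n = {torus_elt a \<epsilon> |a \<epsilon>. a \<noteq> 0 \<and> \<epsilon> \<in> roots_of_unity n}"
  by (simp add: torus_def torus_elt_def)

lemma torus_eltI: "a \<noteq> 0 \<Longrightarrow> \<epsilon> \<in> roots_of_unity n \<Longrightarrow> torus_elt a \<epsilon> \<in> torus n"
  by (auto simp: torus_eq)

lemma torus_abs_elt [simp]: "torus_abs absv (torus_elt a \<epsilon>) = absv a"
  by (simp add: torus_abs_def torus_elt_def)

lemma torus_elt_1: "torus_elt 1 \<epsilon> = (mat 1, \<epsilon>)"
  by (simp add: torus_elt_def mat_1_eq_mat2)

locale kubota = padic_field absv for absv :: "'f::field_char_0 \<Rightarrow> real" +
  fixes n :: nat
  assumes n_pos: "n \<ge> 1" and roots: "card (roots_of_unity n :: 'f set) = n"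
begin

abbreviation hs :: "'f \<Rightarrow> 'f \<Rightarrow> 'f" where
  "hs \<equiv> hilbert_symbol absv n"

abbreviation mult :: "'f cover_elt \<Rightarrow> 'f cover_elt \<Rightarrow> 'f cover_elt"  (infixl "\<odot>" 70) where
  "x \<odot> y \<equiv> x \<otimes>\<^bsub>cover absv n\<^esub> y"

text \<open>Under this condition the cocycle values occurring in conjugation by \<open>weyl\<close>
  are roots of unity, so the conjugate of a torus element is in the torus.\<close>

definition symbols_in_roots :: bool where
  "symbols_in_roots \<longleftrightarrow> (\<forall>a b. a \<noteq> 0 \<longrightarrow> b \<noteq> 0 \<longrightarrow> hs a b \<in> roots_of_unity n)"

lemma root_nonzero: "x \<in> roots_of_unity n \<Longrightarrow> x \<noteq> 0"
  using n_pos by (auto simp: roots_of_unity_def power_0_left)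

lemma root_cancel: "x * \<epsilon> \<in> roots_of_unity n \<Longrightarrow> \<epsilon> \<in> roots_of_unity n \<Longrightarrow> x \<in> roots_of_unity n"
  using roots_of_unity_mult[of "x * \<epsilon>" n "inverse \<epsilon>"] roots_of_unity_inverse[of \<epsilon> n] root_nonzero[of \<epsilon>]
  by (simp add: mult.assoc)

lemma torus_mult:
  assumes "a \<noteq> 0" "b \<noteq> 0"
  shows "torus_elt a \<epsilon> \<odot> torus_elt b \<epsilon>' = torus_elt (a * b) (hs (inverse b) (inverse a) * \<epsilon> * \<epsilon>')"
proof -
  have *: "a * (inverse a * inverse b) = inverse b" "b * (inverse a * inverse b) = inverse a"
    using assms by simp_all
  show ?thesis
    using assms by (simp add: torus_elt_def mat2_mult kubota_cocycle_mat2 Let_def mult_ac *)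
qed

lemma identity_in_nhd: "(mat 1, 1) \<in> congruence_nhd absv l"
proof -
  have "mat 1 $ i $ j = (1::'f) \<or> mat 1 $ i $ j = (0::'f)" for i j :: 2
    by (simp add: mat_def)
  then have "mat 1 $ i $ j \<in> int_ring absv" for i j :: 2
    unfolding int_ring_def by (metis absv_0 absv_1 mem_Collect_eq order_refl zero_le_one)
  then show ?thesis
    by (simp add: congruence_nhd_def SL2_def)
qed

text \<open>Right translation by such an element moves matrices with lower left entry 0 into the big
  cell.\<close>

lemma lower_in_nhd: "\<exists>y. y \<noteq> 0 \<and> (mat2 1 0 y 1, 1) \<in> congruence_nhd absv l"
proof -
  obtain \<pi> where \<pi>: "uniformizer absv \<pi>" "absv \<pi> = 1 / real (residue_card absv)"
    using normalized by blast
  note p = uniformizer_props[OF \<pi>(1)]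
  have "absv \<pi> ^ l \<le> 1"
    using p(2,3) by (intro power_le_one) simp_all
  then have "(mat2 1 0 (\<pi> ^ l) 1, 1) \<in> congruence_nhd absv l"
    using \<pi>(2) p(2)
    by (simp add: congruence_nhd_def mat2_SL2 forall_2 int_ring_def absv_power mat_1_eq_mat2 del: One_nat_def)
  then show ?thesis
    using p(1) by (metis power_not_zero)
qed

section \<open>Hilbert symbols in the presence of a genuine representation\<close>

context
  fixes \<iota> :: "'f \<Rightarrow> complex"
    and sc :: "complex \<Rightarrow> 'v::ab_group_add \<Rightarrow> 'v"
    and \<sigma> :: "'f cover_elt \<Rightarrow> 'v \<Rightarrow> 'v"
  assumes emb: "unity_embedding n \<iota>"
    and gsi: "genuine_smooth_irreducible absv n \<iota> sc \<sigma>"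
begin

lemma vs: "vector_space sc"
  using gsi by (simp add: genuine_smooth_irreducible_def)

lemma \<sigma>_linear: "t \<in> torus n \<Longrightarrow> Vector_Spaces.linear sc sc (\<sigma> t)"
  using gsi by (simp add: genuine_smooth_irreducible_def)

lemma \<sigma>_mult: "t \<in> torus n \<Longrightarrow> t' \<in> torus n \<Longrightarrow> \<sigma> (t \<odot> t') v = \<sigma> t (\<sigma> t' v)"
  using gsi by (simp add: genuine_smooth_irreducible_def)

lemma \<sigma>_genuine: "\<epsilon> \<in> roots_of_unity n \<Longrightarrow> \<sigma> (torus_elt 1 \<epsilon>) v = sc (\<iota> \<epsilon>) v"
  using gsi by (simp add: genuine_smooth_irreducible_def torus_elt_1)

text \<open>The identity lies in every congruence neighborhood, so smoothness makes it fix each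
  vector.\<close>

lemma \<sigma>_one: "\<sigma> (torus_elt 1 1) v = v"
proof -
  have "\<exists>l. \<forall>t\<in>torus n \<inter> congruence_nhd absv l. \<sigma> t v = v"
    using gsi[unfolded genuine_smooth_irreducible_def] by (elim conjE) (erule spec)
  then obtain l where "\<forall>t\<in>torus n \<inter> congruence_nhd absv l. \<sigma> t v = v"
    by blast
  then show ?thesis
    using identity_in_nhd[of l] torus_eltI[of 1 1 n] unfolding torus_elt_1 by auto
qed

text \<open>\<open>unity_embedding\<close> by itself admits \<open>\<iota> 1 = 0\<close> when n = 1;
  the identity acting trivially on a nonzero space excludes this.\<close>

lemma \<iota>_nonzero:
  assumes "\<epsilon> \<in> roots_of_unity n"
  shows "\<iota> \<epsilon> \<noteq> 0"
proof -
  have "\<exists>v::'v. v \<noteq> 0"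
    using gsi by (simp only: genuine_smooth_irreducible_def)
  then obtain v :: 'v where v: "v \<noteq> 0" ..
  interpret vector_space sc
    by (rule vs)
  have "sc (\<iota> 1) v = v"
    using \<sigma>_one[of v] \<sigma>_genuine[of 1 v] by simp
  then have "\<iota> 1 \<noteq> 0"
    using v by (metis scale_zero_left)
  moreover have "\<iota> (\<epsilon> * inverse \<epsilon>) = \<iota> \<epsilon> * \<iota> (inverse \<epsilon>)"
    using emb assms roots_of_unity_inverse unfolding unity_embedding_def by blast
  ultimately show ?thesis
    using root_nonzero[OF assms] by auto
qed

text \<open>Without an Artin map, all Hilbert symbols are the same unspecified value.\<close>

lemma \<sigma>_injective:
  assumes t: "t \<in> torus n" and 0: "\<sigma> t v = 0"
  shows "v = 0"
proof -
  obtain a \<epsilon> where a: "t = torus_elt a \<epsilon>" "a \<noteq> 0" "\<epsilon> \<in> roots_of_unity n"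
    using t by (auto simp: torus_eq)
  let ?t = "torus_elt (inverse a) 1"
  have t': "?t \<in> torus n"
    using a by (intro torus_eltI) simp_all
  interpret vector_space sc
    by (rule vs)
  interpret lt: Vector_Spaces.linear sc sc "\<sigma> ?t"
    by (rule \<sigma>_linear[OF t'])
  have zero: "\<sigma> (?t \<odot> t) v = 0"
    by (simp add: \<sigma>_mult[OF t' t] 0 lt.zero)
  \<comment> \<open>Up to the central component, \<open>?t\<close> is an inverse of
    \<open>t\<close>; it remains to see that the product acts by a nonzero scalar.\<close>
  have prod: "?t \<odot> t = torus_elt 1 (hs (inverse a) a * \<epsilon>)"
    using a by (simp add: torus_mult)
  show ?thesis
  proof (cases "\<exists>\<theta>. artin_map absv \<theta>")
    case True
    then have "hs (inverse a) (inverse (inverse a)) \<in> roots_of_unity n"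
      using hilbert_symbol_inverse[OF n_pos roots, of _ "inverse a"] a by auto
    then have root: "hs (inverse a) a * \<epsilon> \<in> roots_of_unity n"
      using a by (intro roots_of_unity_mult) simp_all
    show ?thesis
      using zero \<sigma>_genuine[OF root] \<iota>_nonzero[OF root] by (simp add: prod)
  next
    case False
    \<comment> \<open>The symbol may fail to be a root of unity here. As all symbols coincide, the
      product equals that of two central torus elements, and multiplicativity of \<sigma> evaluates
      it.\<close>
    have "?t \<odot> t = torus_elt 1 1 \<odot> torus_elt 1 \<epsilon>"
      using hilbert_symbol_no_artin[OF False] unfolding prod by (simp add: torus_mult) metis
    then have "\<sigma> (?t \<odot> t) v = sc (\<iota> \<epsilon>) v"
      using \<sigma>_mult[of "torus_elt 1 1" "torus_elt 1 \<epsilon>" v] a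
      by (simp add: torus_eltI \<sigma>_one \<sigma>_genuine)
    then show ?thesis
      using zero \<iota>_nonzero a by simp
  qed
qed

text \<open>The support of a nonzero section of the induced representation is stable under left translation
  by \<open>B\<close> and contained in the carrier of the cover. This forces the cocycle, hence the Hilbert
  symbol, to take values in the roots of unity.\<close>

lemma section_imp_symbols:
  assumes f: "f \<in> induced absv n sc (twist absv sc \<sigma> s)" and g: "f g \<noteq> 0"
  shows symbols_in_roots
proof -
  interpret vector_space sc
    by (rule vs)
  have carrier: "g \<in> carrier (cover absv n)" if "f g \<noteq> 0" for g
    using f that unfolding induced_def by blast
  have left: "f (t \<odot> unip x \<odot> g) \<noteq> 0" if t: "t \<in> torus n" and g: "f g \<noteq> 0" for t x g
  proof -
    obtain a \<epsilon> where a: "t = torus_elt a \<epsilon>" "a \<noteq> 0"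
      using t by (auto simp: torus_eq)
    have "f (t \<odot> unip x \<odot> g) = sc (complex_of_real (torus_abs absv t)) (twist absv sc \<sigma> s t (f g))"
      using f t carrier[OF g] unfolding induced_def by blast
    moreover have "\<sigma> t (f g) \<noteq> 0"
      using \<sigma>_injective[OF t] g by blast
    ultimately show ?thesis
      using a absv_eq_0[of a] by (simp add: twist_def)
  qed
  obtain l where l: "\<And>k g. k \<in> congruence_nhd absv l \<Longrightarrow> g \<in> carrier (cover absv n) \<Longrightarrow> f (g \<odot> k) = f g"
    using f unfolding induced_def by blast
  \<comment> \<open>If r = 0, the section is still nonzero after right translation by a small lower
    unipotent element, which makes the lower left entry s y.\<close>
  have "\<exists>p q r s \<epsilon>. r \<noteq> 0 \<and> f (mat2 p q r s, \<epsilon>) \<noteq> 0"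
  proof -
    obtain p q r s \<epsilon> where pq: "g = (mat2 p q r s, \<epsilon>)"
      by (metis mat2_cases prod.collapse)
    show ?thesis
    proof (cases "r = 0")
      case True
      have "mat2 p q r s \<in> SL2"
        using carrier[OF g] by (simp add: cover_carrier pq)
      then have "s \<noteq> 0"
        using True by (auto simp: mat2_SL2)
      obtain y where y: "y \<noteq> 0" "(mat2 1 0 y 1, 1) \<in> congruence_nhd absv l"
        using lower_in_nhd by blast
      have "f (g \<odot> (mat2 1 0 y 1, 1)) \<noteq> 0"
        using l[OF y(2) carrier[OF g]] g by simp
      moreover have "s * y \<noteq> 0"
        using \<open>s \<noteq> 0\<close> y by simp
      ultimately show ?thesis
        unfolding pq cover_mult mat2_mult True
        by (intro exI[of _ "p + q * y"] exI[of _ q] exI[of _ "s * y"] exI[of _ s] exI) (simp add: algebra_simps)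
    next
      case False
      then show ?thesis
        using g pq by blast
    qed
  qed
  then obtain p\<^sub>0 q\<^sub>0 r\<^sub>0 s\<^sub>0 \<epsilon>\<^sub>0 where g\<^sub>0: "r\<^sub>0 \<noteq> 0" "f (mat2 p\<^sub>0 q\<^sub>0 r\<^sub>0 s\<^sub>0, \<epsilon>\<^sub>0) \<noteq> 0"
    by blast
  have prod: "torus_elt a 1 \<odot> unip 0 \<odot> (mat2 p q r s, \<epsilon>) =
      (mat2 (a * p) (a * q) (inverse a * r) (inverse a * s), hs r (inverse a) * hs 1 (inverse a) * \<epsilon>)"
    if "a \<noteq> 0" "r \<noteq> 0" for a p q r s \<epsilon>
  proof -
    have *: "a * (r * inverse a) = r" "r * (inverse a * inverse r) = inverse a"
      using that by simp_all
    show ?thesis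
      using that by (simp add: torus_elt_def unip_def mat2_mult kubota_cocycle_mat2 Let_def mult_ac *)
  qed
  have all: "\<exists>p q s \<epsilon>. f (mat2 p q r s, \<epsilon>) \<noteq> 0" if r: "r \<noteq> 0" for r
  proof -
    have a: "r\<^sub>0 / r \<noteq> 0"
      using r g\<^sub>0 by simp
    have "f (torus_elt (r\<^sub>0 / r) 1 \<odot> unip 0 \<odot> (mat2 p\<^sub>0 q\<^sub>0 r\<^sub>0 s\<^sub>0, \<epsilon>\<^sub>0)) \<noteq> 0"
      using a by (intro left torus_eltI g\<^sub>0) simp_all
    moreover have "inverse (r\<^sub>0 / r) * r\<^sub>0 = r"
      using r g\<^sub>0 by simp
    ultimately show ?thesis
      unfolding prod[OF a g\<^sub>0(1)] by (auto simp del: inverse_divide)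
  qed
  \<comment> \<open>\<open>hs 1 r\<close> is the cocycle of right multiplication by the identity,
    under which the section is invariant; the product therefore stays in the carrier.\<close>
  have one: "hs 1 r \<in> roots_of_unity n" if r: "r \<noteq> 0" for r
  proof -
    obtain p q s \<epsilon> where g: "f (mat2 p q r s, \<epsilon>) \<noteq> 0"
      using all[OF r] by blast
    have "f ((mat2 p q r s, \<epsilon>) \<odot> (mat 1, 1)) \<noteq> 0"
      using l[OF identity_in_nhd carrier[OF g]] g by simp
    then have "(mat2 p q r s, \<epsilon>) \<odot> (mat 1, 1) \<in> carrier (cover absv n)"
      by (rule carrier)
    then have "hs 1 r * \<epsilon> \<in> roots_of_unity n"
      using r by (simp add: cover_carrier mat_1_eq_mat2 kubota_cocycle_mat2 Let_def)
    moreover have "\<epsilon> \<in> roots_of_unity n"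
      using carrier[OF g] by (simp add: cover_carrier)
    ultimately show ?thesis
      by (rule root_cancel)
  qed
  show ?thesis
    unfolding symbols_in_roots_def
  proof (intro allI impI)
    fix r b :: 'f
    assume r: "r \<noteq> 0" and b: "b \<noteq> 0"
    obtain p q s \<epsilon> where g: "f (mat2 p q r s, \<epsilon>) \<noteq> 0"
      using all[OF r] by blast
    have "f (torus_elt (inverse b) 1 \<odot> unip 0 \<odot> (mat2 p q r s, \<epsilon>)) \<noteq> 0"
      using b by (intro left torus_eltI g) simp_all
    then have "torus_elt (inverse b) 1 \<odot> unip 0 \<odot> (mat2 p q r s, \<epsilon>) \<in> carrier (cover absv n)"
      by (rule carrier)
    then have "hs r b * (hs 1 b * \<epsilon>) \<in> roots_of_unity n"
      using prod[of "inverse b" r p q s \<epsilon>] b r by (simp add: cover_carrier mult.assoc)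
    moreover have "\<epsilon> \<in> roots_of_unity n"
      using carrier[OF g] by (simp add: cover_carrier)
    ultimately show "hs r b \<in> roots_of_unity n"
      using root_cancel roots_of_unity_mult one[OF b] by blast
  qed
qed

end

text \<open>The group laws of the cover are not at hand, so the definite description behind the
  inverse is evaluated directly. That the candidate is inverse on both sides amounts to the equality
  of the symbols (1, -1) and (-1, 1).\<close>

lemma weyl_inverse:
  assumes symbols_in_roots
  obtains \<epsilon> where "\<epsilon> \<in> roots_of_unity n" "inv\<^bsub>cover absv n\<^esub> weyl = (mat2 0 (- 1) 1 0, \<epsilon>)"
proof -
  have sym: "hs 1 (- 1) = hs (- 1) 1"
  proof (cases "\<exists>\<theta>. artin_map absv \<theta>")
    case True
    then show ?thesis
      using hilbert_symbol_one_left[OF n_pos roots, of _ "- 1"] hilbert_symbol_one_right[OF n_pos roots, of _ "- 1"]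
      by auto
  next
    case False
    then show ?thesis
      by (rule hilbert_symbol_no_artin)
  qed
  define z where "z = hs (- 1) 1"
  have z: "z \<in> roots_of_unity n"
    using assms unfolding symbols_in_roots_def z_def by (metis neg_equal_0_iff_equal zero_neq_one)
  have "inv\<^bsub>cover absv n\<^esub> weyl = (mat2 0 (- 1) 1 0, inverse z)"
    unfolding m_inv_def
  proof (rule the_equality)
    show "(mat2 0 (- 1) 1 0, inverse z) \<in> carrier (cover absv n) \<and>
        weyl \<odot> (mat2 0 (- 1) 1 0, inverse z) = \<one>\<^bsub>cover absv n\<^esub> \<and>
        (mat2 0 (- 1) 1 0, inverse z) \<odot> weyl = \<one>\<^bsub>cover absv n\<^esub>"
      using root_nonzero[OF z] roots_of_unity_inverse[OF z]
      by (simp add: cover_carrier mat2_SL2 weyl_def mat2_mult kubota_cocycle_mat2 cover_one mat_1_eq_mat2 sym z_def)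
  next
    fix y
    assume y: "y \<in> carrier (cover absv n) \<and> weyl \<odot> y = \<one>\<^bsub>cover absv n\<^esub> \<and> y \<odot> weyl = \<one>\<^bsub>cover absv n\<^esub>"
    obtain a b c d \<epsilon> where y_eq: "y = (mat2 a b c d, \<epsilon>)"
      by (metis mat2_cases prod.collapse)
    have "weyl \<odot> y = \<one>\<^bsub>cover absv n\<^esub>"
      using y by blast
    then have "c = 1" "d = 0" "a = 0" "- b = 1"
      by (simp_all add: y_eq weyl_def mat2_mult cover_one mat_1_eq_mat2 mat2_eq_iff)
    then have "c = 1" "d = 0" "a = 0" "b = - 1"
      by (simp_all add: minus_equation_iff[of b])
    moreover from this have "z * \<epsilon> = 1"
      using \<open>weyl \<odot> y = \<one>\<^bsub>cover absv n\<^esub>\<close>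
      by (simp add: y_eq weyl_def kubota_cocycle_mat2 cover_one z_def)
    ultimately show "y = (mat2 0 (- 1) 1 0, inverse z)"
      by (simp add: y_eq inverse_unique)
  qed
  then show thesis
    using that roots_of_unity_inverse[OF z] by blast
qed

lemma weyl_conj_torus:
  assumes symbols_in_roots and t: "t \<in> torus n"
  shows "weyl \<odot> t \<odot> inv\<^bsub>cover absv n\<^esub> weyl \<in> torus n"
proof -
  have hs: "hs a b \<in> roots_of_unity n" if "a \<noteq> 0" "b \<noteq> 0" for a b
    using assms(1) that by (simp add: symbols_in_roots_def)
  obtain \<epsilon>' where \<epsilon>': "\<epsilon>' \<in> roots_of_unity n" "inv\<^bsub>cover absv n\<^esub> weyl = (mat2 0 (- 1) 1 0, \<epsilon>')"
    by (rule weyl_inverse[OF assms(1)])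
  obtain a \<epsilon> where a: "t = torus_elt a \<epsilon>" "a \<noteq> 0" "\<epsilon> \<in> roots_of_unity n"
    using t by (auto simp: torus_eq)
  define \<delta> where "\<delta> = kubota_cocycle absv n (mat2 0 (inverse a) (- a) 0) (mat2 0 (- 1) 1 0) *
    (kubota_cocycle absv n (mat2 0 1 (- 1) 0) (mat2 a 0 0 (inverse a)) * 1 * \<epsilon>) * \<epsilon>'"
  have "\<delta> \<in> roots_of_unity n"
    unfolding \<delta>_def using a \<epsilon>' by (intro roots_of_unity_mult) (auto simp: kubota_cocycle_mat2 Let_def intro!: hs)
  moreover have "weyl \<odot> t \<odot> inv\<^bsub>cover absv n\<^esub> weyl = torus_elt (inverse a) \<delta>"
    unfolding \<epsilon>'(2) by (simp add: a(1) torus_elt_def weyl_def mat2_mult \<delta>_def)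
  ultimately show ?thesis
    using a(2) by (simp add: torus_eltI)
qed

end


section \<open>Transport along an isomorphism\<close>

subsection \<open>Meromorphic continuation of integrals\<close>

lemma meromorphic_zero_on_half_plane:
  assumes mero: "h meromorphic_on UNIV" and an: "h analytic_on {z\<^sub>0}" and zero: "\<And>z. Re z > c \<Longrightarrow> h z = 0"
  shows "h z\<^sub>0 = 0"
proof -
  define w where "w = complex_of_real (c + 1)"
  have "open {z. Re z > c}"
    by (rule open_halfspace_Re_gt)
  then have "eventually (\<lambda>z. z \<in> {z. Re z > c}) (at w)"
    by (intro eventually_at_in_open') (simp_all add: w_def)
  then have w: "eventually (\<lambda>z. h z = 0) (at w)"
    by (rule eventually_mono) (simp add: zero)
  have "\<not> eventually (\<lambda>z. h z \<noteq> 0) (cosparse UNIV)"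
  proof
    assume "eventually (\<lambda>z. h z \<noteq> 0) (cosparse UNIV)"
    then have "eventually (\<lambda>z. h z \<noteq> 0) (at w)"
      by (simp add: eventually_cosparse_open_eq)
    with w have "eventually (\<lambda>z. False) (at w)"
      by eventually_elim simp
    then show False
      by simp
  qed
  then have "eventually (\<lambda>z. h z = 0) (cosparse UNIV)"
    using meromorphic_imp_constant_or_avoid[OF mero, of 0] by auto
  then have "eventually (\<lambda>z. h z = 0) (at z\<^sub>0)"
    by (simp add: eventually_cosparse_open_eq)
  then have "(h \<longlongrightarrow> 0) (at z\<^sub>0)"
    by (rule tendsto_eventually)
  moreover have "(h \<longlongrightarrow> h z\<^sub>0) (at z\<^sub>0)"
    using analytic_at_imp_isCont[OF an] by (simp add: isCont_def)
  ultimately show ?thesis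
    using tendsto_unique[of "at z\<^sub>0" h 0 "h z\<^sub>0"] by simp
qed

lemma continued_integral_unique:
  assumes "continued_integral \<mu> \<Phi> z\<^sub>0 y" "continued_integral \<mu> \<Phi> z\<^sub>0 y'"
  shows "y = y'"
proof -
  obtain h c where h: "h meromorphic_on UNIV" "h analytic_on {z\<^sub>0}" "y = h z\<^sub>0"
      "\<And>z. Re z > c \<Longrightarrow> h z = (\<integral>x. \<Phi> z x \<partial>\<mu>)"
    using assms(1) unfolding continued_integral_def by blast
  obtain h' c' where h': "h' meromorphic_on UNIV" "h' analytic_on {z\<^sub>0}" "y' = h' z\<^sub>0"
      "\<And>z. Re z > c' \<Longrightarrow> h' z = (\<integral>x. \<Phi> z x \<partial>\<mu>)"
    using assms(2) unfolding continued_integral_def by blast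
  have "h z\<^sub>0 - h' z\<^sub>0 = 0"
  proof (rule meromorphic_zero_on_half_plane[where h = "\<lambda>z. h z - h' z" and c = "max c c'"])
    show "(\<lambda>z. h z - h' z) meromorphic_on UNIV"
      by (intro meromorphic_intros h h')
    show "(\<lambda>z. h z - h' z) analytic_on {z\<^sub>0}"
      by (intro analytic_on_diff h h')
  qed (simp add: h h')
  then show ?thesis
    by (simp add: h h')
qed

lemma continued_integral_sum:
  fixes \<Phi> :: "'i::finite \<Rightarrow> complex \<Rightarrow> 'f::field_char_0 \<Rightarrow> complex"
  assumes "\<And>i. continued_integral \<mu> (\<Phi> i) z\<^sub>0 (y i)"
  shows "continued_integral \<mu> (\<lambda>z x. \<Sum>i\<in>UNIV. k i * \<Phi> i z x) z\<^sub>0 (\<Sum>i\<in>UNIV. k i * y i)"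
proof -
  have "\<forall>i. \<exists>h c. h meromorphic_on UNIV \<and> h analytic_on {z\<^sub>0} \<and>
        (\<forall>z. Re z > c \<longrightarrow> integrable \<mu> (\<Phi> i z) \<and> h z = (\<integral>x. \<Phi> i z x \<partial>\<mu>)) \<and> y i = h z\<^sub>0"
    using assms unfolding continued_integral_def by blast
  then obtain h c where h: "\<And>i. h i meromorphic_on UNIV" "\<And>i. h i analytic_on {z\<^sub>0}" "\<And>i. y i = h i z\<^sub>0"
    and c: "\<And>i z. Re z > c i \<Longrightarrow> integrable \<mu> (\<Phi> i z)" "\<And>i z. Re z > c i \<Longrightarrow> h i z = (\<integral>x. \<Phi> i z x \<partial>\<mu>)"
    by metis
  have le: "c i \<le> Max (range c)" for i
    by (rule Max_ge) simp_all
  show ?thesis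
    unfolding continued_integral_def
  proof (intro exI conjI allI impI)
    show "(\<lambda>z. \<Sum>i\<in>UNIV. k i * h i z) meromorphic_on UNIV"
      by (intro meromorphic_intros h)
    show "(\<lambda>z. \<Sum>i\<in>UNIV. k i * h i z) analytic_on {z\<^sub>0}"
      by (intro analytic_on_sum analytic_on_mult analytic_on_const h)
    fix z
    assume "Re z > Max (range c)"
    then have z: "Re z > c i" for i
      using le[of i] by linarith
    show "integrable \<mu> (\<lambda>x. \<Sum>i\<in>UNIV. k i * \<Phi> i z x)"
      by (intro Bochner_Integration.integrable_sum integrable_mult_right c z)
    show "(\<Sum>i\<in>UNIV. k i * h i z) = (\<integral>x. (\<Sum>i\<in>UNIV. k i * \<Phi> i z x) \<partial>\<mu>)"
      by (subst Bochner_Integration.integral_sum) (simp_all add: c z)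
  qed (simp add: h)
qed


subsection \<open>Bases and matrices\<close>

text \<open>\<open>indexed_basis\<close> gives unique coordinates to elements of \<open>S\<close>,
  and \<open>S\<close> is not known to contain sums. Hence the relation with coefficients c - d is
  added to the trivial expansion of the element \<open>b i\<^sub>0\<close> of
  \<open>S\<close>.\<close>

lemma indexed_basis_coeffs_unique:
  fixes b :: "'i::finite \<Rightarrow> 'a \<Rightarrow> complex"
  assumes b: "indexed_basis S b" and eq: "\<And>a. (\<Sum>i\<in>UNIV. c i * b i a) = (\<Sum>i\<in>UNIV. d i * b i a)"
  shows "c = d"
proof -
  fix i\<^sub>0 :: 'i
  define \<delta> where "\<delta> i = (if i = i\<^sub>0 then 1 else 0 :: complex)" for i
  have \<delta>: "b i\<^sub>0 = (\<lambda>a. \<Sum>i\<in>UNIV. \<delta> i * b i a)"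
    by (simp add: \<delta>_def if_distrib[of "\<lambda>x. x * _"] cong: if_cong)
  have "b i\<^sub>0 = (\<lambda>a. \<Sum>i\<in>UNIV. (\<delta> i + (c i - d i)) * b i a)"
    by (subst \<delta>) (simp add: distrib_right left_diff_distrib sum.distrib sum_subtractf eq)
  moreover have "\<exists>!e. b i\<^sub>0 = (\<lambda>a. \<Sum>i\<in>UNIV. e i * b i a)"
    using b unfolding indexed_basis_def by blast
  then obtain e where e: "\<And>e'. b i\<^sub>0 = (\<lambda>a. \<Sum>i\<in>UNIV. e' i * b i a) \<Longrightarrow> e' = e"
    by (elim ex1E) blast
  ultimately have "(\<lambda>i. \<delta> i + (c i - d i)) = e"
    by (intro e)
  also have "e = \<delta>"
    using e[OF \<delta>] ..
  finally have "(\<lambda>i. \<delta> i + (c i - d i)) = \<delta>" .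
  then show ?thesis
    by (simp add: fun_eq_iff)
qed

lemma indexed_basis_expand:
  assumes "indexed_basis S b" "x \<in> S"
  obtains c where "\<And>a. x a = (\<Sum>i\<in>UNIV. c i * b i a)"
proof -
  obtain c where "x = (\<lambda>a. \<Sum>i\<in>UNIV. c i * b i a)"
    using assms unfolding indexed_basis_def by blast
  then show thesis
    using that by simp
qed

lemma matrix_inv_eqI:
  fixes P :: "complex ^ 'i ^ 'i::finite"
  assumes "P ** Q = mat 1"
  shows "matrix_inv P = Q"
proof -
  have "P ** Q = mat 1 \<and> Q ** P = mat 1"
    using assms matrix_left_right_inverse by blast
  then have "P ** matrix_inv P = mat 1 \<and> matrix_inv P ** P = mat 1"
    unfolding matrix_inv_def by (rule someI)
  then have "matrix_inv P = matrix_inv P ** (P ** Q)"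
    by (simp add: assms)
  also have "\<dots> = Q"
    using \<open>P ** matrix_inv P = mat 1 \<and> matrix_inv P ** P = mat 1\<close> by (simp add: matrix_mul_assoc)
  finally show ?thesis .
qed

lemma conjugate_iff:
  "conjugate_matrix_functions M M' \<longleftrightarrow>
    (\<exists>P Q. P ** Q = mat 1 \<and> Q ** P = mat 1 \<and> (\<forall>s. M' s = Q ** M s ** P))"
  unfolding conjugate_matrix_functions_def invertible_def by (metis matrix_inv_eqI)

lemma conjugate_sym:
  assumes "conjugate_matrix_functions M M'"
  shows "conjugate_matrix_functions M' M"
proof -
  obtain P Q where PQ: "P ** Q = mat 1" "Q ** P = mat 1" "\<And>s. M' s = Q ** M s ** P"
    using assms unfolding conjugate_iff by blast
  have "P ** M' s ** Q = (P ** Q) ** M s ** (P ** Q)" for s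
    unfolding PQ(3) by (simp only: matrix_mul_assoc)
  then have "M s = P ** M' s ** Q" for s
    by (simp add: PQ(1))
  then show ?thesis
    unfolding conjugate_iff using PQ by blast
qed

lemma conjugate_trans:
  assumes "conjugate_matrix_functions M M'" "conjugate_matrix_functions M' M''"
  shows "conjugate_matrix_functions M M''"
proof -
  obtain P Q where PQ: "P ** Q = mat 1" "Q ** P = mat 1" "\<And>s. M' s = Q ** M s ** P"
    using assms(1) unfolding conjugate_iff by blast
  obtain P' Q' where PQ': "P' ** Q' = mat 1" "Q' ** P' = mat 1" "\<And>s. M'' s = Q' ** M' s ** P'"
    using assms(2) unfolding conjugate_iff by blast
  have "(P ** P') ** (Q' ** Q) = P ** (P' ** Q') ** Q" "(Q' ** Q) ** (P ** P') = Q' ** (Q ** P) ** P'"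
    by (simp_all only: matrix_mul_assoc)
  then have "(P ** P') ** (Q' ** Q) = mat 1" "(Q' ** Q) ** (P ** P') = mat 1"
    by (simp_all add: PQ PQ')
  moreover have "M'' s = (Q' ** Q) ** M s ** (P ** P')" for s
    unfolding PQ'(3) PQ(3) by (simp only: matrix_mul_assoc)
  ultimately show ?thesis
    unfolding conjugate_iff by blast
qed

lemma conjugacy_class_eq:
  assumes "conjugate_matrix_functions M M'"
  shows "conjugacy_class M = conjugacy_class M'"
  using assms conjugate_sym conjugate_trans unfolding conjugacy_class_def by blast


subsection \<open>Linear isomorphisms\<close>

text \<open>Vector-valued integrals are defined through functionals; this makes their values
  unique.\<close>

lemma dual_separates:
  fixes sc :: "complex \<Rightarrow> 'v::ab_group_add \<Rightarrow> 'v"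
  assumes "vector_space sc" and "v \<noteq> w"
  obtains \<xi> where "\<xi> \<in> dual sc" "\<xi> v \<noteq> \<xi> w"
proof -
  interpret vector_space_pair sc "(*) :: complex \<Rightarrow> complex \<Rightarrow> complex"
    using assms(1) by (simp add: vector_space_pair_def vector_space_over_itself.vector_space_axioms)
  have "vs1.independent {v - w}"
    using assms(2) by (simp add: vs1.dependent_single)
  then obtain \<xi> where \<xi>: "Vector_Spaces.linear sc (*) \<xi>" "\<xi> (v - w) = 1"
    using linear_independent_extend[of "{v - w}" "\<lambda>_. 1"] by auto
  then have "\<xi> v = \<xi> (v - w) + \<xi> w"
    unfolding Vector_Spaces.linear_iff by (metis diff_add_cancel)
  then show thesis
    using that[of \<xi>] \<xi> by (simp add: dual_def)
qed

context kubota
begin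

context
  fixes sc :: "complex \<Rightarrow> 'v::ab_group_add \<Rightarrow> 'v" and sc' :: "complex \<Rightarrow> 'u::ab_group_add \<Rightarrow> 'u"
    and T :: "'v \<Rightarrow> 'u"
  assumes T: "Vector_Spaces.linear sc sc' T" "bij T"
begin

lemma T_scale: "T (sc c v) = sc' c (T v)" and T_add: "T (v + w) = T v + T w"
  using T(1) by (simp_all add: Vector_Spaces.linear_iff)

lemma T_zero: "T 0 = 0"
  using T_add[of 0 0] by simp

lemma inv_T: "Vector_Spaces.linear sc' sc (inv_into UNIV T)" "bij (inv_into UNIV T)" "inv_into UNIV T (T v) = v" "T (inv_into UNIV T u) = u"
proof -
  show inv: "inv_into UNIV T (T v) = v" "T (inv_into UNIV T u) = u" for v u
    using T(2) by (simp_all add: bij_is_inj bij_is_surj surj_f_inv_f)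
  show "bij (inv_into UNIV T)"
    using T(2) by (rule bij_imp_bij_inv)
  have "inv_into UNIV T (u + u') = inv_into UNIV T u + inv_into UNIV T u'" "inv_into UNIV T (sc' c u) = sc c (inv_into UNIV T u)" for u u' c
    using T_add[of "inv_into UNIV T u" "inv_into UNIV T u'"] T_scale[of c "inv_into UNIV T u"] inv by metis+
  then show "Vector_Spaces.linear sc' sc (inv_into UNIV T)"
    using T(1) by (simp add: Vector_Spaces.linear_iff)
qed

lemma dual_transport: "\<xi> \<in> dual sc' \<Longrightarrow> (\<lambda>v. \<xi> (T v)) \<in> dual sc"
  using T(1) by (auto simp: dual_def Vector_Spaces.linear_iff)

lemma flat_section_transport:
  "flat_section absv n sc' z (\<lambda>g. T (f g)) g = T (flat_section absv n sc z f g)"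
  by (simp add: flat_section_def T_scale)

lemma intertwining_value_transport:
  assumes "intertwining_value absv n \<mu> sc f g v"
  shows "intertwining_value absv n \<mu> sc' (\<lambda>g. T (f g)) g (T v)"
  unfolding intertwining_value_def flat_section_transport
proof
  fix \<xi>
  assume "\<xi> \<in> dual sc'"
  then have "(\<lambda>v. \<xi> (T v)) \<in> dual sc"
    by (rule dual_transport)
  with assms show "continued_integral \<mu> (\<lambda>z x. \<xi> (T (flat_section absv n sc z f (weyl \<odot> unip x \<odot> g)))) 0 (\<xi> (T v))"
    unfolding intertwining_value_def by (rule bspec[where x = "\<lambda>v. \<xi> (T v)"])
qed

lemma jacquet_value_transport:
  "jacquet_value absv n \<psi> \<mu> sc' \<xi> (\<lambda>g. T (f g)) y \<longleftrightarrow> jacquet_value absv n \<psi> \<mu> sc (\<lambda>v. \<xi> (T v)) f y"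
  by (simp add: jacquet_value_def flat_section_transport)

lemma induced_transport:
  assumes \<tau>: "\<And>t v. t \<in> torus n \<Longrightarrow> T (\<tau> t v) = \<tau>' t (T v)" and f: "f \<in> induced absv n sc \<tau>"
  shows "(\<lambda>g. T (f g)) \<in> induced absv n sc' \<tau>'"
proof -
  obtain l where l: "\<forall>k\<in>congruence_nhd absv l. \<forall>g\<in>carrier (cover absv n). f (g \<odot> k) = f g"
    using f unfolding induced_def by blast
  have "\<forall>t\<in>torus n. \<forall>x. \<forall>g\<in>carrier (cover absv n).
      T (f (t \<odot> unip x \<odot> g)) = sc' (complex_of_real (torus_abs absv t)) (\<tau>' t (T (f g)))"
    using f by (simp add: induced_def T_scale \<tau>)
  moreover have "\<exists>l. \<forall>k\<in>congruence_nhd absv l. \<forall>g\<in>carrier (cover absv n). T (f (g \<odot> k)) = T (f g)"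
    using l by (intro exI[of _ l]) simp
  moreover have "\<forall>g. g \<notin> carrier (cover absv n) \<longrightarrow> T (f g) = 0"
    using f by (simp add: induced_def T_zero)
  ultimately show ?thesis
    unfolding induced_def by blast
qed

end

section \<open>Transport in both directions, by T and by its inverse\<close>

context
  fixes sc :: "complex \<Rightarrow> 'v::ab_group_add \<Rightarrow> 'v" and sc' :: "complex \<Rightarrow> 'u::ab_group_add \<Rightarrow> 'u"
    and T :: "'v \<Rightarrow> 'u"
  assumes T: "Vector_Spaces.linear sc sc' T" "bij T"
begin

lemma vs_T: "vector_space sc" "vector_space sc'"
  using T(1) by (simp_all add: Vector_Spaces.linear_iff)

lemma intertwining_value_unique:
  assumes "intertwining_value absv n \<mu> sc f g v" "intertwining_value absv n \<mu> sc f g w"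
  shows "v = w"
proof (rule ccontr)
  assume "v \<noteq> w"
  then obtain \<xi> where "\<xi> \<in> dual sc" "\<xi> v \<noteq> \<xi> w"
    using dual_separates vs_T by blast
  then show False
    using assms continued_integral_unique unfolding intertwining_value_def by blast
qed

lemma intertwining_value_inv_transport:
  assumes "intertwining_value absv n \<mu> sc' (\<lambda>g. T (f g)) g u"
  shows "intertwining_value absv n \<mu> sc f g (inv_into UNIV T u)"
  using intertwining_value_transport[OF inv_T(1,2)[OF T] assms] by (simp add: inv_T[OF T])

text \<open>Existence of a value matters: a definite description without a witness is unspecified
  and would not be carried over by T.\<close>

lemma intertwining_transport:
  assumes v: "g \<in> carrier (cover absv n) \<Longrightarrow> \<exists>v. intertwining_value absv n \<mu> sc f g v"
  shows "intertwining absv n \<mu> sc' (\<lambda>g. T (f g)) g = T (intertwining absv n \<mu> sc f g)"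
proof (cases "g \<in> carrier (cover absv n)")
  case True
  then obtain v where v: "intertwining_value absv n \<mu> sc f g v"
    using assms by blast
  then have "(THE v. intertwining_value absv n \<mu> sc f g v) = v"
    using intertwining_value_unique by blast
  moreover have "(THE u. intertwining_value absv n \<mu> sc' (\<lambda>g. T (f g)) g u) = T v"
  proof (rule the_equality)
    show "intertwining_value absv n \<mu> sc' (\<lambda>g. T (f g)) g (T v)"
      by (rule intertwining_value_transport[OF T v])
    fix u
    assume "intertwining_value absv n \<mu> sc' (\<lambda>g. T (f g)) g u"
    then have "inv_into UNIV T u = v"
      using intertwining_value_inv_transport intertwining_value_unique v by blast
    then show "u = T v"
      using inv_T(4)[OF T] by metis
  qed
  ultimately show ?thesis
    using True by (simp add: intertwining_def)
qed (simp add: intertwining_def T_zero[OF T])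

context
  fixes \<tau> :: "'f cover_elt \<Rightarrow> 'v \<Rightarrow> 'v" and \<tau>' :: "'f cover_elt \<Rightarrow> 'u \<Rightarrow> 'u"
  assumes \<tau>: "\<And>t v. t \<in> torus n \<Longrightarrow> T (\<tau> t v) = \<tau>' t (T v)"
begin

lemma inv_\<tau>: "t \<in> torus n \<Longrightarrow> inv_into UNIV T (\<tau>' t u) = \<tau> t (inv_into UNIV T u)"
  using \<tau>[of t "inv_into UNIV T u"] inv_T[OF T] by metis

lemma induced_transport_iff:
  "(\<lambda>g. T (f g)) \<in> induced absv n sc' \<tau>' \<longleftrightarrow> f \<in> induced absv n sc \<tau>"
proof
  assume "(\<lambda>g. T (f g)) \<in> induced absv n sc' \<tau>'"
  then have "(\<lambda>g. inv_into UNIV T (T (f g))) \<in> induced absv n sc \<tau>"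
    using induced_transport[OF inv_T(1,2)[OF T], of \<tau>' \<tau> "\<lambda>g. T (f g)"] inv_\<tau> by simp
  then show "f \<in> induced absv n sc \<tau>"
    by (simp add: inv_T[OF T])
next
  assume "f \<in> induced absv n sc \<tau>"
  then show "(\<lambda>g. T (f g)) \<in> induced absv n sc' \<tau>'"
    using induced_transport[OF T, of \<tau> \<tau>' f] \<tau> by simp
qed

text \<open>The value is a complex number on both sides, so the two definite descriptions are over
  one and the same predicate.\<close>

lemma jacquet_transport:
  "jacquet absv n \<psi> \<mu> sc' \<tau>' \<xi> (\<lambda>g. T (f g)) = jacquet absv n \<psi> \<mu> sc \<tau> (\<lambda>v. \<xi> (T v)) f"
proof -
  have "jacquet_value absv n \<psi> \<mu> sc' \<xi> (\<lambda>g. T (f g)) = jacquet_value absv n \<psi> \<mu> sc (\<lambda>v. \<xi> (T v)) f"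
    by (rule ext) (rule jacquet_value_transport[OF T])
  then show ?thesis
    by (simp add: jacquet_def induced_transport_iff)
qed

lemma intertwining_regular_transport:
  assumes "intertwining_regular absv n \<mu> sc \<tau>"
  shows "intertwining_regular absv n \<mu> sc' \<tau>'"
  unfolding intertwining_regular_def
proof (intro ballI)
  fix f' g
  assume f': "f' \<in> induced absv n sc' \<tau>'" and g: "g \<in> carrier (cover absv n)"
  define f where "f = (\<lambda>g. inv_into UNIV T (f' g))"
  have f: "f' = (\<lambda>g. T (f g))"
    by (simp add: f_def inv_T[OF T])
  then obtain v where "intertwining_value absv n \<mu> sc f g v"
    using assms f' g unfolding intertwining_regular_def by (auto simp: induced_transport_iff)
  then show "\<exists>v. intertwining_value absv n \<mu> sc' f' g v"
    unfolding f using intertwining_value_transport[OF T] by blast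
qed

lemma jacquet_regular_transport:
  assumes "jacquet_regular absv n \<psi> \<mu> sc \<tau>"
  shows "jacquet_regular absv n \<psi> \<mu> sc' \<tau>'"
  unfolding jacquet_regular_def
proof (intro ballI)
  fix f' \<xi>
  assume f': "f' \<in> induced absv n sc' \<tau>'" and \<xi>: "\<xi> \<in> dual sc'"
  define f where "f = (\<lambda>g. inv_into UNIV T (f' g))"
  have f: "f' = (\<lambda>g. T (f g))"
    by (simp add: f_def inv_T[OF T])
  have "f \<in> induced absv n sc \<tau>"
    using f' f by (simp add: induced_transport_iff)
  then show "\<exists>y. jacquet_value absv n \<psi> \<mu> sc' \<xi> f' y"
    using assms dual_transport[OF T \<xi>] unfolding jacquet_regular_def f jacquet_value_transport[OF T] by blast
qed

end

end

text \<open>Regularity supplies a value for each \<open>R k\<close>; a linear combination of these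
  values is then a value for the combined functional, and values are unique.\<close>

lemma jacquet_sum:
  fixes R :: "'i::finite \<Rightarrow> 'v::ab_group_add \<Rightarrow> complex"
  assumes reg: "jacquet_regular absv n \<psi> \<mu> sc \<tau>" and R: "\<And>k. R k \<in> dual sc"
  shows "jacquet absv n \<psi> \<mu> sc \<tau> (\<lambda>v. \<Sum>k\<in>UNIV. c k * R k v) f = (\<Sum>k\<in>UNIV. c k * jacquet absv n \<psi> \<mu> sc \<tau> (R k) f)"
proof (cases "f \<in> induced absv n sc \<tau>")
  case True
  have the: "(THE y. jacquet_value absv n \<psi> \<mu> sc \<xi> f y) = y" if "jacquet_value absv n \<psi> \<mu> sc \<xi> f y" for \<xi> y
    using that continued_integral_unique unfolding jacquet_value_def by blast
  have "\<forall>k. \<exists>y. jacquet_value absv n \<psi> \<mu> sc (R k) f y"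
    using reg R True unfolding jacquet_regular_def by blast
  then obtain y where y: "\<And>k. jacquet_value absv n \<psi> \<mu> sc (R k) f (y k)"
    by metis
  have "jacquet_value absv n \<psi> \<mu> sc (\<lambda>v. \<Sum>k\<in>UNIV. c k * R k v) f (\<Sum>k\<in>UNIV. c k * y k)"
    using continued_integral_sum[OF y[unfolded jacquet_value_def], of c]
    unfolding jacquet_value_def by (simp add: sum_distrib_right mult.assoc)
  then show ?thesis
    unfolding jacquet_def if_P[OF True] the[OF y] by (rule the)
qed (simp add: jacquet_def)


subsection \<open>Local coefficients matrices\<close>

text \<open>On a zero representation space there is no nonempty basis of Whittaker functionals.\<close>

lemma slcm_domain_imp_symbols:
  fixes \<sigma> :: "'f cover_elt \<Rightarrow> 'v::ab_group_add \<Rightarrow> 'v" and R :: "'i::finite \<Rightarrow> 'v \<Rightarrow> complex"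
  assumes emb: "unity_embedding n \<iota>" and gsi: "genuine_smooth_irreducible absv n \<iota> sc \<sigma>"
    and M: "slcm_wrt absv n \<psi> \<mu> sc \<sigma> R M" and s: "s \<in> slcm_domain absv n \<psi> \<mu> sc \<sigma>"
  shows symbols_in_roots
proof -
  interpret vector_space sc
    using gsi by (simp add: genuine_smooth_irreducible_def)
  let ?\<tau> = "twist absv sc \<sigma> s"
  define b where "b = (\<lambda>i. jacquet absv n \<psi> \<mu> sc ?\<tau> (R i))"
  have b: "indexed_basis (whittaker absv n \<psi> sc ?\<tau>) b"
    using M s unfolding slcm_wrt_def represents_def b_def by blast
  have "\<exists>f\<in>induced absv n sc ?\<tau>. \<exists>g. f g \<noteq> 0"
  proof (rule ccontr)
    assume "\<not> (\<exists>f\<in>induced absv n sc ?\<tau>. \<exists>g. f g \<noteq> 0)"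
    then have zero: "f = (\<lambda>_. 0)" if "f \<in> induced absv n sc ?\<tau>" for f
      using that by auto
    have "b i f = 0" for i f
    proof -
      have L: "b i \<in> whittaker absv n \<psi> sc ?\<tau>"
        using b by (simp add: indexed_basis_def)
      show ?thesis
      proof (cases "f \<in> induced absv n sc ?\<tau>")
        case True
        then have "b i (\<lambda>g. sc 0 (f g)) = 0 * b i f"
          using L unfolding whittaker_def by blast
        then show ?thesis
          using zero[OF True] by simp
      next
        case False
        then show ?thesis
          using L unfolding whittaker_def by blast
      qed
    qed
    \<comment> \<open>With all basis elements zero, the coefficient families 0 and 1 give the same
      sum, and the index type is nonempty.\<close>
    then have "(\<lambda>i. 0) = (\<lambda>i::'i. 1 :: complex)"
      by (intro indexed_basis_coeffs_unique[OF b]) simp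
    then show False
      by (simp add: fun_eq_iff)
  qed
  then show ?thesis
    using section_imp_symbols[OF emb gsi] by blast
qed

lemma slcm_domain_transport:
  fixes \<sigma> :: "'f cover_elt \<Rightarrow> 'v::ab_group_add \<Rightarrow> 'v" and \<sigma>' :: "'f cover_elt \<Rightarrow> 'u::ab_group_add \<Rightarrow> 'u"
  assumes T: "Vector_Spaces.linear sc sc' T" "bij T" and \<sigma>: "\<And>t v. t \<in> torus n \<Longrightarrow> T (\<sigma> t v) = \<sigma>' t (T v)"
    and symbols_in_roots and s: "s \<in> slcm_domain absv n \<psi> \<mu> sc \<sigma>"
  shows "s \<in> slcm_domain absv n \<psi> \<mu> sc' \<sigma>'"
proof -
  let ?\<tau> = "twist absv sc \<sigma> s" and ?\<tau>' = "twist absv sc' \<sigma>' s"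
  have \<tau>: "T (twist absv sc \<sigma> s t v) = twist absv sc' \<sigma>' s t (T v)" if "t \<in> torus n" for t v
    using that by (simp add: twist_def T_scale[OF T] \<sigma>)
  have w: "T (weyl_conj absv n (twist absv sc \<sigma> s) t v) = weyl_conj absv n (twist absv sc' \<sigma>' s) t (T v)"
    if "t \<in> torus n" for t v
    using weyl_conj_torus[OF assms(4) that] by (simp add: weyl_conj_def \<tau>)
  have "intertwining_regular absv n \<mu> sc (twist absv sc \<sigma> s)" "jacquet_regular absv n \<psi> \<mu> sc (twist absv sc \<sigma> s)"
    "jacquet_regular absv n \<psi> \<mu> sc (weyl_conj absv n (twist absv sc \<sigma> s))"
    using s by (simp_all add: slcm_domain_def)
  then show ?thesis
    unfolding slcm_domain_def
    by (intro CollectI conjI intertwining_regular_transport[OF T, of ?\<tau> ?\<tau>', OF \<tau>] jacquet_regular_transport[OF T, of ?\<tau> ?\<tau>', OF \<tau>]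
        jacquet_regular_transport[OF T, of "weyl_conj absv n ?\<tau>" "weyl_conj absv n ?\<tau>'", OF w])
qed

lemma slcm_conjugate:
  fixes \<sigma> :: "'f cover_elt \<Rightarrow> 'v::ab_group_add \<Rightarrow> 'v" and \<sigma>' :: "'f cover_elt \<Rightarrow> 'u::ab_group_add \<Rightarrow> 'u"
    and M M' :: "complex \<Rightarrow> complex ^ 'i::finite ^ 'i"
  assumes emb: "unity_embedding n \<iota>"
    and gsi: "genuine_smooth_irreducible absv n \<iota> sc \<sigma>" "genuine_smooth_irreducible absv n \<iota> sc' \<sigma>'"
    and T: "Vector_Spaces.linear sc sc' T" "bij T" and \<sigma>: "\<And>t v. t \<in> torus n \<Longrightarrow> T (\<sigma> t v) = \<sigma>' t (T v)"
    and R: "indexed_basis (dual sc) R" "slcm_wrt absv n \<psi> \<mu> sc \<sigma> R M"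
    and R': "indexed_basis (dual sc') R'" "slcm_wrt absv n \<psi> \<mu> sc' \<sigma>' R' M'"
  shows "conjugate_matrix_functions M M'"
proof -
  have inv_\<sigma>: "inv_into UNIV T (\<sigma>' t u) = \<sigma> t (inv_into UNIV T u)" if "t \<in> torus n" for t u
    using \<sigma>[OF that, of "inv_into UNIV T u"] inv_T[OF T] by metis
  have domain: "s \<in> slcm_domain absv n \<psi> \<mu> sc \<sigma> \<longleftrightarrow> s \<in> slcm_domain absv n \<psi> \<mu> sc' \<sigma>'" for s
  proof
    assume s: "s \<in> slcm_domain absv n \<psi> \<mu> sc \<sigma>"
    show "s \<in> slcm_domain absv n \<psi> \<mu> sc' \<sigma>'"
      by (rule slcm_domain_transport[OF T, of \<sigma> \<sigma>', OF \<sigma> slcm_domain_imp_symbols[OF emb gsi(1) R(2) s] s])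
  next
    assume s: "s \<in> slcm_domain absv n \<psi> \<mu> sc' \<sigma>'"
    show "s \<in> slcm_domain absv n \<psi> \<mu> sc \<sigma>"
      by (rule slcm_domain_transport[OF inv_T(1,2)[OF T], of \<sigma>' \<sigma>, OF inv_\<sigma> slcm_domain_imp_symbols[OF emb gsi(2) R'(2) s] s])
  qed
  have Rd: "R k \<in> dual sc" "R' k \<in> dual sc'" for k
    using R(1) R'(1) by (simp_all add: indexed_basis_def)
  have "\<exists>c. \<forall>v. R' i (T v) = (\<Sum>k\<in>UNIV. c k * R k v)" for i
    using indexed_basis_expand[OF R(1) dual_transport[OF T Rd(2)[of i]]] by metis
  then obtain p where p: "\<And>i v. R' i (T v) = (\<Sum>k\<in>UNIV. p i k * R k v)"
    by metis
  have "\<exists>c. \<forall>u. R i (inv_into UNIV T u) = (\<Sum>k\<in>UNIV. c k * R' k u)" for i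
    using indexed_basis_expand[OF R'(1) dual_transport[OF inv_T(1,2)[OF T] Rd(1)[of i]]] by metis
  then obtain q where q: "\<And>i u. R i (inv_into UNIV T u) = (\<Sum>k\<in>UNIV. q i k * R' k u)"
    by metis
  \<comment> \<open>Column i of \<open>P\<close> holds the coordinates of R' i composed with T in
    the basis R; \<open>Q\<close> does the same for the inverse of T. Neither involves s.\<close>
  define P :: "complex ^ 'i ^ 'i" where "P = (\<chi> k i. p i k)"
  define Q :: "complex ^ 'i ^ 'i" where "Q = (\<chi> k i. q i k)"
  have "(\<lambda>l. (Q ** P) $ l $ i) = (\<lambda>l. mat 1 $ l $ i)" for i
  proof (rule indexed_basis_coeffs_unique[OF R'(1)])
    fix u
    have "(\<Sum>l\<in>UNIV. (Q ** P) $ l $ i * R' l u) = (\<Sum>k\<in>UNIV. p i k * (\<Sum>l\<in>UNIV. q k l * R' l u))"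
      unfolding matrix_matrix_mult_def P_def Q_def
      by (simp add: sum_distrib_left sum_distrib_right mult_ac) (rule sum.swap)
    also have "\<dots> = (\<Sum>k\<in>UNIV. p i k * R k (inv_into UNIV T u))"
      by (simp add: q)
    also have "\<dots> = R' i u"
      using p[of i "inv_into UNIV T u"] by (simp add: inv_T[OF T])
    also have "\<dots> = (\<Sum>l\<in>UNIV. mat 1 $ l $ i * R' l u)"
      by (simp add: mat_def if_distrib[of "\<lambda>x. x * _"] cong: if_cong)
    finally show "(\<Sum>l\<in>UNIV. (Q ** P) $ l $ i * R' l u) = (\<Sum>l\<in>UNIV. mat 1 $ l $ i * R' l u)" .
  qed
  then have QP: "Q ** P = mat 1"
    by (simp add: vec_eq_iff fun_eq_iff)
  then have PQ: "P ** Q = mat 1"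
    using matrix_left_right_inverse by blast
  have "M' s = Q ** M s ** P" for s
  proof (cases "s \<in> slcm_domain absv n \<psi> \<mu> sc \<sigma>")
    case False
    then have "M s = 0" "M' s = 0"
      using R(2) R'(2) domain unfolding slcm_wrt_def by blast+
    then show ?thesis
      by simp
  next
    case True
    have good: symbols_in_roots
      by (rule slcm_domain_imp_symbols[OF emb gsi(1) R(2) True])
    let ?\<tau> = "twist absv sc \<sigma> s" and ?\<tau>' = "twist absv sc' \<sigma>' s"
    let ?w = "weyl_conj absv n ?\<tau>" and ?w' = "weyl_conj absv n ?\<tau>'"
    let ?J = "jacquet absv n \<psi> \<mu> sc ?\<tau>" and ?J' = "jacquet absv n \<psi> \<mu> sc' ?\<tau>'"
    let ?Jw = "jacquet absv n \<psi> \<mu> sc ?w" and ?Jw' = "jacquet absv n \<psi> \<mu> sc' ?w'"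
    have \<tau>: "T (?\<tau> t v) = ?\<tau>' t (T v)" if "t \<in> torus n" for t v
      using that by (simp add: twist_def T_scale[OF T] \<sigma>)
    have w: "T (?w t v) = ?w' t (T v)" if "t \<in> torus n" for t v
      using weyl_conj_torus[OF good that] by (simp add: weyl_conj_def \<tau>)
    have reg: "intertwining_regular absv n \<mu> sc ?\<tau>" "jacquet_regular absv n \<psi> \<mu> sc ?\<tau>"
      "jacquet_regular absv n \<psi> \<mu> sc ?w"
      using True by (simp_all add: slcm_domain_def)
    have rep: "represents (M s) (intertwining_pullback absv n \<mu> sc ?\<tau>) (whittaker absv n \<psi> sc ?w)
        (\<lambda>i. ?Jw (R i)) (whittaker absv n \<psi> sc ?\<tau>) (\<lambda>i. ?J (R i))"
      using R(2) True unfolding slcm_wrt_def by blast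
    have rep': "represents (M' s) (intertwining_pullback absv n \<mu> sc' ?\<tau>') (whittaker absv n \<psi> sc' ?w')
        (\<lambda>i. ?Jw' (R' i)) (whittaker absv n \<psi> sc' ?\<tau>') (\<lambda>i. ?J' (R' i))"
      using R'(2) True domain unfolding slcm_wrt_def by blast
    have basis: "indexed_basis (whittaker absv n \<psi> sc ?\<tau>) (\<lambda>i. ?J (R i))"
      using rep by (simp add: represents_def)
    have M: "intertwining_pullback absv n \<mu> sc ?\<tau> (?Jw (R i)) f = (\<Sum>j\<in>UNIV. M s $ j $ i * ?J (R j) f)" for i f
      using rep by (simp add: represents_def)
    have M': "intertwining_pullback absv n \<mu> sc' ?\<tau>' (?Jw' (R' i)) f = (\<Sum>j\<in>UNIV. M' s $ j $ i * ?J' (R' j) f)" for i f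
      using rep' by (simp add: represents_def)
    have J: "?J' (R' i) (\<lambda>g. T (f g)) = (\<Sum>k\<in>UNIV. p i k * ?J (R k) f)" for i f
      by (simp add: jacquet_transport[OF T, of ?\<tau> ?\<tau>', OF \<tau>] p jacquet_sum[OF reg(2) Rd(1)])
    have Jw: "?Jw' (R' i) (\<lambda>g. T (f g)) = (\<Sum>k\<in>UNIV. p i k * ?Jw (R k) f)" for i f
      by (simp add: jacquet_transport[OF T, of ?w ?w', OF w] p jacquet_sum[OF reg(3) Rd(1)])
    \<comment> \<open>Both are the coordinates, in the basis of Jacquet functionals of R, of f
      \<mapsto> A'(J'(R' i)) (T f), where A' is the pullback for the second realization: either R' i
      is expanded in R and M applied, or M' is applied and then R' expanded.\<close>
    have "(\<lambda>j. (M s ** P) $ j $ i) = (\<lambda>j. (P ** M' s) $ j $ i)" for i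
    proof (rule indexed_basis_coeffs_unique[OF basis])
      fix f
      have pull: "intertwining_pullback absv n \<mu> sc' ?\<tau>' (?Jw' (R' i)) (\<lambda>g. T (f g)) =
          (\<Sum>k\<in>UNIV. p i k * intertwining_pullback absv n \<mu> sc ?\<tau> (?Jw (R k)) f)"
      proof (cases "f \<in> induced absv n sc ?\<tau>")
        case f: True
        have "intertwining absv n \<mu> sc' (\<lambda>g. T (f g)) = (\<lambda>g. T (intertwining absv n \<mu> sc f g))"
          by (rule ext, rule intertwining_transport[OF T]) (use reg(1) f in \<open>simp add: intertwining_regular_def\<close>)
        then show ?thesis
          using f by (simp add: intertwining_pullback_def induced_transport_iff[OF T, of ?\<tau> ?\<tau>', OF \<tau>] Jw)
      qed (simp add: intertwining_pullback_def induced_transport_iff[OF T, of ?\<tau> ?\<tau>', OF \<tau>])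
      have "(\<Sum>j\<in>UNIV. (M s ** P) $ j $ i * ?J (R j) f) = (\<Sum>k\<in>UNIV. p i k * (\<Sum>j\<in>UNIV. M s $ j $ k * ?J (R j) f))"
        unfolding matrix_matrix_mult_def P_def
        by (simp add: sum_distrib_left sum_distrib_right mult_ac) (rule sum.swap)
      also have "\<dots> = (\<Sum>l\<in>UNIV. M' s $ l $ i * (\<Sum>j\<in>UNIV. p l j * ?J (R j) f))"
        using pull by (simp add: M M' J)
      also have "\<dots> = (\<Sum>j\<in>UNIV. (P ** M' s) $ j $ i * ?J (R j) f)"
        unfolding matrix_matrix_mult_def P_def
        by (simp add: sum_distrib_left sum_distrib_right mult_ac) (rule sum.swap)
      finally show "(\<Sum>j\<in>UNIV. (M s ** P) $ j $ i * ?J (R j) f) = (\<Sum>j\<in>UNIV. (P ** M' s) $ j $ i * ?J (R j) f)" .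
    qed
    then have "M s ** P = P ** M' s"
      by (simp add: vec_eq_iff fun_eq_iff)
    then have "Q ** M s ** P = (Q ** P) ** M' s"
      by (metis matrix_mul_assoc)
    then show ?thesis
      by (simp add: QP)
  qed
  then show ?thesis
    unfolding conjugate_iff using PQ QP by blast
qed

end

theorem proposition5p3:
  fixes absv :: "'f::field_char_0 \<Rightarrow> real"
    and n :: nat
    and \<iota> :: "'f \<Rightarrow> complex"
    and \<psi> :: "'f \<Rightarrow> complex"
    and \<mu> :: "'f measure"
    and sc :: "complex \<Rightarrow> 'v::ab_group_add \<Rightarrow> 'v"
    and \<sigma> :: "'f cover_elt \<Rightarrow> 'v \<Rightarrow> 'v"
    and sc' :: "complex \<Rightarrow> 'u::ab_group_add \<Rightarrow> 'u"
    and \<sigma>' :: "'f cover_elt \<Rightarrow> 'u \<Rightarrow> 'u"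
    and M M' :: "complex \<Rightarrow> complex ^ 'i::finite ^ 'i"
  assumes "padic_field absv"
    and "n \<ge> 1"
    and "card (roots_of_unity n :: 'f set) = n"
    and "unity_embedding n \<iota>"
    and "nontrivial_character absv \<psi>"
    and "self_dual_haar absv \<psi> \<mu>"
    and "genuine_smooth_irreducible absv n \<iota> sc \<sigma>"
    and "genuine_smooth_irreducible absv n \<iota> sc' \<sigma>'"
    and "isomorphic_reps n sc \<sigma> sc' \<sigma>'"
    and "is_slcm absv n \<psi> \<mu> sc \<sigma> M"
    and "is_slcm absv n \<psi> \<mu> sc' \<sigma>' M'"
  shows "conjugate_matrix_functions M M' \<and> conjugacy_class M = conjugacy_class M'"
proof -
  interpret kubota absv n
    using assms(1-3) by (simp add: kubota_def kubota_axioms_def)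
  obtain T where T: "Vector_Spaces.linear sc sc' T" "bij T" "\<And>t v. t \<in> torus n \<Longrightarrow> T (\<sigma> t v) = \<sigma>' t (T v)"
    using assms(9) unfolding isomorphic_reps_def by blast
  obtain R where R: "indexed_basis (dual sc) R" "slcm_wrt absv n \<psi> \<mu> sc \<sigma> R M"
    using assms(10) unfolding is_slcm_def by blast
  obtain R' where R': "indexed_basis (dual sc') R'" "slcm_wrt absv n \<psi> \<mu> sc' \<sigma>' R' M'"
    using assms(11) unfolding is_slcm_def by blast
  have "conjugate_matrix_functions M M'"
    by (rule slcm_conjugate[OF assms(4,7,8) T R R'])
  then show ?thesis
    using conjugacy_class_eq by blast
qed

end
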